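(* Let $C$ and $D$ be coalgebras over a field $k$ and let $\Psi'\in\mathsf{Tw}$, with $\Psi=\Psi'\circ\tau$, be such that $\varepsilon_\Psi=\phi_\Psi^{-1}$ (the inverse of $\phi_\Psi$ for the convolution product, which is thus assumed to exist) is invertible in $[(C\otimes D)',\star]$. Then $$\widetilde{\Psi}=(p_D\otimes p_C)\circ\Delta_\Psi\circ\mu^{-1}: C\otimes D\to D\otimes C$$ is a conormal twist, different from the flip $\tau$, and there are the two coalgebra isomorphisms $$C\otimes_\Psi D\simeq C\otimes_{\widetilde{\Psi}}D\simeq C\otimes D ,$$ where $C\otimes D$ carries the usual tensor product coalgebra structure.
   Context: All coalgebras are coassociative and counital over the field $k$, with Sweedler notation $\Delta(c)=c_{(1)}\otimes c_{(2)}$; $\tau: C\otimes D\to D\otimes C$ is the flip (the same symbol is used for the flip $D\otimes C\to C\otimes D$). A twist is a $k$-linear map $\Psi: C\otimes D\to D\otimes C$, and $\Psi'=\Psi\circ\tau: D\otimes C\to D\otimes C$. $\mathsf{Tw}$ is the set of $k$-linear maps $\Psi': D\otimes C\to D\otimes C$ with $(\Delta_D\otimes\mathrm{id}_C)\Psi'=(\mathrm{id}_D\otimes\Psi')(\Delta_D\otimes\mathrm{id}_C)$ and $(\mathrm{id}_D\otimes\Delta_C)\Psi'=(\Psi'\otimes\mathrm{id}_C)(\mathrm{id}_D\otimes\Delta_C)$. For a twist $\Psi$ the twisted coproduct is $\Delta_\Psi:=(\mathrm{id}_C\otimes\Psi\otimes\mathrm{id}_D)\circ(\Delta_C\otimes\Delta_D)$,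 and $C\otimes_\Psi D$ is the vector space $C\otimes D$ with coproduct $\Delta_\Psi$ and its counit. Put $\phi_\Psi=(\varepsilon_D\otimes\varepsilon_C)\circ\Psi$. For $\Psi'\in\mathsf{Tw}$ the coproduct $\Delta_\Psi$ is coassociative, and has a counit exactly when $\phi_\Psi$ is invertible for the convolution product $(\phi\ast\phi')(c\otimes d)=\phi(c_{(1)}\otimes d_{(1)})\phi'(c_{(2)}\otimes d_{(2)})$ on $(C\otimes D)'=\mathrm{Hom}_k(C\otimes D,k)$; the counit is then $\varepsilon_\Psi=\phi_\Psi^{-1}$. The product $\star$ on $(C\otimes D)'$ is $(\phi\star\phi')(c\otimes d)=\phi(c_{(2)}\otimes d_{(1)})\phi'(c_{(1)}\otimes d_{(2)})$, with unit $\varepsilon_C\otimes\varepsilon_D$. Put $p_C(c\otimes d)=c_{(1)}\varepsilon_\Psi(c_{(2)}\otimes d)$, $p_D(c\otimes d)=\varepsilon_\Psi(c\otimes d_{(1)})d_{(2)}$, and $\mu=(p_C\otimes p_D)\circ\Delta_\Psi: C\otimes_\Psi D\to C\otimes D$, which is bijective when $\varepsilon_\Psi$ is $\star$-invertible. A twist $\Psi$ is conormal if $(\varepsilon_D\otimes\mathrm{id}_C)\Psi=\mathrm{id}_C\otimes\varepsilon_D$ and $(\mathrm{id}_D\otimes\varepsilon_C)\Psi=\varepsilon_C\otimes\mathrm{id}_D$.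
   Formalization: "Different from the flip τ" fails for some Ψ (for Ψ = τ one gets Ψ̃ = τ), so it is replaced by: over every field k there are coalgebras C, D and Ψ' in Tw satisfying all hypotheses with Ψ̃ ≠ τ; the other conclusions hold for all C, D, Ψ'. *)

theory Defs
  imports Complex_Main "HOL-Library.Function_Algebras"
begin

section \<open>Vector spaces and their tensor products\<close>

text \<open>
  The ground field is the type \<open>'k\<close>.  A vector space is a linear subspace (\<open>pts\<close>) of a type which is
  a vector space under \<open>scal\<close>; the carrier is needed because a tensor product depends on the
  scalar multiplications of its factors and hence cannot be a type of its own.  Maps between
  spaces are only meaningful on carriers.
\<close>

record ('k, 'v) vspace =
  pts :: "'v set"
  scal :: "'k \<Rightarrow> 'v \<Rightarrow> 'v"

definition is_vspace :: "('k::field, 'v::ab_group_add, 'z) vspace_scheme \<Rightarrow> bool" where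
  "is_vspace V \<longleftrightarrow> vector_space (scal V) \<and> module.subspace (scal V) (pts V)"

definition ground :: "('k::field, 'k) vspace" where
  "ground = \<lparr>pts = UNIV, scal = (*)\<rparr>"

definition lin ::
  "('k::field, 'v::ab_group_add, 'y) vspace_scheme \<Rightarrow> ('k, 'w::ab_group_add, 'z) vspace_scheme
    \<Rightarrow> ('v \<Rightarrow> 'w) \<Rightarrow> bool" where
  "lin V W f \<longleftrightarrow>
     (\<forall>x\<in>pts V. f x \<in> pts W) \<and>
     (\<forall>x\<in>pts V. \<forall>y\<in>pts V. f (x + y) = f x + f y) \<and>
     (\<forall>a. \<forall>x\<in>pts V. f (scal V a x) = scal W a (f x))"

definition bilin ::
  "('k::field, 'v::ab_group_add, 'x) vspace_scheme \<Rightarrow> ('k, 'w::ab_group_add, 'y) vspace_scheme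
    \<Rightarrow> ('k, 'u::ab_group_add, 'z) vspace_scheme \<Rightarrow> ('v \<Rightarrow> 'w \<Rightarrow> 'u) \<Rightarrow> bool" where
  "bilin V W U B \<longleftrightarrow> (\<forall>w\<in>pts W. lin V U (\<lambda>v. B v w)) \<and> (\<forall>v\<in>pts V. lin W U (B v))"

text \<open>
  The tensor product is realised inside the dual of the space of bilinear forms: \<open>v \<otimes> w\<close> is
  evaluation at \<open>(v, w)\<close>, and \<open>V \<otimes> W\<close> is the span of these elements.  Over a field this is the usual
  tensor product; its universal property is given by \<open>tensor_universal_ex\<close> and \<open>tensor_universal_uniq\<close>, and everything after that is
  defined through the universal property only.
\<close>

type_synonym ('v, 'w, 'k) tensor = "('v \<Rightarrow> 'w \<Rightarrow> 'k) \<Rightarrow> 'k"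

definition tens ::
  "('k::field, 'v::ab_group_add, 'y) vspace_scheme \<Rightarrow> ('k, 'w::ab_group_add, 'z) vspace_scheme
    \<Rightarrow> 'v \<Rightarrow> 'w \<Rightarrow> ('v, 'w, 'k) tensor" where
  "tens V W v w = (\<lambda>\<beta>. if bilin V W ground \<beta> then \<beta> v w else 0)"

definition tensor_scal :: "'k::field \<Rightarrow> ('v, 'w, 'k) tensor \<Rightarrow> ('v, 'w, 'k) tensor" where
  "tensor_scal a t = (\<lambda>\<beta>. a * t \<beta>)"

definition tensor ::
  "('k::field, 'v::ab_group_add, 'y) vspace_scheme \<Rightarrow> ('k, 'w::ab_group_add, 'z) vspace_scheme
    \<Rightarrow> ('k, ('v, 'w, 'k) tensor) vspace"  (infixr \<open>\<otimes>\<close> 75) where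
  "V \<otimes> W =
     \<lparr>pts = module.span tensor_scal {tens V W v w | v w. v \<in> pts V \<and> w \<in> pts W},
      scal = tensor_scal\<rparr>"

text \<open>The linear map out of \<open>V \<otimes> W\<close> induced by a bilinear map.\<close>

definition lift ::
  "('k::field, 'v::ab_group_add, 'x) vspace_scheme \<Rightarrow> ('k, 'w::ab_group_add, 'y) vspace_scheme
    \<Rightarrow> ('k, 'u::ab_group_add, 'z) vspace_scheme \<Rightarrow> ('v \<Rightarrow> 'w \<Rightarrow> 'u)
    \<Rightarrow> ('v, 'w, 'k) tensor \<Rightarrow> 'u" where
  "lift V W U B =
     (SOME h. lin (V \<otimes> W) U h \<and> (\<forall>v\<in>pts V. \<forall>w\<in>pts W. h (tens V W v w) = B v w))"

lemma vector_space_tensor_scal: "vector_space (tensor_scal :: 'k::field \<Rightarrow> _)"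
  by unfold_locales (auto simp: tensor_scal_def fun_eq_iff algebra_simps)

lemma is_vspace_ground: "is_vspace (ground :: ('k::field, 'k) vspace)"
proof -
  have vs: "vector_space ((*) :: 'k \<Rightarrow> 'k \<Rightarrow> 'k)"
    by unfold_locales (auto simp: algebra_simps)
  interpret vector_space "(*) :: 'k \<Rightarrow> 'k \<Rightarrow> 'k" by (rule vs)
  show ?thesis
    using vs by (auto simp: is_vspace_def ground_def subspace_UNIV)
qed

lemma is_vspace_tensor: "is_vspace (V \<otimes> W)"
proof -
  interpret T: vector_space "tensor_scal :: 'a \<Rightarrow> ('b, 'c, 'a) tensor \<Rightarrow> _"
    by (rule vector_space_tensor_scal)
  show ?thesis
    unfolding is_vspace_def tensor_def using vector_space_tensor_scal T.subspace_span by auto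
qed

lemma bilin_tens:
  assumes "is_vspace V" "is_vspace W"
  shows "bilin V W (V \<otimes> W) (tens V W)"
proof -
  interpret T: vector_space "tensor_scal :: 'a \<Rightarrow> ('b, 'd, 'a) tensor \<Rightarrow> _"
    by (rule vector_space_tensor_scal)
  have "tens V W v w \<in> pts (V \<otimes> W)" if "v \<in> pts V" "w \<in> pts W" for v w
    using that by (auto simp: tensor_def intro!: T.span_base)
  then show ?thesis
    by (auto simp: bilin_def lin_def tens_def tensor_def tensor_scal_def ground_def fun_eq_iff)
qed

lemma functional_separates:
  fixes scale :: "'k::field \<Rightarrow> 'u::ab_group_add \<Rightarrow> 'u"
  assumes "vector_space scale" "u \<noteq> 0"
  shows "\<exists>f. Vector_Spaces.linear scale (*) f \<and> f u = 1"
proof -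
  interpret vector_space scale by fact
  interpret k: vector_space "(*) :: 'k \<Rightarrow> 'k \<Rightarrow> 'k"
    by unfold_locales (auto simp: algebra_simps)
  interpret vector_space_pair scale "(*) :: 'k \<Rightarrow> 'k \<Rightarrow> 'k" ..
  have "independent {u}"
    using assms by simp
  from linear_independent_extend[OF this, of "\<lambda>_. 1"] show ?thesis by auto
qed

theorem tensor_universal_ex:
  assumes V: "is_vspace V" and W: "is_vspace W" and U: "is_vspace U" and B: "bilin V W U B"
  shows "\<exists>h. lin (V \<otimes> W) U h \<and> (\<forall>v\<in>pts V. \<forall>w\<in>pts W. h (tens V W v w) = B v w)"
proof -
  let ?S = "{tens V W v w | v w. v \<in> pts V \<and> w \<in> pts W}"
  interpret T: vector_space "tensor_scal :: 'a \<Rightarrow> ('b, 'd, 'a) tensor \<Rightarrow> _"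
    by (rule vector_space_tensor_scal)
  interpret U: vector_space "scal U"
    using U by (simp add: is_vspace_def)
  have Usub: "U.subspace (pts U)"
    using U by (simp add: is_vspace_def)
  have S: "pts (V \<otimes> W) = T.span ?S" and sc: "scal (V \<otimes> W) = tensor_scal"
    by (simp_all add: tensor_def)

  define R where "R t u \<longleftrightarrow> t \<in> T.span ?S \<and> u \<in> pts U \<and>
     (\<forall>f. Vector_Spaces.linear (scal U) (*) f \<longrightarrow> f u = t (\<lambda>v w. f (B v w)))" for t u
  have Rtens: "R (tens V W v w) (B v w)" if vw: "v \<in> pts V" "w \<in> pts W" for v w
  proof -
    have "bilin V W ground (\<lambda>v w. f (B v w))" if "Vector_Spaces.linear (scal U) (*) f" for f
    proof -
      interpret f: Vector_Spaces.linear "scal U" "(*)" f by fact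
      show ?thesis
        using B by (auto simp: bilin_def lin_def ground_def f.add f.scale)
    qed
    then show ?thesis
      using vw B by (auto simp: R_def tens_def bilin_def lin_def intro!: T.span_base)
  qed
  have Radd: "R (t + t') (u + u')" if "R t u" "R t' u'" for t t' u u'
    using that U.subspace_add[OF Usub] T.span_add[of t ?S t']
    by (auto simp: R_def Vector_Spaces.linear_def module_hom_def module_hom_axioms_def)
  have Rscal: "R (tensor_scal a t) (scal U a u)" if "R t u" for a t u
    using that U.subspace_scale[OF Usub] T.span_scale[of t ?S a]
    by (auto simp: R_def Vector_Spaces.linear_def module_hom_def module_hom_axioms_def
        tensor_scal_def)
  have R0: "R 0 0"
    using U.subspace_0[OF Usub] T.span_zero
    by (auto simp: R_def Vector_Spaces.linear_def intro: module_hom.zero)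
  have Rex: "\<exists>u. R t u" if "t \<in> T.span ?S" for t
    using that
  proof (induction rule: T.span_induct_alt)
    case base
    then show ?case using R0 by blast
  next
    case (step a x y)
    then show ?case using Rtens Radd Rscal by blast
  qed
  have Runiq: "u = u'" if "R t u" "R t u'" for t u u'
  proof (rule ccontr)
    assume "u \<noteq> u'"
    then obtain f where f: "Vector_Spaces.linear (scal U) (*) f" "f (u - u') = 1"
      using functional_separates[OF U.vector_space_axioms, of "u - u'"] by auto
    interpret f: Vector_Spaces.linear "scal U" "(*)" f by fact
    have "f u = f u'"
      using that f(1) by (auto simp: R_def)
    then show False using f(2) by (simp add: f.diff)
  qed
  define h where "h t = (THE u. R t u)" for t
  have h: "R t u \<Longrightarrow> h t = u" for t u
    unfolding h_def using Runiq by blast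
  have Rh: "R t (h t)" if "t \<in> T.span ?S" for t
    using Rex[OF that] h by auto
  have "lin (V \<otimes> W) U h"
    unfolding lin_def S sc
    using Rh h Radd Rscal by (auto simp: R_def[of _ "h _"])
  moreover have "\<forall>v\<in>pts V. \<forall>w\<in>pts W. h (tens V W v w) = B v w"
    using h Rtens by blast
  ultimately show ?thesis by blast
qed

theorem tensor_universal_uniq:
  assumes V: "is_vspace V" and W: "is_vspace W" and U: "is_vspace U"
    and g: "lin (V \<otimes> W) U g" and h: "lin (V \<otimes> W) U h"
    and eq: "\<And>v w. v \<in> pts V \<Longrightarrow> w \<in> pts W \<Longrightarrow> g (tens V W v w) = h (tens V W v w)"
    and t: "t \<in> pts (V \<otimes> W)"
  shows "g t = h t"
proof -
  let ?S = "{tens V W v w | v w. v \<in> pts V \<and> w \<in> pts W}"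
  interpret T: vector_space "tensor_scal :: 'a \<Rightarrow> ('b, 'd, 'a) tensor \<Rightarrow> _"
    by (rule vector_space_tensor_scal)
  have S: "pts (V \<otimes> W) = T.span ?S" and sc: "scal (V \<otimes> W) = tensor_scal"
    by (simp_all add: tensor_def)
  have zero: "k 0 = 0" if "lin (V \<otimes> W) U k" for k
  proof -
    have "k (0 + 0) = k 0 + k 0"
      using that T.span_zero unfolding lin_def S by blast
    then show ?thesis by simp
  qed
  have "t \<in> T.span ?S" using t by (simp add: S)
  then have "t \<in> T.span ?S \<and> g t = h t"
  proof (induction rule: T.span_induct_alt)
    case base
    show ?case unfolding zero[OF g] zero[OF h] by (intro conjI T.span_zero refl)
  next
    case (step a x y)
    then have x: "x \<in> T.span ?S" and gx: "g x = h x"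
      using eq by (auto intro: T.span_base)
    have ax: "tensor_scal a x \<in> T.span ?S" by (simp add: x T.span_scale)
    have add: "k (tensor_scal a x + y) = scal U a (k x) + k y" if "lin (V \<otimes> W) U k" for k
      using that x step ax unfolding lin_def S sc by simp
    have "tensor_scal a x + y \<in> T.span ?S"
      using step by (intro T.span_add ax) simp
    moreover have "g y = h y"
      using step by simp
    then have "g (tensor_scal a x + y) = h (tensor_scal a x + y)"
      unfolding add[OF g] add[OF h] gx by (rule arg_cong)
    ultimately show ?case ..
  qed
  then show ?thesis by simp
qed

definition tmap ::
  "('k::field, 'v::ab_group_add, 'x) vspace_scheme \<Rightarrow> ('k, 'w::ab_group_add, 'y) vspace_scheme
    \<Rightarrow> ('k, 'v2::ab_group_add, 'x2) vspace_scheme \<Rightarrow> ('k, 'w2::ab_group_add, 'y2) vspace_scheme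
    \<Rightarrow> ('v \<Rightarrow> 'v2) \<Rightarrow> ('w \<Rightarrow> 'w2) \<Rightarrow> ('v, 'w, 'k) tensor \<Rightarrow> ('v2, 'w2, 'k) tensor" where
  "tmap V W V' W' f g = lift V W (V' \<otimes> W') (\<lambda>v w. tens V' W' (f v) (g w))"

definition flip ::
  "('k::field, 'v::ab_group_add, 'x) vspace_scheme \<Rightarrow> ('k, 'w::ab_group_add, 'y) vspace_scheme
    \<Rightarrow> ('v, 'w, 'k) tensor \<Rightarrow> ('w, 'v, 'k) tensor" where
  "flip V W = lift V W (W \<otimes> V) (\<lambda>v w. tens W V w v)"

definition assoc ::
  "('k::field, 'u::ab_group_add, 'x) vspace_scheme \<Rightarrow> ('k, 'v::ab_group_add, 'y) vspace_scheme
    \<Rightarrow> ('k, 'w::ab_group_add, 'z) vspace_scheme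
    \<Rightarrow> (('u, 'v, 'k) tensor, 'w, 'k) tensor \<Rightarrow> ('u, ('v, 'w, 'k) tensor, 'k) tensor" where
  "assoc U V W = lift (U \<otimes> V) W (U \<otimes> (V \<otimes> W))
     (\<lambda>t w. lift U V (U \<otimes> (V \<otimes> W)) (\<lambda>u v. tens U (V \<otimes> W) u (tens V W v w)) t)"

definition assoc_inv ::
  "('k::field, 'u::ab_group_add, 'x) vspace_scheme \<Rightarrow> ('k, 'v::ab_group_add, 'y) vspace_scheme
    \<Rightarrow> ('k, 'w::ab_group_add, 'z) vspace_scheme
    \<Rightarrow> ('u, ('v, 'w, 'k) tensor, 'k) tensor \<Rightarrow> (('u, 'v, 'k) tensor, 'w, 'k) tensor" where
  "assoc_inv U V W = lift U (V \<otimes> W) ((U \<otimes> V) \<otimes> W)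
     (\<lambda>u t. lift V W ((U \<otimes> V) \<otimes> W) (\<lambda>v w. tens (U \<otimes> V) W (tens U V u v) w) t)"

section \<open>Coalgebras\<close>

record ('k, 'v) coalg = "('k, 'v) vspace" +
  comult :: "'v \<Rightarrow> ('v, 'v, 'k) tensor"
  counit :: "'v \<Rightarrow> 'k"

definition is_counit ::
  "('k::field, 'v::ab_group_add, 'z) vspace_scheme \<Rightarrow> ('v \<Rightarrow> ('v, 'v, 'k) tensor)
    \<Rightarrow> ('v \<Rightarrow> 'k) \<Rightarrow> bool" where
  "is_counit V \<Delta> \<epsilon> \<longleftrightarrow> lin V ground \<epsilon> \<and>
     (\<forall>x\<in>pts V. lift V V V (\<lambda>y z. scal V (\<epsilon> y) z) (\<Delta> x) = x \<and>
                 lift V V V (\<lambda>y z. scal V (\<epsilon> z) y) (\<Delta> x) = x)"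

definition coassociative ::
  "('k::field, 'v::ab_group_add, 'z) vspace_scheme \<Rightarrow> ('v \<Rightarrow> ('v, 'v, 'k) tensor) \<Rightarrow> bool" where
  "coassociative V \<Delta> \<longleftrightarrow>
     (\<forall>x\<in>pts V. assoc V V V (tmap V V (V \<otimes> V) V \<Delta> id (\<Delta> x)) = tmap V V V (V \<otimes> V) id \<Delta> (\<Delta> x))"

definition coalgebra :: "('k::field, 'v::ab_group_add, 'z) coalg_scheme \<Rightarrow> bool" where
  "coalgebra C \<longleftrightarrow> is_vspace C \<and> lin C (C \<otimes> C) (comult C) \<and>
     coassociative C (comult C) \<and> is_counit C (comult C) (counit C)"

definition coalgebra_iso ::
  "('k::field, 'v::ab_group_add, 'y) coalg_scheme \<Rightarrow> ('k, 'w::ab_group_add, 'z) coalg_scheme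
    \<Rightarrow> ('v \<Rightarrow> 'w) \<Rightarrow> bool" where
  "coalgebra_iso C D f \<longleftrightarrow> coalgebra C \<and> coalgebra D \<and>
     lin C D f \<and> bij_betw f (pts C) (pts D) \<and>
     (\<forall>x\<in>pts C. comult D (f x) = tmap C C D D f f (comult C x)) \<and>
     (\<forall>x\<in>pts C. counit D (f x) = counit C x)"

definition isomorphic ::
  "('k::field, 'v::ab_group_add, 'y) coalg_scheme \<Rightarrow> ('k, 'w::ab_group_add, 'z) coalg_scheme
    \<Rightarrow> bool"  (infix \<open>\<simeq>\<close> 50) where
  "C \<simeq> D \<longleftrightarrow> (\<exists>f. coalgebra_iso C D f)"

text \<open>\<open>sw C U F c\<close> is the Sweedler sum of \<open>F c\<^sub>(\<^sub>1\<^sub>) c\<^sub>(\<^sub>2\<^sub>)\<close>, with values in \<open>U\<close>.\<close>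

definition sw ::
  "('k::field, 'v::ab_group_add, 'y) coalg_scheme \<Rightarrow> ('k, 'u::ab_group_add, 'z) vspace_scheme
    \<Rightarrow> ('v \<Rightarrow> 'v \<Rightarrow> 'u) \<Rightarrow> 'v \<Rightarrow> 'u" where
  "sw C U F c = lift C C U F (comult C c)"

section \<open>Twists\<close>

definition twist ::
  "('k::field, 'c::ab_group_add) coalg \<Rightarrow> ('k, 'd::ab_group_add) coalg
    \<Rightarrow> (('c, 'd, 'k) tensor \<Rightarrow> ('d, 'c, 'k) tensor) \<Rightarrow> bool" where
  "twist C D \<Psi> \<longleftrightarrow> lin (C \<otimes> D) (D \<otimes> C) \<Psi>"

definition Tw ::
  "('k::field, 'c::ab_group_add) coalg \<Rightarrow> ('k, 'd::ab_group_add) coalg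
    \<Rightarrow> (('d, 'c, 'k) tensor \<Rightarrow> ('d, 'c, 'k) tensor) set" where
  "Tw C D = {\<Psi>'. lin (D \<otimes> C) (D \<otimes> C) \<Psi>' \<and>
     (\<forall>t\<in>pts (D \<otimes> C).
        assoc D D C (tmap D C (D \<otimes> D) C (comult D) id (\<Psi>' t)) =
        tmap D (D \<otimes> C) D (D \<otimes> C) id \<Psi>' (assoc D D C (tmap D C (D \<otimes> D) C (comult D) id t))) \<and>
     (\<forall>t\<in>pts (D \<otimes> C).
        assoc_inv D C C (tmap D C D (C \<otimes> C) id (comult C) (\<Psi>' t)) =
        tmap (D \<otimes> C) C (D \<otimes> C) C \<Psi>' id (assoc_inv D C C (tmap D C D (C \<otimes> C) id (comult C) t)))}"

text \<open>
  \<open>mid C D \<Psi>\<close> is \<open>id\<^sub>C \<otimes> \<Psi> \<otimes> id\<^sub>D\<close>, from \<open>(C \<otimes> C) \<otimes> (D \<otimes> D)\<close> to \<open>(C \<otimes> D) \<otimes> (C \<otimes> D)\<close>.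
\<close>

definition mid ::
  "('k::field, 'c::ab_group_add) coalg \<Rightarrow> ('k, 'd::ab_group_add) coalg
    \<Rightarrow> (('c, 'd, 'k) tensor \<Rightarrow> ('d, 'c, 'k) tensor)
    \<Rightarrow> (('c, 'c, 'k) tensor, ('d, 'd, 'k) tensor, 'k) tensor
    \<Rightarrow> (('c, 'd, 'k) tensor, ('c, 'd, 'k) tensor, 'k) tensor" where
  "mid C D \<Psi> =
     assoc_inv C D (C \<otimes> D)
     \<circ> tmap C ((D \<otimes> C) \<otimes> D) C (D \<otimes> (C \<otimes> D)) id (assoc D C D)
     \<circ> tmap C ((C \<otimes> D) \<otimes> D) C ((D \<otimes> C) \<otimes> D) id (tmap (C \<otimes> D) D (D \<otimes> C) D \<Psi> id)
     \<circ> tmap C (C \<otimes> (D \<otimes> D)) C ((C \<otimes> D) \<otimes> D) id (assoc_inv C D D)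
     \<circ> assoc C C (D \<otimes> D)"

definition twisted_comult ::
  "('k::field, 'c::ab_group_add) coalg \<Rightarrow> ('k, 'd::ab_group_add) coalg
    \<Rightarrow> (('c, 'd, 'k) tensor \<Rightarrow> ('d, 'c, 'k) tensor)
    \<Rightarrow> ('c, 'd, 'k) tensor \<Rightarrow> (('c, 'd, 'k) tensor, ('c, 'd, 'k) tensor, 'k) tensor" where
  "twisted_comult C D \<Psi> = mid C D \<Psi> \<circ> tmap C D (C \<otimes> C) (D \<otimes> D) (comult C) (comult D)"

text \<open>
  The counit of a coproduct is unique on the carrier when it exists; if it does not exist, the
  field \<open>counit\<close> below is arbitrary and \<open>coalgebra\<close> fails.
\<close>

definition twisted_tensor ::
  "('k::field, 'c::ab_group_add) coalg \<Rightarrow> ('k, 'd::ab_group_add) coalg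
    \<Rightarrow> (('c, 'd, 'k) tensor \<Rightarrow> ('d, 'c, 'k) tensor) \<Rightarrow> ('k, ('c, 'd, 'k) tensor) coalg" where
  "twisted_tensor C D \<Psi> =
     \<lparr>pts = pts (C \<otimes> D), scal = scal (C \<otimes> D),
      comult = twisted_comult C D \<Psi>,
      counit = (SOME \<epsilon>. is_counit (C \<otimes> D) (twisted_comult C D \<Psi>) \<epsilon>)\<rparr>"

definition counit2 ::
  "('k::field, 'c::ab_group_add) coalg \<Rightarrow> ('k, 'd::ab_group_add) coalg
    \<Rightarrow> ('c, 'd, 'k) tensor \<Rightarrow> 'k" where
  "counit2 C D = lift C D ground (\<lambda>c d. counit C c * counit D d)"

definition tensor_coalgebra ::
  "('k::field, 'c::ab_group_add) coalg \<Rightarrow> ('k, 'd::ab_group_add) coalg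
    \<Rightarrow> ('k, ('c, 'd, 'k) tensor) coalg" where
  "tensor_coalgebra C D =
     \<lparr>pts = pts (C \<otimes> D), scal = scal (C \<otimes> D),
      comult = mid C D (flip C D) \<circ> tmap C D (C \<otimes> C) (D \<otimes> D) (comult C) (comult D),
      counit = counit2 C D\<rparr>"

definition phi ::
  "('k::field, 'c::ab_group_add) coalg \<Rightarrow> ('k, 'd::ab_group_add) coalg
    \<Rightarrow> (('c, 'd, 'k) tensor \<Rightarrow> ('d, 'c, 'k) tensor) \<Rightarrow> ('c, 'd, 'k) tensor \<Rightarrow> 'k" where
  "phi C D \<Psi> = counit2 D C \<circ> \<Psi>"

definition conv ::
  "('k::field, 'c::ab_group_add) coalg \<Rightarrow> ('k, 'd::ab_group_add) coalg
    \<Rightarrow> (('c, 'd, 'k) tensor \<Rightarrow> 'k) \<Rightarrow> (('c, 'd, 'k) tensor \<Rightarrow> 'k) \<Rightarrow> ('c, 'd, 'k) tensor \<Rightarrow> 'k" where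
  "conv C D \<phi> \<phi>' = lift C D ground (\<lambda>c d.
     sw C ground (\<lambda>c1 c2. sw D ground (\<lambda>d1 d2.
       \<phi> (tens C D c1 d1) * \<phi>' (tens C D c2 d2)) d) c)"

definition star ::
  "('k::field, 'c::ab_group_add) coalg \<Rightarrow> ('k, 'd::ab_group_add) coalg
    \<Rightarrow> (('c, 'd, 'k) tensor \<Rightarrow> 'k) \<Rightarrow> (('c, 'd, 'k) tensor \<Rightarrow> 'k) \<Rightarrow> ('c, 'd, 'k) tensor \<Rightarrow> 'k" where
  "star C D \<phi> \<phi>' = lift C D ground (\<lambda>c d.
     sw C ground (\<lambda>c1 c2. sw D ground (\<lambda>d1 d2.
       \<phi> (tens C D c2 d1) * \<phi>' (tens C D c1 d2)) d) c)"

text \<open>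
  Two-sided inverses in \<open>(C \<otimes> D)'\<close> for a product \<open>m\<close> (\<open>conv C D\<close> or \<open>star C D\<close>), both of which have
  the unit \<open>\<epsilon>\<^sub>C \<otimes> \<epsilon>\<^sub>D\<close>.
\<close>

definition is_inverse ::
  "('k::field, 'c::ab_group_add) coalg \<Rightarrow> ('k, 'd::ab_group_add) coalg
    \<Rightarrow> ((('c, 'd, 'k) tensor \<Rightarrow> 'k) \<Rightarrow> (('c, 'd, 'k) tensor \<Rightarrow> 'k) \<Rightarrow> ('c, 'd, 'k) tensor \<Rightarrow> 'k)
    \<Rightarrow> (('c, 'd, 'k) tensor \<Rightarrow> 'k) \<Rightarrow> (('c, 'd, 'k) tensor \<Rightarrow> 'k) \<Rightarrow> bool" where
  "is_inverse C D m \<phi> \<psi> \<longleftrightarrow>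
     lin (C \<otimes> D) ground \<phi> \<and> lin (C \<otimes> D) ground \<psi> \<and>
     (\<forall>t\<in>pts (C \<otimes> D). m \<phi> \<psi> t = counit2 C D t \<and> m \<psi> \<phi> t = counit2 C D t)"

definition conv_invertible ::
  "('k::field, 'c::ab_group_add) coalg \<Rightarrow> ('k, 'd::ab_group_add) coalg
    \<Rightarrow> (('c, 'd, 'k) tensor \<Rightarrow> 'k) \<Rightarrow> bool" where
  "conv_invertible C D \<phi> \<longleftrightarrow> (\<exists>\<psi>. is_inverse C D (conv C D) \<phi> \<psi>)"

definition star_invertible ::
  "('k::field, 'c::ab_group_add) coalg \<Rightarrow> ('k, 'd::ab_group_add) coalg
    \<Rightarrow> (('c, 'd, 'k) tensor \<Rightarrow> 'k) \<Rightarrow> bool" where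
  "star_invertible C D \<phi> \<longleftrightarrow> (\<exists>\<psi>. is_inverse C D (star C D) \<phi> \<psi>)"

definition eps ::
  "('k::field, 'c::ab_group_add) coalg \<Rightarrow> ('k, 'd::ab_group_add) coalg
    \<Rightarrow> (('c, 'd, 'k) tensor \<Rightarrow> ('d, 'c, 'k) tensor) \<Rightarrow> ('c, 'd, 'k) tensor \<Rightarrow> 'k" where
  "eps C D \<Psi> = (SOME \<psi>. is_inverse C D (conv C D) (phi C D \<Psi>) \<psi>)"

definition p_C ::
  "('k::field, 'c::ab_group_add) coalg \<Rightarrow> ('k, 'd::ab_group_add) coalg
    \<Rightarrow> (('c, 'd, 'k) tensor \<Rightarrow> ('d, 'c, 'k) tensor) \<Rightarrow> ('c, 'd, 'k) tensor \<Rightarrow> 'c" where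
  "p_C C D \<Psi> = lift C D C (\<lambda>c d. sw C C (\<lambda>c1 c2. scal C (eps C D \<Psi> (tens C D c2 d)) c1) c)"

definition p_D ::
  "('k::field, 'c::ab_group_add) coalg \<Rightarrow> ('k, 'd::ab_group_add) coalg
    \<Rightarrow> (('c, 'd, 'k) tensor \<Rightarrow> ('d, 'c, 'k) tensor) \<Rightarrow> ('c, 'd, 'k) tensor \<Rightarrow> 'd" where
  "p_D C D \<Psi> = lift C D D (\<lambda>c d. sw D D (\<lambda>d1 d2. scal D (eps C D \<Psi> (tens C D c d1)) d2) d)"

definition mu ::
  "('k::field, 'c::ab_group_add) coalg \<Rightarrow> ('k, 'd::ab_group_add) coalg
    \<Rightarrow> (('c, 'd, 'k) tensor \<Rightarrow> ('d, 'c, 'k) tensor) \<Rightarrow> ('c, 'd, 'k) tensor \<Rightarrow> ('c, 'd, 'k) tensor" where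
  "mu C D \<Psi> = tmap (C \<otimes> D) (C \<otimes> D) C D (p_C C D \<Psi>) (p_D C D \<Psi>) \<circ> twisted_comult C D \<Psi>"

definition tilde_twist ::
  "('k::field, 'c::ab_group_add) coalg \<Rightarrow> ('k, 'd::ab_group_add) coalg
    \<Rightarrow> (('c, 'd, 'k) tensor \<Rightarrow> ('d, 'c, 'k) tensor) \<Rightarrow> ('c, 'd, 'k) tensor \<Rightarrow> ('d, 'c, 'k) tensor" where
  "tilde_twist C D \<Psi> =
     tmap (C \<otimes> D) (C \<otimes> D) D C (p_D C D \<Psi>) (p_C C D \<Psi>) \<circ> twisted_comult C D \<Psi>
     \<circ> the_inv_into (pts (C \<otimes> D)) (mu C D \<Psi>)"

definition conormal ::
  "('k::field, 'c::ab_group_add) coalg \<Rightarrow> ('k, 'd::ab_group_add) coalg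
    \<Rightarrow> (('c, 'd, 'k) tensor \<Rightarrow> ('d, 'c, 'k) tensor) \<Rightarrow> bool" where
  "conormal C D \<Psi> \<longleftrightarrow> (\<forall>t\<in>pts (C \<otimes> D).
     lift D C C (\<lambda>d c. scal C (counit D d) c) (\<Psi> t) = lift C D C (\<lambda>c d. scal C (counit D d) c) t \<and>
     lift D C D (\<lambda>d c. scal D (counit C c) d) (\<Psi> t) = lift C D D (\<lambda>c d. scal D (counit C c) d) t)"

end

theory Submission
  imports Defs
begin

text \<open>
  Write \<open>X = C \<otimes> D\<close> for the ordinary tensor product coalgebra and \<open>x\<^sub>1 \<otimes> x\<^sub>2\<close> for its coproduct, \<open>\<phi>\<close> for the form
  \<open>(\<epsilon>\<^sub>D \<otimes> \<epsilon>\<^sub>C) \<Psi>\<close> and \<open>e\<close> for its convolution inverse.  The two conditions that define \<open>Tw\<close> are colinearity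
  conditions, and they determine the twist by its form: \<open>\<Psi> (c \<otimes> d)\<close> is \<open>\<phi> (c\<^sub>1 \<otimes> d\<^sub>2)\<close> times \<open>d\<^sub>1 \<otimes> c\<^sub>2\<close>
  (\<open>Tw_eq_twist_of_form\<close>).  Hence the twisted coproduct is \<open>\<Delta>\<^sub>\<Psi> x = \<phi> (x\<^sub>2) x\<^sub>1 \<otimes> x\<^sub>3\<close> (\<open>Delta_Psi\<close>), a formula in which only
  the single coalgebra \<open>X\<close> occurs.

  From there on the proof is algebra in the convolution algebra of \<open>X\<close>.  Linear forms act from the left and
  from the right on linear maps out of \<open>X\<close>, \<open>(e \<triangleright> F) x = e (x\<^sub>1) F (x\<^sub>2)\<close> and \<open>(F \<triangleleft> e) x = F (x\<^sub>1) e (x\<^sub>2)\<close>,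
  and two linear maps have a product \<open>(F \<odot> G) x = F x\<^sub>1 \<otimes> G x\<^sub>2\<close>.  These operations are associative in every
  sense that the types allow, all for the same reason (\<open>convol_assoc\<close>), and every map of the theorem is a
  word in them.  With \<open>\<pi>C\<close> and \<open>\<pi>D\<close> the projections of \<open>X\<close> to its factors,
  \<open>p_C = \<pi>C \<triangleleft> e\<close>, \<open>p_D = e \<triangleright> \<pi>D\<close>, \<open>\<Delta>\<^sub>\<Psi> = (id \<triangleleft> \<phi>) \<odot> id\<close>, and therefore
  \<open>(F \<otimes> G) \<Delta>\<^sub>\<Psi> = (F \<triangleleft> \<phi>) \<odot> G\<close> for all linear \<open>F\<close> and \<open>G\<close> (\<open>tmap_Delta_Psi\<close>).

  This gives \<open>\<mu> = \<pi>C \<odot> p_D\<close> and \<open>\<Psi>t \<mu> = (p_D \<triangleleft> \<phi>) \<odot> p_C\<close> for the new twist \<open>\<Psi>t\<close>.  Applying a counit to one factor of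
  these two expressions shows that \<open>\<Psi>t\<close> is conormal (\<open>conormal_tilde\<close>).  Since \<open>\<pi>C\<close> and \<open>\<pi>D\<close> are
  coalgebra maps, reassociating the factors yields
  \<open>\<Delta>\<^bsub>\<Psi>t\<^esub> \<mu> = (\<mu> \<triangleleft> \<phi>) \<odot> \<mu> = (\<mu> \<otimes> \<mu>) \<Delta>\<^sub>\<Psi>\<close> (\<open>comult_mu\<close>), which is the first isomorphism.  The map \<open>\<alpha> = e \<triangleright> id\<close>
  satisfies \<open>(\<alpha> \<otimes> \<alpha>) \<Delta>\<^sub>\<Psi> = e \<triangleright> (id \<odot> id) = \<Delta>\<^sub>X \<alpha>\<close> (\<open>comult_alpha\<close>), so \<open>C \<otimes>\<^sub>\<Psi> D\<close> is isomorphic to \<open>X\<close>, and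
  the second isomorphism is \<open>\<alpha> \<mu>\<^sup>-\<^sup>1\<close>.

  Both bijections have the same shape.  The inverse of \<open>e \<triangleright> id\<close> is \<open>\<phi> \<triangleright> id\<close>.  The map \<open>\<mu>\<close> sends \<open>c \<otimes> d\<close> to
  \<open>e (c\<^sub>2 \<otimes> d\<^sub>1) c\<^sub>1 \<otimes> d\<^sub>2\<close>, which is again \<open>e \<triangleright> id\<close>, but for the tensor product of \<open>D\<close> with the co-opposite
  coalgebra of \<open>C\<close>; the product \<open>\<star>\<close> is the convolution product of that coalgebra, and so \<open>\<star>\<close>-invertibility of
  \<open>e\<close> makes \<open>\<mu>\<close> bijective.

  That \<open>\<Psi>t\<close> can differ from the flip needs an example in which neither coalgebra is cocommutative.  The
  smallest one works over every field: \<open>C = D\<close> is spanned by two grouplike elements \<open>g\<close>, \<open>h\<close> and by \<open>x\<close> with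
  \<open>\<Delta> x = g \<otimes> x + x \<otimes> h\<close>, and \<open>e = \<epsilon> \<otimes> \<epsilon> + x\<^sup>* \<otimes> x\<^sup>*\<close>.  Every form \<open>p\<close> on \<open>C\<close> satisfies \<open>x\<^sup>* p x\<^sup>* = 0\<close>, and
  therefore the transposes of \<open>\<Psi>t \<mu>\<close> and of the flip after \<open>\<mu>\<close>, which map \<open>q \<otimes> p\<close> to a form on \<open>C \<otimes> D\<close>, differ exactly by
  the product of commutators \<open>[x\<^sup>*, p] \<otimes> [x\<^sup>*, q]\<close>.  It is not zero at \<open>p = q = g\<^sup>*\<close>.
\<close>

section \<open>Linear and bilinear maps\<close>

lemma lin_mem: "lin V W f \<Longrightarrow> x \<in> pts V \<Longrightarrow> f x \<in> pts W"
  and lin_add: "lin V W f \<Longrightarrow> x \<in> pts V \<Longrightarrow> y \<in> pts V \<Longrightarrow> f (x + y) = f x + f y"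
  and lin_scal: "lin V W f \<Longrightarrow> x \<in> pts V \<Longrightarrow> f (scal V a x) = scal W a (f x)"
  by (auto simp: lin_def)

context
  fixes V :: "('k::field, 'v::ab_group_add, 'z) vspace_scheme"
  assumes V: "is_vspace V"
begin

interpretation V: vector_space "scal V" using V by (simp add: is_vspace_def)

lemma vspace_zero: "0 \<in> pts V"
  and vspace_add: "x \<in> pts V \<Longrightarrow> y \<in> pts V \<Longrightarrow> x + y \<in> pts V"
  and vspace_scal: "x \<in> pts V \<Longrightarrow> scal V a x \<in> pts V"
  using V by (auto simp: is_vspace_def V.subspace_0 V.subspace_add V.subspace_scale)

lemma scal_simps:
  "scal V a (x + y) = scal V a x + scal V a y" "scal V (a + b) x = scal V a x + scal V b x"
  "scal V a (scal V b x) = scal V (a * b) x" "scal V 1 x = x" "scal V 0 x = 0" "scal V a 0 = 0"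
  by (simp_all add: V.scale_right_distrib V.scale_left_distrib)

lemma bilin_scal: "bilin ground V V (scal V)" "bilin V ground V (\<lambda>v a. scal V a v)"
  by (auto simp: bilin_def lin_def ground_def scal_simps vspace_scal mult.commute)

end

lemma is_vspace_simps [simp]: "is_vspace (V \<otimes> W)" "is_vspace ground"
  by (rule is_vspace_tensor is_vspace_ground)+

lemma pts_ground [simp]: "pts ground = UNIV" and scal_ground [simp]: "scal ground = (*)"
  by (simp_all add: ground_def)

lemma bilinI:
  assumes "\<And>w. w \<in> pts W \<Longrightarrow> lin V U (\<lambda>v. B v w)" "\<And>v. v \<in> pts V \<Longrightarrow> lin W U (B v)"
  shows "bilin V W U B"
  using assms by (simp add: bilin_def)

lemma bilin_left: "bilin V W U B \<Longrightarrow> w \<in> pts W \<Longrightarrow> lin V U (\<lambda>v. B v w)"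
  and bilin_right: "bilin V W U B \<Longrightarrow> v \<in> pts V \<Longrightarrow> lin W U (B v)"
  by (auto simp: bilin_def)

lemma bilin_mem: "bilin V W U B \<Longrightarrow> v \<in> pts V \<Longrightarrow> w \<in> pts W \<Longrightarrow> B v w \<in> pts U"
  by (auto simp: bilin_def lin_def)

lemma lin_ident: "lin V V (\<lambda>x. x)"
  by (simp add: lin_def)

lemma lin_compose: "lin W U g \<Longrightarrow> lin V W f \<Longrightarrow> lin V U (\<lambda>x. g (f x))"
  by (simp add: lin_def)

lemma lin_bilin_left: "bilin A B U m \<Longrightarrow> lin V A f \<Longrightarrow> b \<in> pts B \<Longrightarrow> lin V U (\<lambda>x. m (f x) b)"
  and lin_bilin_right: "bilin A B U m \<Longrightarrow> lin V B g \<Longrightarrow> a \<in> pts A \<Longrightarrow> lin V U (\<lambda>x. m a (g x))"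
  by (auto simp: bilin_def lin_def)

lemma bilin_compose:
  assumes "bilin A B U m" "lin V A f" "lin W B g"
  shows "bilin V W U (\<lambda>v w. m (f v) (g w))"
  using assms by (auto simp: bilin_def lin_def)

lemma bilin_post: "bilin A B U m \<Longrightarrow> lin U U' h \<Longrightarrow> bilin A B U' (\<lambda>a b. h (m a b))"
  by (auto simp: bilin_def lin_def)

lemma lin_cong: "is_vspace V \<Longrightarrow> (\<And>x. x \<in> pts V \<Longrightarrow> f x = g x) \<Longrightarrow> lin V W f \<longleftrightarrow> lin V W g"
  by (auto simp: lin_def vspace_add vspace_scal)

lemma lin_scal_left: "lin V ground f \<Longrightarrow> u \<in> pts U \<Longrightarrow> is_vspace U \<Longrightarrow> lin V U (\<lambda>x. scal U (f x) u)"
  and lin_scal_right: "lin V U g \<Longrightarrow> is_vspace U \<Longrightarrow> lin V U (\<lambda>x. scal U k (g x))"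
  by (auto simp: lin_def scal_simps vspace_scal mult.commute)

lemma lin_mult_left: "lin V ground f \<Longrightarrow> lin V ground (\<lambda>x. f x * k)"
  and lin_mult_right: "lin V ground f \<Longrightarrow> lin V ground (\<lambda>x. k * f x)"
  by (auto simp: lin_def algebra_simps)

lemma lin_plus:
  "lin V U f \<Longrightarrow> lin V U g \<Longrightarrow> is_vspace U \<Longrightarrow> lin V U (\<lambda>x. f x + g x)"
  by (auto simp: lin_def scal_simps vspace_add algebra_simps)

section \<open>Tensor products\<close>

lemma tens_mem: "is_vspace V \<Longrightarrow> is_vspace W \<Longrightarrow> v \<in> pts V \<Longrightarrow> w \<in> pts W \<Longrightarrow> tens V W v w \<in> pts (V \<otimes> W)"
  using bilin_tens bilin_mem by blast

lemma lin_tens_left: "is_vspace V \<Longrightarrow> is_vspace W \<Longrightarrow> lin A V f \<Longrightarrow> w \<in> pts W \<Longrightarrow> lin A (V \<otimes> W) (\<lambda>x. tens V W (f x) w)"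
  and lin_tens_right: "is_vspace V \<Longrightarrow> is_vspace W \<Longrightarrow> lin A W g \<Longrightarrow> v \<in> pts V \<Longrightarrow> lin A (V \<otimes> W) (\<lambda>x. tens V W v (g x))"
  by (auto intro: lin_bilin_left lin_bilin_right bilin_tens)

lemmas tens_lins = lin_tens_left lin_tens_right lin_ident tens_mem

lemma
  assumes "is_vspace V" "is_vspace W" "is_vspace U" "bilin V W U B"
  shows lin_lift: "lin (V \<otimes> W) U (lift V W U B)"
    and lift_tens: "v \<in> pts V \<Longrightarrow> w \<in> pts W \<Longrightarrow> lift V W U B (tens V W v w) = B v w"
proof -
  have "lin (V \<otimes> W) U (lift V W U B) \<and>
      (\<forall>v\<in>pts V. \<forall>w\<in>pts W. lift V W U B (tens V W v w) = B v w)"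
    using someI_ex[OF tensor_universal_ex[OF assms]] unfolding lift_def .
  then show "lin (V \<otimes> W) U (lift V W U B)"
    and "v \<in> pts V \<Longrightarrow> w \<in> pts W \<Longrightarrow> lift V W U B (tens V W v w) = B v w"
    by auto
qed

text \<open>
  A lift is chosen by a condition that sees the bilinear map on the carriers only, so the two lifts agree
  as functions, also off the tensor product.
\<close>

lemma lift_cong:
  assumes "\<And>v w. v \<in> pts V \<Longrightarrow> w \<in> pts W \<Longrightarrow> B v w = B' v w"
  shows "lift V W U B = lift V W U B'"
  unfolding lift_def using assms by (intro arg_cong[where f = Eps] ext) auto

lemma lift_eqI: "lift V W U B t = lift V W U B' t" if "\<And>v w. v \<in> pts V \<Longrightarrow> w \<in> pts W \<Longrightarrow> B v w = B' v w"
  by (rule fun_cong[OF lift_cong[OF that]])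

text \<open>
  The form in which the universal property is used: the value of a linear map at an arbitrary tensor is
  rewritten as a lift, after which only pure tensors have to be considered.
\<close>

lemma eq_lift:
  assumes "is_vspace V" "is_vspace W" "is_vspace U" "lin (V \<otimes> W) U h" "t \<in> pts (V \<otimes> W)"
  shows "h t = lift V W U (\<lambda>v w. h (tens V W v w)) t"
proof -
  have bil: "bilin V W U (\<lambda>v w. h (tens V W v w))"
    by (rule bilin_post[OF bilin_tens]) (use assms in auto)
  show ?thesis
    by (rule tensor_universal_uniq[OF assms(1-4) lin_lift[OF assms(1-3) bil] _ assms(5)])
      (rule lift_tens[OF assms(1-3) bil, symmetric])
qed

lemma lift_post:
  assumes "is_vspace V" "is_vspace W" "is_vspace U" "is_vspace U'" "bilin V W U B" "lin U U' h"
    "t \<in> pts (V \<otimes> W)"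
  shows "h (lift V W U B t) = lift V W U' (\<lambda>v w. h (B v w)) t"
proof -
  have "h (lift V W U B t) = lift V W U' (\<lambda>v w. h (lift V W U B (tens V W v w))) t"
    by (rule eq_lift[OF assms(1,2,4) lin_compose[OF assms(6) lin_lift[OF assms(1-3,5)]] assms(7)])
  also have "\<dots> = lift V W U' (\<lambda>v w. h (B v w)) t"
    using assms by (intro fun_cong[OF lift_cong]) (simp add: lift_tens)
  finally show ?thesis .
qed

lemma lift_mem:
  "is_vspace V \<Longrightarrow> is_vspace W \<Longrightarrow> is_vspace U \<Longrightarrow> bilin V W U B \<Longrightarrow> t \<in> pts (V \<otimes> W) \<Longrightarrow> lift V W U B t \<in> pts U"
  by (rule lin_mem[OF lin_lift])

lemma lin_lift_comp:
  "is_vspace V \<Longrightarrow> is_vspace W \<Longrightarrow> is_vspace U \<Longrightarrow> bilin V W U B \<Longrightarrow> lin A (V \<otimes> W) f \<Longrightarrow>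
   lin A U (\<lambda>x. lift V W U B (f x))"
  by (rule lin_compose[OF lin_lift])

lemma tensor_induct [consumes 3, case_names pure add]:
  assumes V: "is_vspace V" and W: "is_vspace W" and t: "t \<in> pts (V \<otimes> W)"
    and pure: "\<And>v w. v \<in> pts V \<Longrightarrow> w \<in> pts W \<Longrightarrow> P (tens V W v w)"
    and add: "\<And>s t. s \<in> pts (V \<otimes> W) \<Longrightarrow> t \<in> pts (V \<otimes> W) \<Longrightarrow> P s \<Longrightarrow> P t \<Longrightarrow> P (s + t)"
  shows "P t"
proof -
  interpret T: vector_space "tensor_scal :: 'a \<Rightarrow> ('b, 'd, 'a) tensor \<Rightarrow> _"
    by (rule vector_space_tensor_scal)
  let ?S = "{tens V W v w | v w. v \<in> pts V \<and> w \<in> pts W}"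
  have S: "pts (V \<otimes> W) = T.span ?S" and sc: "scal (V \<otimes> W) = tensor_scal"
    by (simp_all add: tensor_def)
  have scal: "tensor_scal a (tens V W v w) = tens V W (scal V a v) w" if "v \<in> pts V" "w \<in> pts W" for a v w
    using lin_scal[OF bilin_left[OF bilin_tens[OF V W] that(2)] that(1), of a] by (simp add: sc)
  from t have "t \<in> T.span ?S" by (simp add: S)
  then have "t \<in> T.span ?S \<and> P t"
  proof (induction rule: T.span_induct_alt)
    case base
    have "tens V W 0 0 = 0"
      using scal[of 0 0 0] V W by (simp add: vspace_zero tensor_scal_def scal_simps fun_eq_iff)
    then have "P 0"
      using pure[OF vspace_zero[OF V] vspace_zero[OF W]] by simp
    then show ?case
      by (intro conjI T.span_zero)
  next
    case (step a x y)
    then obtain v w where x: "x = tens V W v w" "v \<in> pts V" "w \<in> pts W" by auto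
    let ?x = "tens V W (scal V a v) w"
    have mem: "?x \<in> T.span ?S" using x V by (auto intro!: T.span_base vspace_scal)
    have "P (?x + y)"
      using x V step mem by (intro add pure) (simp_all add: S vspace_scal)
    moreover have "?x + y \<in> T.span ?S" using mem step by (intro T.span_add) auto
    moreover have "tensor_scal a x = ?x" using x by (simp add: scal)
    ultimately show ?case by metis
  qed
  then show ?thesis ..
qed

text \<open>
  A lift depends linearly on parameters of the bilinear map.  This is what makes iterated Sweedler sums
  multilinear in all their variables.
\<close>

lemma lin_lift_param:
  assumes "is_vspace P" "is_vspace V" "is_vspace W" "is_vspace U"
    and "\<And>v w. v \<in> pts V \<Longrightarrow> w \<in> pts W \<Longrightarrow> lin P U (\<lambda>x. B x v w)"
    and bil: "\<And>x. x \<in> pts P \<Longrightarrow> bilin V W U (B x)" and t: "t \<in> pts (V \<otimes> W)"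
  shows "lin P U (\<lambda>x. lift V W U (B x) t)"
  using assms(2,3) t
proof (induction rule: tensor_induct)
  case (pure v w)
  then show ?case
    using assms by (subst lin_cong[of P _ "\<lambda>x. B x v w"]) (auto simp: lift_tens)
next
  case (add s t)
  have "lin P U (\<lambda>x. lift V W U (B x) s + lift V W U (B x) t)"
    using add assms(4) by (intro lin_plus)
  then show ?case
    using assms add by (subst lin_cong[of P _ "\<lambda>x. lift V W U (B x) s + lift V W U (B x) t"])
      (auto simp: lin_add[OF lin_lift])
qed

text \<open>
  Two Sweedler sums over different elements may be interchanged: the right-hand side is linear in \<open>s\<close> and
  agrees with the left-hand side at pure tensors \<open>s\<close>.
\<close>

lemma lift_swap:
  assumes vs: "is_vspace V" "is_vspace W" "is_vspace V'" "is_vspace W'" "is_vspace U"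
    and a: "\<And>b p q. b \<in> pts W \<Longrightarrow> p \<in> pts V' \<Longrightarrow> q \<in> pts W' \<Longrightarrow> lin V U (\<lambda>a. F a b p q)"
    and b: "\<And>a p q. a \<in> pts V \<Longrightarrow> p \<in> pts V' \<Longrightarrow> q \<in> pts W' \<Longrightarrow> lin W U (\<lambda>b. F a b p q)"
    and p: "\<And>a b q. a \<in> pts V \<Longrightarrow> b \<in> pts W \<Longrightarrow> q \<in> pts W' \<Longrightarrow> lin V' U (\<lambda>p. F a b p q)"
    and q: "\<And>a b p. a \<in> pts V \<Longrightarrow> b \<in> pts W \<Longrightarrow> p \<in> pts V' \<Longrightarrow> lin W' U (\<lambda>q. F a b p q)"
    and s: "s \<in> pts (V \<otimes> W)" and t: "t \<in> pts (V' \<otimes> W')"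
  shows "lift V W U (\<lambda>a b. lift V' W' U (\<lambda>p q. F a b p q) t) s =
    lift V' W' U (\<lambda>p q. lift V W U (\<lambda>a b. F a b p q) s) t"
proof -
  let ?h = "\<lambda>s. lift V' W' U (\<lambda>p q. lift V W U (\<lambda>a b. F a b p q) s) t"
  have "?h s = lift V W U (\<lambda>a b. ?h (tens V W a b)) s"
    using assms by (intro eq_lift lin_lift_param lin_lift bilinI) auto
  also have "\<dots> = lift V W U (\<lambda>a b. lift V' W' U (\<lambda>p q. F a b p q) t) s"
    using assms by (intro fun_cong[OF lift_cong] lift_tens) (auto intro: bilinI)
  finally show ?thesis ..
qed

lemma
  assumes "is_vspace V" "is_vspace W" "is_vspace V'" "is_vspace W'" "lin V V' f" "lin W W' g"
  shows lin_tmap: "lin (V \<otimes> W) (V' \<otimes> W') (tmap V W V' W' f g)"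
    and tmap_tens: "v \<in> pts V \<Longrightarrow> w \<in> pts W \<Longrightarrow> tmap V W V' W' f g (tens V W v w) = tens V' W' (f v) (g w)"
  using assms unfolding tmap_def
  by (auto intro!: lin_lift lift_tens bilin_compose[OF bilin_tens])

lemma lift_tmap:
  assumes "is_vspace V" "is_vspace W" "is_vspace V'" "is_vspace W'" "is_vspace U"
    "lin V V' f" "lin W W' g" "bilin V' W' U B" "t \<in> pts (V \<otimes> W)"
  shows "lift V' W' U B (tmap V W V' W' f g t) = lift V W U (\<lambda>v w. B (f v) (g w)) t"
proof -
  have "lift V' W' U B (tmap V W V' W' f g t) =
      lift V W U (\<lambda>v w. lift V' W' U B (tmap V W V' W' f g (tens V W v w))) t"
    using assms by (intro eq_lift[where h = "\<lambda>t. lift V' W' U B (tmap V W V' W' f g t)"]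
        lin_lift_comp lin_tmap)
  also have "\<dots> = lift V W U (\<lambda>v w. B (f v) (g w)) t"
    using assms lin_mem[of V V' f] lin_mem[of W W' g]
    by (intro fun_cong[OF lift_cong]) (simp add: tmap_tens lift_tens)
  finally show ?thesis .
qed

lemma tmap_cong:
  assumes "\<And>v. v \<in> pts V \<Longrightarrow> f v = f' v" "\<And>w. w \<in> pts W \<Longrightarrow> g w = g' w"
  shows "tmap V W V' W' f g = tmap V W V' W' f' g'"
  unfolding tmap_def using assms by (intro lift_cong) simp

lemma tmap_inverse:
  assumes "is_vspace V" "is_vspace W" "lin V W f" "lin W V g" "\<And>x. x \<in> pts V \<Longrightarrow> g (f x) = x" "s \<in> pts (V \<otimes> V)"
  shows "tmap W W V V g g (tmap V V W W f f s) = s"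
proof -
  have "tmap W W V V g g (tmap V V W W f f s) = lift V V (V \<otimes> V) (\<lambda>a b. tens V V (g (f a)) (g (f b))) s"
    unfolding tmap_def[of W W V V] using assms
    by (intro lift_tmap) (auto intro!: bilin_compose[OF bilin_tens])
  also have "\<dots> = lift V V (V \<otimes> V) (\<lambda>a b. tens V V a b) s"
    by (rule lift_eqI) (simp add: assms(5))
  also have "\<dots> = s"
    using assms by (intro eq_lift[symmetric, where h = "\<lambda>x. x"] lin_ident) auto
  finally show ?thesis .
qed

lemma
  assumes "is_vspace V" "is_vspace W"
  shows lin_flip: "lin (V \<otimes> W) (W \<otimes> V) (flip V W)"
    and flip_tens: "v \<in> pts V \<Longrightarrow> w \<in> pts W \<Longrightarrow> flip V W (tens V W v w) = tens W V w v"
  using assms unfolding flip_def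
  by (auto intro!: lin_lift lift_tens bilinI tens_lins)

lemma lift_flip:
  assumes "is_vspace V" "is_vspace W" "is_vspace U" "bilin W V U F" "s \<in> pts (V \<otimes> W)"
  shows "lift W V U F (flip V W s) = lift V W U (\<lambda>a b. F b a) s"
proof -
  have "lift W V U F (flip V W s) = lift V W U (\<lambda>a b. lift W V U F (flip V W (tens V W a b))) s"
    using assms by (intro eq_lift[where h = "\<lambda>s. lift W V U F (flip V W s)"] lin_lift_comp lin_flip)
  also have "\<dots> = lift V W U (\<lambda>a b. F b a) s"
    by (rule lift_eqI) (use assms in \<open>simp add: flip_tens lift_tens\<close>)
  finally show ?thesis .
qed

lemma flip_flip:
  assumes "is_vspace V" "is_vspace W" "t \<in> pts (V \<otimes> W)"
  shows "flip W V (flip V W t) = t"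
  by (rule tensor_universal_uniq[OF assms(1,2) is_vspace_tensor lin_compose[OF lin_flip lin_flip] lin_ident _ assms(3)])
    (use assms in \<open>simp_all add: flip_tens\<close>)

lemma
  assumes "is_vspace U" "is_vspace V" "is_vspace W"
  shows lin_assoc: "lin ((U \<otimes> V) \<otimes> W) (U \<otimes> (V \<otimes> W)) (assoc U V W)"
    and assoc_tens: "u \<in> pts U \<Longrightarrow> v \<in> pts V \<Longrightarrow> w \<in> pts W \<Longrightarrow>
      assoc U V W (tens (U \<otimes> V) W (tens U V u v) w) = tens U (V \<otimes> W) u (tens V W v w)"
proof -
  have 1: "bilin U V (U \<otimes> (V \<otimes> W)) (\<lambda>u v. tens U (V \<otimes> W) u (tens V W v w))" if "w \<in> pts W" for w
    using assms that by (auto intro!: bilinI tens_lins)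
  have 2: "bilin (U \<otimes> V) W (U \<otimes> (V \<otimes> W)) (\<lambda>t w. lift U V (U \<otimes> (V \<otimes> W)) (\<lambda>u v. tens U (V \<otimes> W) u (tens V W v w)) t)"
    using assms 1 by (auto intro!: bilinI lin_lift lin_lift_param tens_lins)
  show "lin ((U \<otimes> V) \<otimes> W) (U \<otimes> (V \<otimes> W)) (assoc U V W)"
    using assms 2 unfolding assoc_def by (auto intro!: lin_lift)
  show "u \<in> pts U \<Longrightarrow> v \<in> pts V \<Longrightarrow> w \<in> pts W \<Longrightarrow>
      assoc U V W (tens (U \<otimes> V) W (tens U V u v) w) = tens U (V \<otimes> W) u (tens V W v w)"
    using assms 1 2 unfolding assoc_def by (simp add: lift_tens tens_mem)
qed

lemma
  assumes "is_vspace U" "is_vspace V" "is_vspace W"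
  shows lin_assoc_inv: "lin (U \<otimes> (V \<otimes> W)) ((U \<otimes> V) \<otimes> W) (assoc_inv U V W)"
    and assoc_inv_tens: "u \<in> pts U \<Longrightarrow> v \<in> pts V \<Longrightarrow> w \<in> pts W \<Longrightarrow>
      assoc_inv U V W (tens U (V \<otimes> W) u (tens V W v w)) = tens (U \<otimes> V) W (tens U V u v) w"
proof -
  have 1: "bilin V W ((U \<otimes> V) \<otimes> W) (\<lambda>v w. tens (U \<otimes> V) W (tens U V u v) w)" if "u \<in> pts U" for u
    using assms that by (auto intro!: bilinI tens_lins)
  have 2: "bilin U (V \<otimes> W) ((U \<otimes> V) \<otimes> W) (\<lambda>u t. lift V W ((U \<otimes> V) \<otimes> W) (\<lambda>v w. tens (U \<otimes> V) W (tens U V u v) w) t)"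
    using assms 1 by (auto intro!: bilinI lin_lift lin_lift_param tens_lins)
  show "lin (U \<otimes> (V \<otimes> W)) ((U \<otimes> V) \<otimes> W) (assoc_inv U V W)"
    using assms 2 unfolding assoc_inv_def by (auto intro!: lin_lift)
  show "u \<in> pts U \<Longrightarrow> v \<in> pts V \<Longrightarrow> w \<in> pts W \<Longrightarrow>
      assoc_inv U V W (tens U (V \<otimes> W) u (tens V W v w)) = tens (U \<otimes> V) W (tens U V u v) w"
    using assms 1 2 unfolding assoc_inv_def by (simp add: lift_tens tens_mem)
qed

lemma lift_tens_split:
  assumes vs: "is_vspace V" "is_vspace W" "is_vspace A" "is_vspace B" "is_vspace A'" "is_vspace B'"
    and f: "bilin A A' V f" and g: "bilin B B' W g" and s: "s \<in> pts (A \<otimes> A')" and t: "t \<in> pts (B \<otimes> B')"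
  shows "lift A A' (V \<otimes> W) (\<lambda>a b. lift B B' (V \<otimes> W) (\<lambda>p q. tens V W (f a b) (g p q)) t) s =
      tens V W (lift A A' V f s) (lift B B' W g t)"
proof -
  have fm: "lift A A' V f s \<in> pts V" and gm: "lift B B' W g t \<in> pts W"
    using vs f g s t by (auto intro: lift_mem)
  have "lift A A' (V \<otimes> W) (\<lambda>a b. lift B B' (V \<otimes> W) (\<lambda>p q. tens V W (f a b) (g p q)) t) s =
    lift A A' (V \<otimes> W) (\<lambda>a b. tens V W (f a b) (lift B B' W g t)) s"
    by (rule fun_cong[OF lift_cong], rule lift_post[symmetric, where h = "tens V W _"])
      (use vs g t bilin_mem[OF f] in \<open>auto intro!: tens_lins\<close>)
  also have "\<dots> = tens V W (lift A A' V f s) (lift B B' W g t)"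
    by (rule lift_post[symmetric, where h = "\<lambda>u. tens V W u _"])
      (use vs f s gm in \<open>auto intro!: tens_lins\<close>)
  finally show ?thesis .
qed

section \<open>Convolution on a coalgebra\<close>

text \<open>
  Avoids the maps \<open>assoc\<close> and \<open>tmap\<close>, both when coassociativity is used and when it is proved for a new
  comultiplication.
\<close>

lemma coassociative_iff:
  assumes V: "is_vspace V" and D: "lin V (V \<otimes> V) \<Delta>"
  shows "coassociative V \<Delta> \<longleftrightarrow> (\<forall>x\<in>pts V.
    lift V V (V \<otimes> (V \<otimes> V)) (\<lambda>a b. lift V V (V \<otimes> (V \<otimes> V)) (\<lambda>p q. tens V (V \<otimes> V) p (tens V V q b)) (\<Delta> a)) (\<Delta> x)
    = lift V V (V \<otimes> (V \<otimes> V)) (\<lambda>a b. tens V (V \<otimes> V) a (\<Delta> b)) (\<Delta> x))"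
proof -
  have "assoc V V V (tmap V V (V \<otimes> V) V \<Delta> id s) =
    lift V V (V \<otimes> (V \<otimes> V)) (\<lambda>a b. lift V V (V \<otimes> (V \<otimes> V)) (\<lambda>p q. tens V (V \<otimes> V) p (tens V V q b)) (\<Delta> a)) s"
    if s: "s \<in> pts (V \<otimes> V)" for s
  proof -
    have id: "lin V V id" by (simp add: lin_def)
    have "assoc V V V (tmap V V (V \<otimes> V) V \<Delta> id s) =
      lift V V (V \<otimes> (V \<otimes> V)) (\<lambda>a b. assoc V V V (tmap V V (V \<otimes> V) V \<Delta> id (tens V V a b))) s"
      using V D s id by (intro eq_lift[where h = "\<lambda>s. assoc V V V (tmap V V (V \<otimes> V) V \<Delta> id s)"]
        lin_compose[OF lin_assoc] lin_tmap) auto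
    also have "\<dots> = lift V V (V \<otimes> (V \<otimes> V)) (\<lambda>a b. assoc V V V (tens (V \<otimes> V) V (\<Delta> a) b)) s"
      using V D id by (intro fun_cong[OF lift_cong]) (simp add: tmap_tens)
    also have "\<dots> = lift V V (V \<otimes> (V \<otimes> V)) (\<lambda>a b. lift V V (V \<otimes> (V \<otimes> V))
        (\<lambda>p q. assoc V V V (tens (V \<otimes> V) V (tens V V p q) b)) (\<Delta> a)) s"
      using V lin_mem[OF D]
      by (intro fun_cong[OF lift_cong] eq_lift[where h = "\<lambda>t. assoc V V V (tens (V \<otimes> V) V t _)"]
        lin_compose[OF lin_assoc] tens_lins) auto
    also have "\<dots> = lift V V (V \<otimes> (V \<otimes> V)) (\<lambda>a b. lift V V (V \<otimes> (V \<otimes> V))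
        (\<lambda>p q. tens V (V \<otimes> V) p (tens V V q b)) (\<Delta> a)) s"
      using V by (intro fun_cong[OF lift_cong] assoc_tens) auto
    finally show ?thesis .
  qed
  then show ?thesis
    using lin_mem[OF D] by (simp add: coassociative_def tmap_def)
qed

text \<open>
  The Sweedler sum of \<open>m (F x\<^sub>1) (G x\<^sub>2)\<close>.  The value \<open>0\<close> off the carrier turns the associativity laws below
  into equations between functions, so that they can be used to rewrite inside larger products.
\<close>

definition convol ::
  "('k::field, 'v::ab_group_add, 'z) vspace_scheme \<Rightarrow> ('v \<Rightarrow> ('v, 'v, 'k) tensor)
    \<Rightarrow> ('k, 'u::ab_group_add, 'y) vspace_scheme \<Rightarrow> ('a \<Rightarrow> 'b \<Rightarrow> 'u) \<Rightarrow> ('v \<Rightarrow> 'a) \<Rightarrow> ('v \<Rightarrow> 'b) \<Rightarrow> 'v \<Rightarrow> 'u" where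
  "convol V \<Delta> U m F G = (\<lambda>x. if x \<in> pts V then lift V V U (\<lambda>a b. m (F a) (G b)) (\<Delta> x) else 0)"

lemma convol_cong:
  assumes "\<And>x. x \<in> pts V \<Longrightarrow> F x = F' x" "\<And>x. x \<in> pts V \<Longrightarrow> G x = G' x"
  shows "convol V \<Delta> U m F G = convol V \<Delta> U m F' G'"
proof -
  have eq: "lift V V U (\<lambda>a b. m (F a) (G b)) = lift V V U (\<lambda>a b. m (F' a) (G' b))"
    using assms by (intro lift_cong) simp
  show ?thesis unfolding convol_def eq ..
qed

text \<open>
  The space is kept apart from the comultiplication and the counit, because \<open>C \<otimes> D\<close> carries several
  coalgebra structures at once.
\<close>

locale coalg_str =
  fixes V :: "('k::field, 'v::ab_group_add, 'z) vspace_scheme"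
    and \<Delta> :: "'v \<Rightarrow> ('v, 'v, 'k) tensor" and \<epsilon> :: "'v \<Rightarrow> 'k"
  assumes vs: "is_vspace V" and com: "lin V (V \<otimes> V) \<Delta>"
    and coass: "coassociative V \<Delta>" and cou: "is_counit V \<Delta> \<epsilon>"
begin

lemma com_mem: "x \<in> pts V \<Longrightarrow> \<Delta> x \<in> pts (V \<otimes> V)"
  by (rule lin_mem[OF com])

lemma lin_counit: "lin V ground \<epsilon>"
  using cou by (simp add: is_counit_def)

text \<open>
  Coassociativity for an arbitrary trilinear map \<open>T\<close>: the map \<open>L\<close> on the triple tensor product that is
  induced by \<open>T\<close> is applied to both sides of \<open>coassociative_iff\<close>.
\<close>

lemma coassoc_lift:
  assumes U: "is_vspace U"
    and a: "\<And>b c. b \<in> pts V \<Longrightarrow> c \<in> pts V \<Longrightarrow> lin V U (\<lambda>a. T a b c)"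
    and b: "\<And>a c. a \<in> pts V \<Longrightarrow> c \<in> pts V \<Longrightarrow> lin V U (\<lambda>b. T a b c)"
    and c: "\<And>a b. a \<in> pts V \<Longrightarrow> b \<in> pts V \<Longrightarrow> lin V U (\<lambda>c. T a b c)"
    and x: "x \<in> pts V"
  shows "lift V V U (\<lambda>a b. lift V V U (\<lambda>p q. T p q b) (\<Delta> a)) (\<Delta> x) =
    lift V V U (\<lambda>a b. lift V V U (\<lambda>p q. T a p q) (\<Delta> b)) (\<Delta> x)"
proof -
  define L where "L = lift V (V \<otimes> V) U (\<lambda>a s. lift V V U (\<lambda>p q. T a p q) s)"
  have bl: "bilin V (V \<otimes> V) U (\<lambda>a s. lift V V U (\<lambda>p q. T a p q) s)"
    using assms vs by (intro bilinI lin_lift_param lin_lift) auto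
  have L: "lin (V \<otimes> (V \<otimes> V)) U L" unfolding L_def
    using U vs bl by (intro lin_lift) auto
  have Lt: "L (tens V (V \<otimes> V) a s) = lift V V U (\<lambda>p q. T a p q) s" if "a \<in> pts V" "s \<in> pts (V \<otimes> V)" for a s
    unfolding L_def using U vs bl that by (subst lift_tens) auto
  have Ltt: "L (tens V (V \<otimes> V) p (tens V V q b)) = T p q b" if "p \<in> pts V" "q \<in> pts V" "b \<in> pts V" for p q b
    using U vs that b c by (subst Lt) (auto intro!: lift_tens bilinI tens_lins)
  let ?W = "V \<otimes> (V \<otimes> V)"
  have b1: "bilin V V ?W (\<lambda>p q. tens V (V \<otimes> V) p (tens V V q b))" if "b \<in> pts V" for b
    using vs that by (auto intro!: bilinI tens_lins)
  have b2: "bilin V V ?W (\<lambda>a b. lift V V ?W (\<lambda>p q. tens V (V \<otimes> V) p (tens V V q b)) (\<Delta> a))"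
    using vs b1 com by (auto intro!: bilinI lin_lift_param lin_lift_comp tens_lins com_mem)
  have b3: "bilin V V ?W (\<lambda>a b. tens V (V \<otimes> V) a (\<Delta> b))"
    using vs com by (auto intro!: bilinI tens_lins com_mem)
  have "L (lift V V ?W (\<lambda>a b. lift V V ?W (\<lambda>p q. tens V (V \<otimes> V) p (tens V V q b)) (\<Delta> a)) (\<Delta> x))
    = L (lift V V ?W (\<lambda>a b. tens V (V \<otimes> V) a (\<Delta> b)) (\<Delta> x))"
    using coassociative_iff[OF vs com] coass x by simp
  also have "\<dots> = lift V V U (\<lambda>a b. L (tens V (V \<otimes> V) a (\<Delta> b))) (\<Delta> x)"
    using vs U b3 L x by (intro lift_post[where h = L]) (auto intro: com_mem)
  also have "\<dots> = lift V V U (\<lambda>a b. lift V V U (\<lambda>p q. T a p q) (\<Delta> b)) (\<Delta> x)"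
    by (intro fun_cong[OF lift_cong] Lt com_mem)
  also have "L (lift V V ?W (\<lambda>a b. lift V V ?W (\<lambda>p q. tens V (V \<otimes> V) p (tens V V q b)) (\<Delta> a)) (\<Delta> x))
    = lift V V U (\<lambda>a b. L (lift V V ?W (\<lambda>p q. tens V (V \<otimes> V) p (tens V V q b)) (\<Delta> a))) (\<Delta> x)"
    using vs U b2 L x by (intro lift_post[where h = L]) (auto intro: com_mem)
  also have "\<dots> = lift V V U (\<lambda>a b. lift V V U (\<lambda>p q. T p q b) (\<Delta> a)) (\<Delta> x)"
  proof (intro fun_cong[OF lift_cong])
    fix a b assume ab: "a \<in> pts V" "b \<in> pts V"
    have "L (lift V V ?W (\<lambda>p q. tens V (V \<otimes> V) p (tens V V q b)) (\<Delta> a))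
      = lift V V U (\<lambda>p q. L (tens V (V \<otimes> V) p (tens V V q b))) (\<Delta> a)"
      using vs U b1 L ab by (intro lift_post[where h = L]) (auto intro: com_mem)
    also have "\<dots> = lift V V U (\<lambda>p q. T p q b) (\<Delta> a)"
      using ab by (intro fun_cong[OF lift_cong] Ltt)
    finally show "L (lift V V ?W (\<lambda>p q. tens V (V \<otimes> V) p (tens V V q b)) (\<Delta> a)) = \<dots>" .
  qed
  finally show ?thesis .
qed

lemma lin_convol:
  assumes "is_vspace U" "bilin A B U m" "lin V A F" "lin V B G"
  shows "lin V U (convol V \<Delta> U m F G)"
  using assms vs com
  by (subst lin_cong[of V _ "\<lambda>x. lift V V U (\<lambda>a b. m (F a) (G b)) (\<Delta> x)"])
    (auto simp: convol_def intro!: lin_lift_comp bilin_compose[OF assms(2-4)])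

text \<open>
  The source of all associativity laws below, which differ only in the four bilinear maps.
\<close>

lemma convol_assoc:
  assumes F: "lin V A F" and G: "lin V B G" and H: "lin V E H"
    and vsp: "is_vspace P" "is_vspace Q" "is_vspace U"
    and m: "bilin A B P m1" "bilin P E U m2" "bilin B E Q m3" "bilin A Q U m4"
    and eq: "\<And>a b e. a \<in> pts A \<Longrightarrow> b \<in> pts B \<Longrightarrow> e \<in> pts E \<Longrightarrow> m2 (m1 a b) e = m4 a (m3 b e)"
  shows "convol V \<Delta> U m2 (convol V \<Delta> P m1 F G) H = convol V \<Delta> U m4 F (convol V \<Delta> Q m3 G H)"
proof (rule ext)
  fix x
  show "convol V \<Delta> U m2 (convol V \<Delta> P m1 F G) H x = convol V \<Delta> U m4 F (convol V \<Delta> Q m3 G H) x"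
  proof (cases "x \<in> pts V")
    case True
    note mems = lin_mem[OF F] lin_mem[OF G] lin_mem[OF H]
    have "convol V \<Delta> U m2 (convol V \<Delta> P m1 F G) H x =
      lift V V U (\<lambda>a b. m2 (lift V V P (\<lambda>p q. m1 (F p) (G q)) (\<Delta> a)) (H b)) (\<Delta> x)"
      using True by (auto simp: convol_def intro!: fun_cong[OF lift_cong])
    also have "\<dots> = lift V V U (\<lambda>a b. lift V V U (\<lambda>p q. m2 (m1 (F p) (G q)) (H b)) (\<Delta> a)) (\<Delta> x)"
      using vs vsp m F G mems
      by (intro fun_cong[OF lift_cong] lift_post[where h = "\<lambda>t. m2 t _"] bilin_compose[OF m(1) F G])
        (auto intro: com_mem bilin_left)
    also have "\<dots> = lift V V U (\<lambda>a b. lift V V U (\<lambda>p q. m2 (m1 (F a) (G p)) (H q)) (\<Delta> b)) (\<Delta> x)"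
      using True vsp F G H mems m
      by (intro coassoc_lift[where T = "\<lambda>a b c. m2 (m1 (F a) (G b)) (H c)"]
         lin_bilin_left[OF m(2)] lin_bilin_right[OF m(2)] lin_bilin_left[OF m(1)] lin_bilin_right[OF m(1)]
         bilin_mem[OF m(1)]) auto
    also have "\<dots> = lift V V U (\<lambda>a b. lift V V U (\<lambda>p q. m4 (F a) (m3 (G p) (H q))) (\<Delta> b)) (\<Delta> x)"
      using mems by (intro fun_cong[OF lift_cong] eq) auto
    also have "\<dots> = lift V V U (\<lambda>a b. m4 (F a) (lift V V Q (\<lambda>p q. m3 (G p) (H q)) (\<Delta> b))) (\<Delta> x)"
      using vs vsp m G H mems
      by (intro fun_cong[OF lift_cong] lift_post[symmetric, where h = "m4 _"] bilin_compose[OF m(3) G H])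
        (auto intro: com_mem bilin_right)
    also have "\<dots> = convol V \<Delta> U m4 F (convol V \<Delta> Q m3 G H) x"
      using True by (auto simp: convol_def intro!: fun_cong[OF lift_cong])
    finally show ?thesis .
  qed (simp add: convol_def)
qed

lemma convol_post:
  assumes "is_vspace U" "is_vspace U'" "lin U U' h" "bilin A B U m" "lin V A F" "lin V B G" "x \<in> pts V"
  shows "h (convol V \<Delta> U m F G x) = convol V \<Delta> U' (\<lambda>a b. h (m a b)) F G x"
  using assms vs com_mem unfolding convol_def
  by (simp add: lift_post[where h = h, OF _ _ _ _ bilin_compose[OF assms(4-6)]])

lemma counit_lift_left:
  assumes U: "is_vspace U" and F: "lin V U F" and x: "x \<in> pts V"
  shows "lift V V U (\<lambda>a b. scal U (\<epsilon> a) (F b)) (\<Delta> x) = F x"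
proof -
  have b: "bilin V V V (\<lambda>y z. scal V (\<epsilon> y) z)"
    using vs lin_counit by (auto intro!: bilin_compose[OF bilin_scal(1)] lin_ident)
  have "F (lift V V V (\<lambda>y z. scal V (\<epsilon> y) z) (\<Delta> x)) = lift V V U (\<lambda>y z. F (scal V (\<epsilon> y) z)) (\<Delta> x)"
    using vs U F x b by (intro lift_post[where h = F]) (auto intro: com_mem)
  also have "\<dots> = lift V V U (\<lambda>y z. scal U (\<epsilon> y) (F z)) (\<Delta> x)"
    using F by (intro lift_eqI) (rule lin_scal)
  finally show ?thesis
    using cou x by (simp add: is_counit_def)
qed

lemma counit_lift_right:
  assumes U: "is_vspace U" and F: "lin V U F" and x: "x \<in> pts V"
  shows "lift V V U (\<lambda>a b. scal U (\<epsilon> b) (F a)) (\<Delta> x) = F x"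
proof -
  have b: "bilin V V V (\<lambda>y z. scal V (\<epsilon> z) y)"
    using vs lin_counit bilin_compose[OF bilin_scal(2)[OF vs] lin_ident lin_counit] by simp
  have "F (lift V V V (\<lambda>y z. scal V (\<epsilon> z) y) (\<Delta> x)) = lift V V U (\<lambda>y z. F (scal V (\<epsilon> z) y)) (\<Delta> x)"
    using vs U F x b by (intro lift_post[where h = F]) (auto intro: com_mem)
  also have "\<dots> = lift V V U (\<lambda>y z. scal U (\<epsilon> z) (F y)) (\<Delta> x)"
    using F by (intro lift_eqI) (rule lin_scal)
  finally show ?thesis
    using cou x by (simp add: is_counit_def)
qed

end

text \<open>
  The linear forms on a coalgebra are an algebra under convolution, with unit the counit.  It acts on the
  linear maps into \<open>U\<close> from both sides; the convolution product itself is the case \<open>U = ground\<close>.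
  The third product takes maps into \<open>U\<close> and \<open>W\<close> to a map into \<open>U \<otimes> W\<close>.
\<close>

definition lact where "lact V \<Delta> U e F = convol V \<Delta> U (scal U) e F"
definition ract where "ract V \<Delta> U F e = convol V \<Delta> U (\<lambda>u a. scal U a u) F e"
definition tprod where "tprod V \<Delta> U W F G = convol V \<Delta> (U \<otimes> W) (tens U W) F G"

lemma lact_cong: "(\<And>x. x \<in> pts V \<Longrightarrow> e x = e' x) \<Longrightarrow> (\<And>x. x \<in> pts V \<Longrightarrow> F x = F' x) \<Longrightarrow> lact V \<Delta> U e F = lact V \<Delta> U e' F'"
  and ract_cong: "(\<And>x. x \<in> pts V \<Longrightarrow> e x = e' x) \<Longrightarrow> (\<And>x. x \<in> pts V \<Longrightarrow> F x = F' x) \<Longrightarrow> ract V \<Delta> U F e = ract V \<Delta> U F' e'"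
  unfolding lact_def ract_def by (rule convol_cong; assumption)+

lemma tprod_cong: "(\<And>x. x \<in> pts V \<Longrightarrow> F x = F' x) \<Longrightarrow> (\<And>x. x \<in> pts V \<Longrightarrow> G x = G' x) \<Longrightarrow> tprod V \<Delta> U W F G = tprod V \<Delta> U W F' G'"
  unfolding tprod_def by (rule convol_cong; assumption)+

context coalg_str
begin

abbreviation left_act (\<open>(_ \<triangleright>\<^bsub>_\<^esub> _)\<close> [81, 0, 80] 80)
  where "e \<triangleright>\<^bsub>U\<^esub> F \<equiv> lact V \<Delta> U e F"
abbreviation right_act (\<open>(_ \<triangleleft>\<^bsub>_\<^esub> _)\<close> [80, 0, 81] 80)
  where "F \<triangleleft>\<^bsub>U\<^esub> e \<equiv> ract V \<Delta> U F e"
abbreviation tens_act (\<open>(_ \<odot>\<^bsub>_,_\<^esub> _)\<close> [79, 0, 0, 78] 78)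
  where "F \<odot>\<^bsub>U,W\<^esub> G \<equiv> tprod V \<Delta> U W F G"

lemma lin_lact: "is_vspace U \<Longrightarrow> lin V ground e \<Longrightarrow> lin V U F \<Longrightarrow> lin V U (e \<triangleright>\<^bsub>U\<^esub> F)"
  unfolding lact_def by (rule lin_convol[OF _ bilin_scal(1)])

lemma lin_ract: "is_vspace U \<Longrightarrow> lin V U F \<Longrightarrow> lin V ground e \<Longrightarrow> lin V U (F \<triangleleft>\<^bsub>U\<^esub> e)"
  unfolding ract_def by (rule lin_convol[OF _ bilin_scal(2)])

lemma lin_tprod: "is_vspace U \<Longrightarrow> is_vspace W \<Longrightarrow> lin V U F \<Longrightarrow> lin V W G \<Longrightarrow> lin V (U \<otimes> W) (F \<odot>\<^bsub>U,W\<^esub> G)"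
  unfolding tprod_def by (rule lin_convol[OF _ bilin_tens]) simp

lemmas lins = lin_lact lin_ract lin_tprod lin_ident lin_counit

lemma lact_lact:
  assumes "is_vspace U" "lin V ground e" "lin V ground f" "lin V U F"
  shows "e \<triangleright>\<^bsub>U\<^esub> (f \<triangleright>\<^bsub>U\<^esub> F) = (e \<triangleright>\<^bsub>ground\<^esub> f) \<triangleright>\<^bsub>U\<^esub> F"
  unfolding lact_def
  by (rule convol_assoc[symmetric, OF assms(2-4)]) (use assms in \<open>auto intro: bilin_scal bilin_scal[of ground, simplified] simp: scal_simps\<close>)

lemma ract_ract:
  assumes "is_vspace U" "lin V U F" "lin V ground e" "lin V ground f"
  shows "F \<triangleleft>\<^bsub>U\<^esub> e \<triangleleft>\<^bsub>U\<^esub> f = F \<triangleleft>\<^bsub>U\<^esub> (e \<triangleright>\<^bsub>ground\<^esub> f)"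
  unfolding ract_def lact_def
  by (rule convol_assoc[OF assms(2-4)]) (use assms in \<open>auto intro: bilin_scal bilin_scal[of ground, simplified] simp: scal_simps mult.commute\<close>)

lemma lact_ract:
  assumes "is_vspace U" "lin V ground e" "lin V U F" "lin V ground f"
  shows "(e \<triangleright>\<^bsub>U\<^esub> F) \<triangleleft>\<^bsub>U\<^esub> f = e \<triangleright>\<^bsub>U\<^esub> (F \<triangleleft>\<^bsub>U\<^esub> f)"
  unfolding ract_def lact_def
  by (rule convol_assoc[OF assms(2-4)]) (use assms in \<open>auto intro: bilin_scal simp: scal_simps mult.commute\<close>)

lemma lact_tprod:
  assumes "is_vspace U" "is_vspace W" "lin V ground e" "lin V U F" "lin V W G"
  shows "(e \<triangleright>\<^bsub>U\<^esub> F) \<odot>\<^bsub>U,W\<^esub> G = e \<triangleright>\<^bsub>U \<otimes> W\<^esub> (F \<odot>\<^bsub>U,W\<^esub> G)"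
  unfolding lact_def tprod_def
  by (rule convol_assoc[OF assms(3-5)]) (use assms in \<open>auto intro: bilin_scal bilin_tens simp: lin_scal[OF bilin_left[OF bilin_tens]]\<close>)

lemma tprod_ract:
  assumes "is_vspace U" "is_vspace W" "lin V U F" "lin V W G" "lin V ground e"
  shows "(F \<odot>\<^bsub>U,W\<^esub> G) \<triangleleft>\<^bsub>U \<otimes> W\<^esub> e = F \<odot>\<^bsub>U,W\<^esub> (G \<triangleleft>\<^bsub>W\<^esub> e)"
  unfolding ract_def tprod_def
  by (rule convol_assoc[OF assms(3-5)]) (use assms in \<open>auto intro: bilin_scal bilin_tens simp: lin_scal[OF bilin_right[OF bilin_tens]]\<close>)

lemma tprod_middle:
  assumes "is_vspace U" "is_vspace W" "lin V U F" "lin V ground e" "lin V W G"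
  shows "(F \<triangleleft>\<^bsub>U\<^esub> e) \<odot>\<^bsub>U,W\<^esub> G = F \<odot>\<^bsub>U,W\<^esub> (e \<triangleright>\<^bsub>W\<^esub> G)"
  unfolding ract_def lact_def tprod_def
  by (rule convol_assoc[OF assms(3-5)]) (use assms in \<open>auto intro: bilin_scal bilin_tens
      simp: lin_scal[OF bilin_right[OF bilin_tens]] lin_scal[OF bilin_left[OF bilin_tens]]\<close>)

lemma counit_lact: "is_vspace U \<Longrightarrow> lin V U F \<Longrightarrow> x \<in> pts V \<Longrightarrow> (\<epsilon> \<triangleright>\<^bsub>U\<^esub> F) x = F x"
  and ract_counit: "is_vspace U \<Longrightarrow> lin V U F \<Longrightarrow> x \<in> pts V \<Longrightarrow> (F \<triangleleft>\<^bsub>U\<^esub> \<epsilon>) x = F x"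
  by (simp_all add: lact_def ract_def convol_def counit_lift_left counit_lift_right)

text \<open>
  Linear maps commute with the actions.  In the special cases \<open>lact_pre\<close> and \<open>ract_pre\<close> below this computes the
  composition of any linear map with \<open>e \<triangleright> id\<close> or \<open>id \<triangleleft> e\<close>.
\<close>

lemma lact_post:
  assumes "is_vspace U" "is_vspace W" "lin U W h" "lin V ground e" "lin V U F" "x \<in> pts V"
  shows "h ((e \<triangleright>\<^bsub>U\<^esub> F) x) = (e \<triangleright>\<^bsub>W\<^esub> (\<lambda>x. h (F x))) x"
  unfolding lact_def
  by (subst convol_post[OF assms(1,2,3) bilin_scal(1)[OF assms(1)] assms(4-6)])
    (use assms lin_mem[OF assms(5)] in \<open>auto simp: convol_def lin_scal[of U W h] intro!: fun_cong[OF lift_cong]\<close>)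

lemma ract_post:
  assumes "is_vspace U" "is_vspace W" "lin U W h" "lin V U F" "lin V ground e" "x \<in> pts V"
  shows "h ((F \<triangleleft>\<^bsub>U\<^esub> e) x) = ((\<lambda>x. h (F x)) \<triangleleft>\<^bsub>W\<^esub> e) x"
  unfolding ract_def
  by (subst convol_post[OF assms(1,2,3) bilin_scal(2)[OF assms(1)] assms(4-6)])
    (use assms lin_mem[OF assms(4)] in \<open>auto simp: convol_def lin_scal[of U W h] intro!: fun_cong[OF lift_cong]\<close>)

lemma tmap_tprod:
  assumes "is_vspace U" "is_vspace W" "is_vspace U'" "is_vspace W'"
    "lin U U' f" "lin W W' g" "lin V U F" "lin V W G" "x \<in> pts V"
  shows "tmap U W U' W' f g ((F \<odot>\<^bsub>U,W\<^esub> G) x) = ((\<lambda>x. f (F x)) \<odot>\<^bsub>U',W'\<^esub> (\<lambda>x. g (G x))) x"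
  unfolding tprod_def
  by (subst convol_post[OF is_vspace_tensor is_vspace_tensor lin_tmap[OF assms(1-6)] bilin_tens[OF assms(1,2)] assms(7-9)])
    (use assms lin_mem[OF assms(7)] lin_mem[OF assms(8)] in \<open>auto simp: convol_def tmap_tens intro!: fun_cong[OF lift_cong]\<close>)

lemma tprod_assoc:
  assumes "is_vspace U" "is_vspace W" "is_vspace Z" "lin V U F" "lin V W G" "lin V Z H" "x \<in> pts V"
  shows assoc_tprod: "assoc U W Z (((F \<odot>\<^bsub>U,W\<^esub> G) \<odot>\<^bsub>U \<otimes> W,Z\<^esub> H) x) = (F \<odot>\<^bsub>U,W \<otimes> Z\<^esub> (G \<odot>\<^bsub>W,Z\<^esub> H)) x"
    and assoc_inv_tprod: "assoc_inv U W Z ((F \<odot>\<^bsub>U,W \<otimes> Z\<^esub> (G \<odot>\<^bsub>W,Z\<^esub> H)) x) = ((F \<odot>\<^bsub>U,W\<^esub> G) \<odot>\<^bsub>U \<otimes> W,Z\<^esub> H) x"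
proof -
  note bl = bilin_tens[OF assms(1,2)] bilin_tens[OF assms(2,3)]
    bilin_tens[OF is_vspace_tensor[of U W] assms(3)] bilin_tens[OF assms(1) is_vspace_tensor[of W Z]]
  have 1: "convol V \<Delta> (U \<otimes> W \<otimes> Z) (\<lambda>t z. assoc U W Z (tens (U \<otimes> W) Z t z)) (F \<odot>\<^bsub>U,W\<^esub> G) H = F \<odot>\<^bsub>U,W \<otimes> Z\<^esub> (G \<odot>\<^bsub>W,Z\<^esub> H)"
    unfolding tprod_def
    by (rule convol_assoc[OF assms(4-6)]) (use assms in \<open>auto intro!: bl bilin_post[OF bl(3)] lin_assoc assoc_tens\<close>)
  show "assoc U W Z (((F \<odot>\<^bsub>U,W\<^esub> G) \<odot>\<^bsub>U \<otimes> W,Z\<^esub> H) x) = (F \<odot>\<^bsub>U,W \<otimes> Z\<^esub> (G \<odot>\<^bsub>W,Z\<^esub> H)) x"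
    unfolding tprod_def[of _ _ "U \<otimes> W" Z]
    by (subst convol_post[OF is_vspace_tensor is_vspace_tensor lin_assoc[OF assms(1-3)] bl(3) lin_tprod[OF assms(1,2,4,5)] assms(6,7)])
      (simp only: 1)
  have 2: "((F \<odot>\<^bsub>U,W\<^esub> G) \<odot>\<^bsub>U \<otimes> W,Z\<^esub> H) = convol V \<Delta> ((U \<otimes> W) \<otimes> Z) (\<lambda>u t. assoc_inv U W Z (tens U (W \<otimes> Z) u t)) F (G \<odot>\<^bsub>W,Z\<^esub> H)"
    unfolding tprod_def
    by (rule convol_assoc[OF assms(4-6)]) (use assms in \<open>auto intro!: bl bilin_post[OF bl(4)] lin_assoc_inv assoc_inv_tens[symmetric]\<close>)
  show "assoc_inv U W Z ((F \<odot>\<^bsub>U,W \<otimes> Z\<^esub> (G \<odot>\<^bsub>W,Z\<^esub> H)) x) = ((F \<odot>\<^bsub>U,W\<^esub> G) \<odot>\<^bsub>U \<otimes> W,Z\<^esub> H) x"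
    unfolding tprod_def[of _ _ "U" "W \<otimes> Z"]
    by (subst convol_post[OF is_vspace_tensor is_vspace_tensor lin_assoc_inv[OF assms(1-3)] bl(4) assms(4) lin_tprod[OF assms(2,3,5,6)] assms(7)])
      (simp only: 2)
qed

lemma comult_eq_tprod: "x \<in> pts V \<Longrightarrow> \<Delta> x = ((\<lambda>x. x) \<odot>\<^bsub>V,V\<^esub> (\<lambda>x. x)) x"
  using eq_lift[OF vs vs is_vspace_tensor lin_ident com_mem, of x] by (simp add: tprod_def convol_def)

lemma ract_pre:
  assumes "is_vspace U" "lin V U F" "lin V ground e" "x \<in> pts V"
  shows "F (((\<lambda>x. x) \<triangleleft>\<^bsub>V\<^esub> e) x) = (F \<triangleleft>\<^bsub>U\<^esub> e) x"
  by (rule ract_post) (use assms vs in \<open>auto intro: lin_ident\<close>)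

lemma lact_pre:
  assumes "is_vspace U" "lin V U F" "lin V ground e" "x \<in> pts V"
  shows "F ((e \<triangleright>\<^bsub>V\<^esub> (\<lambda>x. x)) x) = (e \<triangleright>\<^bsub>U\<^esub> F) x"
  by (rule lact_post) (use assms vs in \<open>auto intro: lin_ident\<close>)

text \<open>
  Since \<open>e \<triangleright> id\<close> is linear, it commutes with the action of \<open>f\<close>; so the composition is \<open>f \<triangleright> (e \<triangleright> id)\<close>, and
  the forms meet in their convolution product.
\<close>

lemma lact_inverse:
  assumes "lin V ground e" "lin V ground f" "\<And>x. x \<in> pts V \<Longrightarrow> (f \<triangleright>\<^bsub>ground\<^esub> e) x = \<epsilon> x" "x \<in> pts V"
  shows "(e \<triangleright>\<^bsub>V\<^esub> (\<lambda>x. x)) ((f \<triangleright>\<^bsub>V\<^esub> (\<lambda>x. x)) x) = x"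
proof -
  have "(e \<triangleright>\<^bsub>V\<^esub> (\<lambda>x. x)) ((f \<triangleright>\<^bsub>V\<^esub> (\<lambda>x. x)) x) = (f \<triangleright>\<^bsub>V\<^esub> (e \<triangleright>\<^bsub>V\<^esub> (\<lambda>x. x))) x"
    using assms vs by (intro lact_pre lins) auto
  also have "\<dots> = ((f \<triangleright>\<^bsub>ground\<^esub> e) \<triangleright>\<^bsub>V\<^esub> (\<lambda>x. x)) x"
    using assms vs by (simp add: lact_lact lins)
  also have "\<dots> = (\<epsilon> \<triangleright>\<^bsub>V\<^esub> (\<lambda>x. x)) x"
    using assms by (intro fun_cong[OF lact_cong]) auto
  also have "\<dots> = x"
    using assms vs by (intro counit_lact lins)
  finally show ?thesis .
qed

lemma ract_ground: "F \<triangleleft>\<^bsub>ground\<^esub> e = F \<triangleright>\<^bsub>ground\<^esub> e"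
  unfolding ract_def lact_def by (simp add: mult.commute)

text \<open>
  Contracting \<open>F \<odot> G\<close> with a bilinear map \<open>m\<close> gives the convolution of \<open>F\<close> and \<open>G\<close> along \<open>m\<close>; for a form on one of
  the two factors this is one of the actions.
\<close>

lemma lift_tprod:
  assumes "is_vspace U" "is_vspace W" "is_vspace Z" "bilin U W Z m" "lin V U F" "lin V W G" "x \<in> pts V"
  shows "lift U W Z m ((F \<odot>\<^bsub>U,W\<^esub> G) x) = convol V \<Delta> Z m F G x"
  unfolding tprod_def
  by (subst convol_post[OF is_vspace_tensor assms(3) lin_lift[OF assms(1-4)] bilin_tens[OF assms(1,2)] assms(5-7)])
    (use assms lin_mem[OF assms(5)] lin_mem[OF assms(6)] in \<open>auto simp: convol_def intro!: fun_cong[OF lift_cong] lift_tens\<close>)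

lemma tprod_eval_left:
  assumes "is_vspace U" "is_vspace W" "lin U ground \<eta>" "lin V U F" "lin V W G" "x \<in> pts V"
  shows "lift U W W (\<lambda>u w. scal W (\<eta> u) w) ((F \<odot>\<^bsub>U,W\<^esub> G) x) = ((\<lambda>x. \<eta> (F x)) \<triangleright>\<^bsub>W\<^esub> G) x"
  by (subst lift_tprod) (use assms in \<open>auto simp: lact_def convol_def intro!: bilinI lin_scal_left lin_scal_right lin_ident\<close>)

lemma tprod_eval_right:
  assumes "is_vspace U" "is_vspace W" "lin W ground \<eta>" "lin V U F" "lin V W G" "x \<in> pts V"
  shows "lift U W U (\<lambda>u w. scal U (\<eta> w) u) ((F \<odot>\<^bsub>U,W\<^esub> G) x) = (F \<triangleleft>\<^bsub>U\<^esub> (\<lambda>x. \<eta> (G x))) x"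
  by (subst lift_tprod) (use assms in \<open>auto simp: ract_def convol_def intro!: bilinI lin_scal_left lin_scal_right lin_ident\<close>)

end

lemma (in coalg_str) bij_lact:
  assumes "lin V ground e" "lin V ground f" "\<And>x. x \<in> pts V \<Longrightarrow> (f \<triangleright>\<^bsub>ground\<^esub> e) x = \<epsilon> x"
    "\<And>x. x \<in> pts V \<Longrightarrow> (e \<triangleright>\<^bsub>ground\<^esub> f) x = \<epsilon> x"
  shows "bij_betw (e \<triangleright>\<^bsub>V\<^esub> (\<lambda>x. x)) (pts V) (pts V)"
  by (rule bij_betw_byWitness[where f' = "f \<triangleright>\<^bsub>V\<^esub> (\<lambda>x. x)"])
    (use assms lact_inverse lin_mem[OF lin_lact[OF vs assms(1) lin_ident]] lin_mem[OF lin_lact[OF vs assms(2) lin_ident]] in auto)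

section \<open>Uniqueness of counits and transport of structure\<close>

lemma coalgebra_coalg_str: "coalgebra C \<longleftrightarrow> coalg_str C (comult C) (counit C)"
  by (auto simp: coalgebra_def coalg_str_def)

text \<open>
  Both \<open>\<epsilon> x\<close> and \<open>\<eta> x\<close> are equal to the Sweedler sum of \<open>\<eta> (x\<^sub>1) \<epsilon> (x\<^sub>2)\<close>.
\<close>

lemma counit_unique:
  assumes V: "is_vspace V" and D: "lin V (V \<otimes> V) \<Delta>" and 1: "is_counit V \<Delta> \<epsilon>" and 2: "is_counit V \<Delta> \<eta>" and x: "x \<in> pts V"
  shows "\<epsilon> x = \<eta> x"
proof -
  have l: "lin V ground \<epsilon>" "lin V ground \<eta>" using 1 2 by (auto simp: is_counit_def)
  have s: "\<Delta> x \<in> pts (V \<otimes> V)" by (rule lin_mem[OF D x])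
  have "\<epsilon> x = \<epsilon> (lift V V V (\<lambda>y z. scal V (\<eta> y) z) (\<Delta> x))"
    using 2 x by (simp add: is_counit_def)
  also have "\<dots> = lift V V ground (\<lambda>y z. \<epsilon> (scal V (\<eta> y) z)) (\<Delta> x)"
    by (rule lift_post[where h = \<epsilon>]) (use V l s in \<open>auto intro!: bilinI lin_scal_left lin_scal_right lin_ident\<close>)
  also have "\<dots> = lift V V ground (\<lambda>y z. \<eta> (scal V (\<epsilon> z) y)) (\<Delta> x)"
    by (rule fun_cong[OF lift_cong]) (simp add: lin_scal[OF l(1)] lin_scal[OF l(2)])
  also have "\<dots> = \<eta> (lift V V V (\<lambda>y z. scal V (\<epsilon> z) y) (\<Delta> x))"
    by (rule lift_post[where h = \<eta>, symmetric]) (use V l s in \<open>auto intro!: bilinI lin_scal_left lin_scal_right lin_ident\<close>)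
  also have "\<dots> = \<eta> x"
    using 1 x by (simp add: is_counit_def)
  finally show ?thesis .
qed

lemma (in coalg_str) lift_intertwined:
  assumes "is_vspace W" "lin V W f" "x \<in> pts V" "y = tmap V V W W f f (\<Delta> x)" "is_vspace U" "bilin W W U F"
  shows "lift W W U F y = lift V V U (\<lambda>a b. F (f a) (f b)) (\<Delta> x)"
  unfolding assms(4) using assms by (intro lift_tmap vs com_mem)

text \<open>
  A Sweedler sum for \<open>\<Delta>'\<close> at \<open>y\<close> is a Sweedler sum for \<open>\<Delta>\<close> at \<open>g y\<close> (\<open>lift_intertwined\<close>), so the axioms are
  inherited along the bijection \<open>f\<close>.
\<close>

lemma (in coalg_str) transport:
  assumes W: "is_vspace W" and f: "lin V W f" and g: "lin W V g" and \<Delta>': "lin W (W \<otimes> W) \<Delta>'"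
    and fg: "\<And>y. y \<in> pts W \<Longrightarrow> f (g y) = y" and gf: "\<And>x. x \<in> pts V \<Longrightarrow> g (f x) = x"
    and eq: "\<And>x. x \<in> pts V \<Longrightarrow> \<Delta>' (f x) = tmap V V W W f f (\<Delta> x)"
  shows "coalg_str W \<Delta>' (\<lambda>y. \<epsilon> (g y))"
proof
  have gm: "g y \<in> pts V" if "y \<in> pts W" for y by (rule lin_mem[OF g that])
  have eq': "\<Delta>' y = tmap V V W W f f (\<Delta> (g y))" if "y \<in> pts W" for y
    using eq[OF gm[OF that]] fg[OF that] by simp
  note lift' = lift_intertwined[OF W f gm eq'] and lift'' = lift_intertwined[OF W f _ eq]
  show "is_vspace W" "lin W (W \<otimes> W) \<Delta>'" by fact+
  show "coassociative W \<Delta>'"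
    unfolding coassociative_iff[OF W \<Delta>']
  proof
    fix y assume y: "y \<in> pts W"
    let ?U = "W \<otimes> (W \<otimes> W)"
    let ?T = "\<lambda>a b c. tens W (W \<otimes> W) a (tens W W b c)"
    note side = bilinI lin_lift_param lin_lift_comp tens_lins lin_ident is_vspace_tensor W vs \<Delta>' lin_mem[OF \<Delta>'] com com_mem
    have "lift W W ?U (\<lambda>a b. lift W W ?U (\<lambda>p q. ?T p q b) (\<Delta>' a)) (\<Delta>' y) =
      lift V V ?U (\<lambda>a b. lift W W ?U (\<lambda>p q. ?T p q (f b)) (\<Delta>' (f a))) (\<Delta> (g y))"
      by (rule lift') (auto intro!: side y)
    also have "\<dots> = lift V V ?U (\<lambda>a b. lift V V ?U (\<lambda>p q. ?T (f p) (f q) (f b)) (\<Delta> a)) (\<Delta> (g y))"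
      by (rule lift_eqI, rule lift'') (auto intro!: side lin_mem[OF f])
    also have "\<dots> = lift V V ?U (\<lambda>a b. lift V V ?U (\<lambda>p q. ?T (f a) (f p) (f q)) (\<Delta> b)) (\<Delta> (g y))"
      by (rule coassoc_lift[where T = "\<lambda>a b c. ?T (f a) (f b) (f c)"]) (auto intro!: side f gm y lin_mem[OF f])
    also have "\<dots> = lift V V ?U (\<lambda>a b. lift W W ?U (\<lambda>p q. ?T (f a) p q) (\<Delta>' (f b))) (\<Delta> (g y))"
      by (rule lift_eqI, rule lift''[symmetric]) (auto intro!: side lin_mem[OF f])
    also have "\<dots> = lift W W ?U (\<lambda>a b. lift W W ?U (\<lambda>p q. ?T a p q) (\<Delta>' b)) (\<Delta>' y)"
      by (rule lift'[symmetric]) (auto intro!: side y)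
    also have "\<dots> = lift W W ?U (\<lambda>a b. tens W (W \<otimes> W) a (\<Delta>' b)) (\<Delta>' y)"
      by (rule lift_eqI, rule eq_lift[symmetric, where h = "tens W (W \<otimes> W) _"]) (auto intro!: tens_lins W lin_mem[OF \<Delta>'])
    finally show "lift W W ?U (\<lambda>a b. lift W W ?U (\<lambda>p q. tens W (W \<otimes> W) p (tens W W q b)) (\<Delta>' a)) (\<Delta>' y)
      = lift W W ?U (\<lambda>a b. tens W (W \<otimes> W) a (\<Delta>' b)) (\<Delta>' y)" .
  qed
  have el: "lin W ground (\<lambda>y. \<epsilon> (g y))" by (rule lin_compose[OF lin_counit g])
  have b: "bilin W W W (\<lambda>y z. scal W (\<epsilon> (g y)) z)" "bilin W W W (\<lambda>y z. scal W (\<epsilon> (g z)) y)"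
    using W el by (auto intro!: bilinI lin_scal_left lin_scal_right lin_ident)
  show "is_counit W \<Delta>' (\<lambda>y. \<epsilon> (g y))"
    unfolding is_counit_def
  proof (intro conjI ballI el)
    fix y assume y: "y \<in> pts W"
    have "lift W W W (\<lambda>y z. scal W (\<epsilon> (g y)) z) (\<Delta>' y) = lift V V W (\<lambda>a b. scal W (\<epsilon> a) (f b)) (\<Delta> (g y))"
      unfolding lift'[OF y y W b(1)] by (rule lift_eqI) (simp add: gf)
    also have "\<dots> = y"
      using counit_lift_left[OF W f gm[OF y]] fg[OF y] by simp
    finally show "lift W W W (\<lambda>y z. scal W (\<epsilon> (g y)) z) (\<Delta>' y) = y" .
    have "lift W W W (\<lambda>y z. scal W (\<epsilon> (g z)) y) (\<Delta>' y) = lift V V W (\<lambda>a b. scal W (\<epsilon> b) (f a)) (\<Delta> (g y))"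
      unfolding lift'[OF y y W b(2)] by (rule lift_eqI) (simp add: gf)
    also have "\<dots> = y"
      using counit_lift_right[OF W f gm[OF y]] fg[OF y] by simp
    finally show "lift W W W (\<lambda>y z. scal W (\<epsilon> (g z)) y) (\<Delta>' y) = y" .
  qed
qed

text \<open>
  Coalgebra records on a vector space differ from that space in their further fields.  The following lemmas
  say that the constructions on vector spaces only see the carrier and the scalar multiplication.
\<close>

lemma same_space:
  fixes V :: "('k::field, 'v::ab_group_add, 'z) vspace_scheme" and V' :: "('k, 'v, 'z') vspace_scheme"
  assumes "pts V = pts V'" "scal V = scal V'"
  shows "is_vspace V \<longleftrightarrow> is_vspace V'" and "lin V W = lin V' W" and "lin W2 V = lin W2 V'"
    and "bilin V W3 U3 = bilin V' W3 U3" and "bilin W4 V U4 = bilin W4 V' U4" and "bilin W5 U5 V = bilin W5 U5 V'"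
proof -
  show "is_vspace V \<longleftrightarrow> is_vspace V'"
    unfolding is_vspace_def assms ..
  show "lin V W = lin V' W"
    by (intro ext) (simp add: lin_def assms)
  show "lin W2 V = lin W2 V'"
    by (intro ext) (simp add: lin_def assms)
  show "bilin V W3 U3 = bilin V' W3 U3"
    by (intro ext) (simp add: bilin_def lin_def assms)
  show "bilin W4 V U4 = bilin W4 V' U4"
    by (intro ext) (simp add: bilin_def lin_def assms)
  show "bilin W5 U5 V = bilin W5 U5 V'"
    by (intro ext) (simp add: bilin_def lin_def assms)
qed

lemma same_space_tensor:
  fixes V :: "('k::field, 'v::ab_group_add, 'z) vspace_scheme" and V' :: "('k, 'v, 'z') vspace_scheme"
  assumes "pts V = pts V'" "scal V = scal V'"
  shows "tens V W = tens V' W" and "tens W2 V = tens W2 V'"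
    and "V \<otimes> W3 = V' \<otimes> W3" and "W4 \<otimes> V = W4 \<otimes> V'"
proof -
  show "tens V W = tens V' W"
    by (intro ext) (simp add: tens_def same_space[OF assms])
  show "tens W2 V = tens W2 V'"
    by (intro ext) (simp add: tens_def same_space[OF assms])
  show "V \<otimes> W3 = V' \<otimes> W3" "W4 \<otimes> V = W4 \<otimes> V'"
    by (simp_all add: tensor_def tens_def same_space[OF assms] assms)
qed

lemma same_space_lift:
  fixes V :: "('k::field, 'v::ab_group_add, 'z) vspace_scheme" and V' :: "('k, 'v, 'z') vspace_scheme"
  assumes "pts V = pts V'" "scal V = scal V'"
  shows "lift V W U = lift V' W U" and "lift W2 V U2 = lift W2 V' U2" and "lift W3 U3 V = lift W3 U3 V'"
  by (intro ext, simp add: lift_def same_space[OF assms] same_space_tensor[OF assms] assms)+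

lemma same_space_coalg:
  fixes V :: "('k::field, 'v::ab_group_add, 'z) vspace_scheme" and V' :: "('k, 'v, 'z') vspace_scheme"
  assumes "pts V = pts V'" "scal V = scal V'"
  shows "is_counit V \<Delta> \<epsilon> = is_counit V' \<Delta> \<epsilon>" and "coassociative V \<Delta> = coassociative V' \<Delta>"
    and "coalg_str V \<Delta> \<epsilon> = coalg_str V' \<Delta> \<epsilon>"
proof -
  note S = same_space[OF assms] same_space_tensor[OF assms] same_space_lift[OF assms] assms
  show 1: "is_counit V \<Delta> \<epsilon> = is_counit V' \<Delta> \<epsilon>"
    unfolding is_counit_def S ..
  show 2: "coassociative V \<Delta> = coassociative V' \<Delta>"
    unfolding coassociative_def assoc_def tmap_def S ..
  show "coalg_str V \<Delta> \<epsilon> = coalg_str V' \<Delta> \<epsilon>"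
    unfolding coalg_str_def 1 2 S ..
qed

lemma coalgebra_twisted_tensor:
  "coalgebra (twisted_tensor C D \<Psi>) \<longleftrightarrow> coalg_str (C \<otimes> D) (twisted_comult C D \<Psi>) (counit (twisted_tensor C D \<Psi>))"
proof -
  have s: "pts (twisted_tensor C D \<Psi>) = pts (C \<otimes> D)" "scal (twisted_tensor C D \<Psi>) = scal (C \<otimes> D)"
    and c: "comult (twisted_tensor C D \<Psi>) = twisted_comult C D \<Psi>"
    by (simp_all add: twisted_tensor_def)
  show ?thesis
    unfolding coalgebra_coalg_str same_space_coalg(3)[OF s] c ..
qed

text \<open>
  The counit of \<open>twisted_tensor\<close> is a choice; by uniqueness it is any counit that is known.
\<close>

lemma counit_twisted_tensor:
  assumes "coalg_str (C \<otimes> D) (twisted_comult C D \<Psi>) \<eta>"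
  shows "coalgebra (twisted_tensor C D \<Psi>)" and "x \<in> pts (C \<otimes> D) \<Longrightarrow> counit (twisted_tensor C D \<Psi>) x = \<eta> x"
proof -
  interpret coalg_str "C \<otimes> D" "twisted_comult C D \<Psi>" \<eta> by fact
  have c: "is_counit (C \<otimes> D) (twisted_comult C D \<Psi>) (counit (twisted_tensor C D \<Psi>))"
    using someI[of "is_counit (C \<otimes> D) (twisted_comult C D \<Psi>)", OF cou] by (simp add: twisted_tensor_def)
  show "x \<in> pts (C \<otimes> D) \<Longrightarrow> counit (twisted_tensor C D \<Psi>) x = \<eta> x"
    by (rule counit_unique[OF vs com c cou])
  show "coalgebra (twisted_tensor C D \<Psi>)"
    unfolding coalgebra_twisted_tensor by unfold_locales (fact com coass c is_vspace_tensor)+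
qed

lemma coalgebra_tensor_coalgebra:
  "coalgebra (tensor_coalgebra C D) \<longleftrightarrow> coalg_str (C \<otimes> D) (comult (tensor_coalgebra C D)) (counit2 C D)"
proof -
  have s: "pts (tensor_coalgebra C D) = pts (C \<otimes> D)" "scal (tensor_coalgebra C D) = scal (C \<otimes> D)"
    and c: "counit (tensor_coalgebra C D) = counit2 C D"
    by (simp_all add: tensor_coalgebra_def)
  show ?thesis
    unfolding coalgebra_coalg_str same_space_coalg(3)[OF s] c ..
qed

lemma coalgebra_iso_comp:
  assumes f: "coalgebra_iso A B f" and g: "coalgebra_iso B E g"
  shows "coalgebra_iso A E (\<lambda>x. g (f x))"
proof -
  have v: "is_vspace A" "is_vspace B" "is_vspace E" and A: "lin A (A \<otimes> A) (comult A)"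
    using f g by (auto simp: coalgebra_iso_def coalgebra_def)
  have lf: "lin A B f" and lg: "lin B E g" using f g by (auto simp: coalgebra_iso_def)
  have "comult E (g (f x)) = tmap A A E E (\<lambda>x. g (f x)) (\<lambda>x. g (f x)) (comult A x)" if x: "x \<in> pts A" for x
  proof -
    have "comult E (g (f x)) = tmap B B E E g g (tmap A A B B f f (comult A x))"
      using f g x lin_mem[OF lf x] by (simp add: coalgebra_iso_def)
    also have "\<dots> = tmap A A E E (\<lambda>x. g (f x)) (\<lambda>x. g (f x)) (comult A x)"
      unfolding tmap_def[of B B E E] tmap_def[of A A E E] using v lf lg x
      by (intro lift_tmap) (auto intro!: bilin_compose[OF bilin_tens] lin_mem[OF A])
    finally show ?thesis .
  qed
  then show ?thesis
    using f g lf lg bij_betw_trans[of f "pts A" "pts B" g "pts E"] lin_mem[OF lf]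
    by (auto simp: coalgebra_iso_def lin_compose[OF lg lf] o_def)
qed

lemma lin_inv_into:
  assumes "is_vspace V" "lin V W f" "bij_betw f (pts V) (pts W)"
  shows "lin W V (the_inv_into (pts V) f)"
proof -
  let ?g = "the_inv_into (pts V) f"
  have inj: "inj_on f (pts V)" and im: "f ` pts V = pts W" using assms(3) by (auto simp: bij_betw_def)
  have g: "?g y \<in> pts V" "f (?g y) = y" if "y \<in> pts W" for y
    using that im by (auto intro: the_inv_into_into[OF inj] f_the_inv_into_f[OF inj])
  show ?thesis
    unfolding lin_def using g assms(1,2)
    by (auto intro!: the_inv_into_f_eq[OF inj] vspace_add vspace_scal simp: lin_add[OF assms(2)] lin_scal[OF assms(2)])
qed

lemma coalgebra_iso_inverse:
  assumes f: "coalgebra_iso A B f"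
  shows "coalgebra_iso B A (the_inv_into (pts A) f)"
proof -
  let ?g = "the_inv_into (pts A) f"
  have v: "is_vspace A" "is_vspace B" and A: "lin A (A \<otimes> A) (comult A)"
    using f by (auto simp: coalgebra_iso_def coalgebra_def)
  have lf: "lin A B f" and bij: "bij_betw f (pts A) (pts B)" using f by (auto simp: coalgebra_iso_def)
  have lg: "lin B A ?g" by (rule lin_inv_into[OF v(1) lf bij])
  have inj: "inj_on f (pts A)" and im: "f ` pts A = pts B" using bij by (auto simp: bij_betw_def)
  have gm: "?g y \<in> pts A" and fg: "f (?g y) = y" if "y \<in> pts B" for y
    using that im by (auto intro: the_inv_into_into[OF inj] f_the_inv_into_f[OF inj])
  have gf: "?g (f x) = x" if "x \<in> pts A" for x using that by (rule the_inv_into_f_f[OF inj])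
  have "comult A (?g y) = tmap B B A A ?g ?g (comult B y)" if y: "y \<in> pts B" for y
  proof -
    have "tmap B B A A ?g ?g (comult B y) = tmap B B A A ?g ?g (tmap A A B B f f (comult A (?g y)))"
      using f gm[OF y] fg[OF y] by (metis coalgebra_iso_def)
    also have "\<dots> = comult A (?g y)"
      by (rule tmap_inverse[OF v lf lg gf lin_mem[OF A gm[OF y]]])
    finally show ?thesis ..
  qed
  then show ?thesis
    using f lg bij_betw_the_inv_into[OF bij] gm fg
    by (auto simp: coalgebra_iso_def) metis
qed

section \<open>The co-opposite coalgebra\<close>

definition cop :: "('k::field, 'v::ab_group_add) coalg \<Rightarrow> ('k, 'v) coalg" where
  "cop C = C\<lparr>comult := \<lambda>x. flip C C (comult C x)\<rparr>"

lemma cop_pts [simp]: "pts (cop C) = pts C" "scal (cop C) = scal C" "counit (cop C) = counit C"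
  "comult (cop C) x = flip C C (comult C x)"
  by (simp_all add: cop_def)

lemmas cop_space [simp] = same_space[of "cop C" C for C, OF cop_pts(1,2)]
  same_space_tensor[of "cop C" C for C, OF cop_pts(1,2)] same_space_lift[of "cop C" C for C, OF cop_pts(1,2)]
  same_space_coalg[of "cop C" C for C, OF cop_pts(1,2)]

text \<open>
  Reversing all factors interchanges the two sides of the coassociativity law, taken for the trilinear map
  with its arguments in the opposite order.
\<close>

lemma coalgebra_cop:
  assumes "coalgebra C"
  shows "coalgebra (cop C)"
proof -
  interpret coalg_str C "comult C" "counit C" using assms by (simp add: coalgebra_coalg_str)
  let ?d = "\<lambda>x. flip C C (comult C x)"
  have lin: "lin C (C \<otimes> C) ?d" by (intro lin_compose[OF lin_flip com] vs)
  have "coalg_str C ?d (counit C)"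
  proof
    show "is_vspace C" "lin C (C \<otimes> C) ?d" by (fact vs lin)+
    let ?U = "C \<otimes> (C \<otimes> C)"
    let ?T = "\<lambda>a b c. tens C (C \<otimes> C) a (tens C C b c)"
    note side = bilinI lin_lift_param lin_lift_comp tens_lins lin_ident is_vspace_tensor vs lin lin_mem[OF lin] com com_mem
    show "coassociative C ?d"
      unfolding coassociative_iff[OF vs lin]
    proof
      fix x assume x: "x \<in> pts C"
      have "lift C C ?U (\<lambda>a b. lift C C ?U (\<lambda>p q. ?T p q b) (?d a)) (?d x) =
        lift C C ?U (\<lambda>a b. lift C C ?U (\<lambda>p q. ?T p q a) (?d b)) (comult C x)"
        by (rule lift_flip) (auto intro!: side x)
      also have "\<dots> = lift C C ?U (\<lambda>a b. lift C C ?U (\<lambda>p q. ?T q p a) (comult C b)) (comult C x)"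
        by (rule lift_eqI, rule lift_flip) (auto intro!: side)
      also have "\<dots> = lift C C ?U (\<lambda>a b. lift C C ?U (\<lambda>p q. ?T b q p) (comult C a)) (comult C x)"
        by (rule coassoc_lift[where T = "\<lambda>a b c. ?T c b a", symmetric]) (auto intro!: side x)
      also have "\<dots> = lift C C ?U (\<lambda>a b. lift C C ?U (\<lambda>p q. ?T b p q) (?d a)) (comult C x)"
        by (rule lift_eqI, rule lift_flip[symmetric]) (auto intro!: side)
      also have "\<dots> = lift C C ?U (\<lambda>a b. lift C C ?U (\<lambda>p q. ?T a p q) (?d b)) (?d x)"
        by (rule lift_flip[symmetric]) (auto intro!: side x)
      also have "\<dots> = lift C C ?U (\<lambda>a b. tens C (C \<otimes> C) a (?d b)) (?d x)"
      by (rule lift_eqI, rule eq_lift[symmetric, where h = "tens C (C \<otimes> C) _"]) (auto intro!: tens_lins vs lin_mem[OF lin])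
      finally show "lift C C ?U (\<lambda>a b. lift C C ?U (\<lambda>p q. tens C (C \<otimes> C) p (tens C C q b)) (?d a)) (?d x)
        = lift C C ?U (\<lambda>a b. tens C (C \<otimes> C) a (?d b)) (?d x)" .
    qed
    have b: "bilin C C C (\<lambda>y z. scal C (counit C y) z)" "bilin C C C (\<lambda>y z. scal C (counit C z) y)"
      using vs lin_counit by (auto intro!: bilinI lin_scal_left lin_scal_right lin_ident)
    show "is_counit C ?d (counit C)"
      using cou unfolding is_counit_def by (simp add: lift_flip vs b com_mem)
  qed
  moreover have "comult (cop C) = ?d" by (simp add: fun_eq_iff)
  ultimately show ?thesis by (simp add: coalgebra_coalg_str)
qed

section \<open>The tensor product of two coalgebras\<close>

locale coalg_pair =
  fixes C :: "('k::field, 'c::ab_group_add) coalg" and D :: "('k, 'd::ab_group_add) coalg"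
  assumes coalgC: "coalgebra C" and coalgD: "coalgebra D"
begin

sublocale C: coalg_str C "comult C" "counit C"
  using coalgC by (simp add: coalgebra_coalg_str)

sublocale D: coalg_str D "comult D" "counit D"
  using coalgD by (simp add: coalgebra_coalg_str)

abbreviation "X \<equiv> C \<otimes> D"
abbreviation "XX \<equiv> (C \<otimes> D) \<otimes> (C \<otimes> D)"
abbreviation "\<Delta>X \<equiv> comult (tensor_coalgebra C D)"
abbreviation "\<epsilon>X \<equiv> counit2 C D"

lemmas vss [simp, intro] = C.vs D.vs

lemma lin_id [simp]: "lin V V id" by (simp add: lin_def)

lemma lin_mid: "lin X (D \<otimes> C) \<Psi> \<Longrightarrow> lin ((C \<otimes> C) \<otimes> (D \<otimes> D)) XX (mid C D \<Psi>)"
  unfolding mid_def o_def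
  by (rule lin_compose[OF lin_assoc_inv] lin_compose[OF lin_tmap] lin_tmap lin_assoc lin_assoc_inv
      lin_id vss is_vspace_tensor | assumption)+

text \<open>
  On pure tensors all the reassociations in \<open>mid\<close> disappear, up to the value of \<open>\<Psi>\<close>, which is a general
  tensor and has to be expanded by \<open>eq_lift\<close>.
\<close>

lemma mid_tens:
  assumes P: "lin X (D \<otimes> C) \<Psi>" and m: "a \<in> pts C" "b \<in> pts C" "p \<in> pts D" "q \<in> pts D"
  shows "mid C D \<Psi> (tens (C \<otimes> C) (D \<otimes> D) (tens C C a b) (tens D D p q)) =
    lift D C XX (\<lambda>p' b'. tens X X (tens C D a p') (tens C D b' q)) (\<Psi> (tens C D b p))"
proof -
  have s: "\<Psi> (tens C D b p) \<in> pts (D \<otimes> C)"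
    using m by (intro lin_mem[OF P] tens_mem) auto
  have "mid C D \<Psi> (tens (C \<otimes> C) (D \<otimes> D) (tens C C a b) (tens D D p q)) =
    assoc_inv C D X (tens C (D \<otimes> X) a (assoc D C D (tens (D \<otimes> C) D (\<Psi> (tens C D b p)) q)))"
    using m s P unfolding mid_def
    by (simp add: assoc_tens tmap_tens assoc_inv_tens lin_assoc lin_assoc_inv lin_tmap tens_mem)
  also have "\<dots> = lift D C XX (\<lambda>p' b'. assoc_inv C D X (tens C (D \<otimes> X) a (assoc D C D (tens (D \<otimes> C) D (tens D C p' b') q)))) (\<Psi> (tens C D b p))"
    by (rule eq_lift[where h = "\<lambda>s. assoc_inv C D X (tens C (D \<otimes> X) a (assoc D C D (tens (D \<otimes> C) D s q)))"])
      (use m s in \<open>auto intro!: lin_compose[OF lin_assoc_inv] lin_compose[OF lin_assoc] tens_lins\<close>)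
  also have "\<dots> = lift D C XX (\<lambda>p' b'. tens X X (tens C D a p') (tens C D b' q)) (\<Psi> (tens C D b p))"
    by (rule fun_cong[OF lift_cong]) (use m in \<open>simp add: assoc_tens assoc_inv_tens tens_mem\<close>)
  finally show ?thesis .
qed

lemma lin_tmap_com: "lin X ((C \<otimes> C) \<otimes> (D \<otimes> D)) (tmap C D (C \<otimes> C) (D \<otimes> D) (comult C) (comult D))"
  by (auto intro!: lin_tmap C.com D.com)

lemma lin_twisted_comult: "lin X (D \<otimes> C) \<Psi> \<Longrightarrow> lin X XX (twisted_comult C D \<Psi>)"
  unfolding twisted_comult_def o_def
  by (rule lin_compose[OF lin_mid lin_tmap_com])

lemma twisted_comult_tens:
  assumes P: "lin X (D \<otimes> C) \<Psi>" and c: "c \<in> pts C" and d: "d \<in> pts D"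
  shows "twisted_comult C D \<Psi> (tens C D c d) =
    lift C C XX (\<lambda>a b. lift D D XX (\<lambda>p q.
      lift D C XX (\<lambda>p' b'. tens X X (tens C D a p') (tens C D b' q)) (\<Psi> (tens C D b p)))
      (comult D d)) (comult C c)"
proof -
  let ?h = "\<lambda>s t. mid C D \<Psi> (tens (C \<otimes> C) (D \<otimes> D) s t)"
  have "twisted_comult C D \<Psi> (tens C D c d) = ?h (comult C c) (comult D d)"
    using c d by (simp add: twisted_comult_def tmap_tens C.com D.com)
  also have "\<dots> = lift C C XX (\<lambda>a b. ?h (tens C C a b) (comult D d)) (comult C c)"
    using c d by (intro eq_lift[where h = "\<lambda>s. ?h s (comult D d)"] lin_compose[OF lin_mid[OF P]])
      (auto intro!: tens_lins C.com_mem D.com_mem)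
  also have "\<dots> = lift C C XX (\<lambda>a b. lift D D XX (\<lambda>p q. ?h (tens C C a b) (tens D D p q)) (comult D d)) (comult C c)"
    using d by (intro fun_cong[OF lift_cong] eq_lift[where h = "?h _"] lin_compose[OF lin_mid[OF P]])
      (auto intro!: tens_lins D.com_mem)
  also have "\<dots> = lift C C XX (\<lambda>a b. lift D D XX (\<lambda>p q.
      lift D C XX (\<lambda>p' b'. tens X X (tens C D a p') (tens C D b' q)) (\<Psi> (tens C D b p)))
      (comult D d)) (comult C c)"
    by (intro fun_cong[OF lift_cong] mid_tens[OF P])
  finally show ?thesis .
qed

lemma tensor_comult_twisted: "\<Delta>X = twisted_comult C D (flip C D)"
  by (simp add: tensor_coalgebra_def twisted_comult_def)

lemma lin_comult: "lin X XX \<Delta>X"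
  unfolding tensor_comult_twisted by (intro lin_twisted_comult lin_flip) auto

lemma comult_mem: "x \<in> pts X \<Longrightarrow> \<Delta>X x \<in> pts XX"
  by (rule lin_mem[OF lin_comult])

lemma comult_tens:
  assumes c: "c \<in> pts C" and d: "d \<in> pts D"
  shows "\<Delta>X (tens C D c d) = lift C C XX (\<lambda>a b. lift D D XX (\<lambda>p q. tens X X (tens C D a p) (tens C D b q))
      (comult D d)) (comult C c)"
  unfolding tensor_comult_twisted
  by (subst twisted_comult_tens) (use c d in \<open>auto intro!: lin_flip fun_cong[OF lift_cong] lift_tens bilinI tens_lins simp: flip_tens\<close>)

text \<open>
  Reduces every computation in \<open>C \<otimes> D\<close> to iterated Sweedler sums over elements of \<open>C\<close> and \<open>D\<close>.
\<close>

lemma lift_comult: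
  assumes U: "is_vspace U" and F: "bilin X X U F" and c: "c \<in> pts C" and d: "d \<in> pts D"
  shows "lift X X U F (\<Delta>X (tens C D c d)) =
    lift C C U (\<lambda>a b. lift D D U (\<lambda>p q. F (tens C D a p) (tens C D b q)) (comult D d)) (comult C c)"
proof -
  let ?h = "lift X X U F"
  have h: "lin XX U ?h" using U F by (intro lin_lift) auto
  have "?h (\<Delta>X (tens C D c d)) = lift C C U (\<lambda>a b. ?h (lift D D XX (\<lambda>p q. tens X X (tens C D a p) (tens C D b q))
      (comult D d))) (comult C c)"
    unfolding comult_tens[OF c d]
    by (rule lift_post[where h = ?h]) (use U h c d in \<open>auto intro!: bilinI lin_lift_param tens_lins C.com_mem D.com_mem\<close>)
  also have "\<dots> = lift C C U (\<lambda>a b. lift D D U (\<lambda>p q. ?h (tens X X (tens C D a p) (tens C D b q))) (comult D d)) (comult C c)"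
    by (intro fun_cong[OF lift_cong] lift_post[where h = ?h]) (use U h c d in \<open>auto intro!: bilinI lin_lift_param tens_lins C.com_mem D.com_mem\<close>)
  also have "\<dots> = lift C C U (\<lambda>a b. lift D D U (\<lambda>p q. F (tens C D a p) (tens C D b q)) (comult D d)) (comult C c)"
    using U F by (intro fun_cong[OF lift_cong] lift_tens) (auto intro!: tens_mem)
  finally show ?thesis .
qed

text \<open>
  At a pure tensor both sides become fourfold Sweedler sums, two over the first factor and two over the second.
  After an interchange the two sums over the same factor are adjacent, and coassociativity of \<open>C\<close> and of \<open>D\<close>
  applies.
\<close>

lemma coassociative_tensor: "coassociative X \<Delta>X"
proof -
  let ?U = "X \<otimes> (X \<otimes> X)"
  let ?T = "\<lambda>u v w. tens X (X \<otimes> X) u (tens X X v w)"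
  note side = bilinI lin_lift_param lin_lift_comp tens_lins comult_mem C.com_mem D.com_mem lin_comult C.com D.com
  have pure: "lift X X ?U (\<lambda>u w. lift X X ?U (\<lambda>v v'. ?T v v' w) (\<Delta>X u)) (\<Delta>X (tens C D c d)) =
      lift X X ?U (\<lambda>u w. lift X X ?U (\<lambda>v v'. ?T u v v') (\<Delta>X w)) (\<Delta>X (tens C D c d))"
    if c: "c \<in> pts C" and d: "d \<in> pts D" for c d
  proof -
    let ?LC = "lift C C ?U" and ?LD = "lift D D ?U"
    let ?t = "tens C D"
    have "lift X X ?U (\<lambda>u w. lift X X ?U (\<lambda>v v'. ?T v v' w) (\<Delta>X u)) (\<Delta>X (tens C D c d)) =
      ?LC (\<lambda>a b. ?LD (\<lambda>p q. lift X X ?U (\<lambda>v v'. ?T v v' (?t b q)) (\<Delta>X (?t a p))) (comult D d)) (comult C c)"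
      using c d by (intro lift_comult) (auto intro!: side)
    also have "\<dots> = ?LC (\<lambda>a b. ?LD (\<lambda>p q. ?LC (\<lambda>a1 a2. ?LD (\<lambda>p1 p2. ?T (?t a1 p1) (?t a2 p2) (?t b q)) (comult D p)) (comult C a)) (comult D d)) (comult C c)"
      by (intro fun_cong[OF lift_cong] lift_comult) (auto intro!: side)
    also have "\<dots> = ?LC (\<lambda>a b. ?LC (\<lambda>a1 a2. ?LD (\<lambda>p q. ?LD (\<lambda>p1 p2. ?T (?t a1 p1) (?t a2 p2) (?t b q)) (comult D p)) (comult D d)) (comult C a)) (comult C c)"
      using d by (rule_tac fun_cong[OF lift_cong], rule_tac lift_swap) (auto intro!: side)
    also have "\<dots> = ?LC (\<lambda>a b. ?LC (\<lambda>a1 a2. ?LD (\<lambda>p q. ?LD (\<lambda>p1 p2. ?T (?t a1 p) (?t a2 p1) (?t b p2)) (comult D q)) (comult D d)) (comult C a)) (comult C c)"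
      by (rule fun_cong[OF lift_cong], rule fun_cong[OF lift_cong],
          rule D.coassoc_lift[where T = "\<lambda>p1 p2 q. ?T (?t _ p1) (?t _ p2) (?t _ q)"]) (use d in \<open>auto intro!: side\<close>)
    also have "\<dots> = ?LC (\<lambda>a b. ?LC (\<lambda>a1 a2. ?LD (\<lambda>p q. ?LD (\<lambda>p1 p2. ?T (?t a p) (?t a1 p1) (?t a2 p2)) (comult D q)) (comult D d)) (comult C b)) (comult C c)"
      by (rule C.coassoc_lift[where T = "\<lambda>a1 a2 b. ?LD (\<lambda>p q. ?LD (\<lambda>p1 p2. ?T (?t a1 p) (?t a2 p1) (?t b p2)) (comult D q)) (comult D d)"])
        (use c d in \<open>auto intro!: side\<close>)
    also have "\<dots> = ?LC (\<lambda>a b. ?LD (\<lambda>p q. ?LC (\<lambda>a1 a2. ?LD (\<lambda>p1 p2. ?T (?t a p) (?t a1 p1) (?t a2 p2)) (comult D q)) (comult C b)) (comult D d)) (comult C c)"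
      by (rule fun_cong[OF lift_cong], rule lift_swap) (use d in \<open>auto intro!: side\<close>)
    also have "\<dots> = ?LC (\<lambda>a b. ?LD (\<lambda>p q. lift X X ?U (\<lambda>v v'. ?T (?t a p) v v') (\<Delta>X (?t b q))) (comult D d)) (comult C c)"
      by (intro fun_cong[OF lift_cong] lift_comult[symmetric]) (auto intro!: side)
    also have "\<dots> = lift X X ?U (\<lambda>u w. lift X X ?U (\<lambda>v v'. ?T u v v') (\<Delta>X w)) (\<Delta>X (tens C D c d))"
      using c d by (intro lift_comult[symmetric]) (auto intro!: side)
    finally show ?thesis .
  qed
  have bl1: "bilin X X ?U (\<lambda>u w. lift X X ?U (\<lambda>v v'. ?T v v' w) (\<Delta>X u))"
    and bl2: "bilin X X ?U (\<lambda>u w. lift X X ?U (\<lambda>v v'. ?T u v v') (\<Delta>X w))"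
    by (auto intro!: side lin_mem[OF lin_comult])
  have "lift X X ?U (\<lambda>u w. lift X X ?U (\<lambda>v v'. ?T v v' w) (\<Delta>X u)) (\<Delta>X x) =
      lift X X ?U (\<lambda>u w. tens X (X \<otimes> X) u (\<Delta>X w)) (\<Delta>X x)" if x: "x \<in> pts X" for x
  proof -
    have "lift X X ?U (\<lambda>u w. lift X X ?U (\<lambda>v v'. ?T v v' w) (\<Delta>X u)) (\<Delta>X x) =
      lift X X ?U (\<lambda>u w. lift X X ?U (\<lambda>v v'. ?T u v v') (\<Delta>X w)) (\<Delta>X x)"
      by (rule tensor_universal_uniq[OF vss is_vspace_tensor[of X "X \<otimes> X"],
            where g = "\<lambda>x. lift X X ?U (\<lambda>u w. lift X X ?U (\<lambda>v v'. ?T v v' w) (\<Delta>X u)) (\<Delta>X x)"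
              and h = "\<lambda>x. lift X X ?U (\<lambda>u w. lift X X ?U (\<lambda>v v'. ?T u v v') (\<Delta>X w)) (\<Delta>X x)"])
        (auto intro!: lin_lift_comp bl1 bl2 lin_comult pure x)
    also have "\<dots> = lift X X ?U (\<lambda>u w. tens X (X \<otimes> X) u (\<Delta>X w)) (\<Delta>X x)"
      by (intro fun_cong[OF lift_cong] eq_lift[symmetric, where h = "tens X (X \<otimes> X) _"])
        (auto intro!: tens_lins lin_mem[OF lin_comult])
    finally show ?thesis .
  qed
  then show ?thesis
    unfolding coassociative_iff[OF is_vspace_tensor lin_comult] by blast
qed

lemma bilin_counit2: "bilin C D ground (\<lambda>c d. counit C c * counit D d)"
  by (auto intro!: bilinI lin_mult_left lin_mult_right C.lin_counit D.lin_counit)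

lemma lin_counit2: "lin X ground \<epsilon>X"
  unfolding counit2_def by (intro lin_lift bilin_counit2) auto

lemma counit2_tens: "c \<in> pts C \<Longrightarrow> d \<in> pts D \<Longrightarrow> \<epsilon>X (tens C D c d) = counit C c * counit D d"
  unfolding counit2_def by (intro lift_tens bilin_counit2) auto

lemma scal_tens: "c \<in> pts C \<Longrightarrow> d \<in> pts D \<Longrightarrow> scal X (k * l) (tens C D c d) = tens C D (scal C k c) (scal D l d)"
  using lin_scal[OF bilin_left[OF bilin_tens[OF vss]], of d c k]
    lin_scal[OF bilin_right[OF bilin_tens[OF vss]], of "scal C k c" d l]
  by (simp add: vspace_scal scal_simps(3)[OF is_vspace_tensor] mult.commute)

lemma is_counit_tensor: "is_counit X \<Delta>X \<epsilon>X"
  unfolding is_counit_def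
proof (intro conjI ballI lin_counit2)
  note side = bilinI lin_lift_param lin_lift_comp lin_scal_left lin_scal_right lin_tens_left lin_tens_right
    lin_ident tens_mem lin_counit2 C.com_mem D.com_mem vspace_scal C.lin_counit D.lin_counit lin_compose[OF lin_counit2]
  have bl: "bilin X X X (\<lambda>y z. scal X (\<epsilon>X y) z)" "bilin X X X (\<lambda>y z. scal X (\<epsilon>X z) y)"
    by (auto intro!: bilinI lin_scal_left lin_scal_right lin_ident lin_counit2)
  fix x assume x: "x \<in> pts X"
  have idl: "lift C C C (\<lambda>a b. scal C (counit C a) b) (comult C c) = c"
    "lift C C C (\<lambda>a b. scal C (counit C b) a) (comult C c) = c" if "c \<in> pts C" for c
    using C.cou that by (auto simp: is_counit_def)
  have idr: "lift D D D (\<lambda>a b. scal D (counit D a) b) (comult D c) = c"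
    "lift D D D (\<lambda>a b. scal D (counit D b) a) (comult D c) = c" if "c \<in> pts D" for c
    using D.cou that by (auto simp: is_counit_def)
  have b: "bilin C C C (\<lambda>a b. scal C (counit C a) b)" "bilin C C C (\<lambda>a b. scal C (counit C b) a)"
    "bilin D D D (\<lambda>a b. scal D (counit D a) b)" "bilin D D D (\<lambda>a b. scal D (counit D b) a)"
    by (auto intro!: bilinI lin_scal_left lin_scal_right lin_ident C.lin_counit D.lin_counit)
  show "lift X X X (\<lambda>y z. scal X (\<epsilon>X y) z) (\<Delta>X x) = x"
  proof (rule tensor_universal_uniq[OF vss is_vspace_tensor _ lin_ident _ x])
    show "lin X X (\<lambda>x. lift X X X (\<lambda>y z. scal X (\<epsilon>X y) z) (\<Delta>X x))"
      by (intro lin_lift_comp bl lin_comult) auto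
    fix c d assume c: "c \<in> pts C" and d: "d \<in> pts D"
    have "lift X X X (\<lambda>y z. scal X (\<epsilon>X y) z) (\<Delta>X (tens C D c d)) =
      lift C C X (\<lambda>a b. lift D D X (\<lambda>p q. scal X (\<epsilon>X (tens C D a p)) (tens C D b q)) (comult D d)) (comult C c)"
      by (rule lift_comult[OF is_vspace_tensor bl(1) c d])
    also have "\<dots> = lift C C X (\<lambda>a b. lift D D X (\<lambda>p q. tens C D (scal C (counit C a) b) (scal D (counit D p) q)) (comult D d)) (comult C c)"
      by (rule fun_cong[OF lift_cong], rule fun_cong[OF lift_cong]) (simp add: counit2_tens scal_tens)
    also have "\<dots> = tens C D c d"
      using c d by (subst lift_tens_split) (auto simp: idl idr intro!: b C.com_mem D.com_mem)
    finally show "lift X X X (\<lambda>y z. scal X (\<epsilon>X y) z) (\<Delta>X (tens C D c d)) = tens C D c d" .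
  qed
  show "lift X X X (\<lambda>y z. scal X (\<epsilon>X z) y) (\<Delta>X x) = x"
  proof (rule tensor_universal_uniq[OF vss is_vspace_tensor _ lin_ident _ x])
    show "lin X X (\<lambda>x. lift X X X (\<lambda>y z. scal X (\<epsilon>X z) y) (\<Delta>X x))"
      by (intro lin_lift_comp bl lin_comult) auto
    fix c d assume c: "c \<in> pts C" and d: "d \<in> pts D"
    have "lift X X X (\<lambda>y z. scal X (\<epsilon>X z) y) (\<Delta>X (tens C D c d)) =
      lift C C X (\<lambda>a b. lift D D X (\<lambda>p q. scal X (\<epsilon>X (tens C D b q)) (tens C D a p)) (comult D d)) (comult C c)"
      by (rule lift_comult[OF is_vspace_tensor bl(2) c d])
    also have "\<dots> = lift C C X (\<lambda>a b. lift D D X (\<lambda>p q. tens C D (scal C (counit C b) a) (scal D (counit D q) p)) (comult D d)) (comult C c)"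
      by (rule fun_cong[OF lift_cong], rule fun_cong[OF lift_cong]) (simp add: counit2_tens scal_tens)
    also have "\<dots> = tens C D c d"
      using c d by (subst lift_tens_split) (auto simp: idl idr intro!: b C.com_mem D.com_mem)
    finally show "lift X X X (\<lambda>y z. scal X (\<epsilon>X z) y) (\<Delta>X (tens C D c d)) = tens C D c d" .
  qed
qed

sublocale X: coalg_str X \<Delta>X \<epsilon>X
  by unfold_locales (simp_all add: lin_comult coassociative_tensor is_counit_tensor)

lemma conv_eq:
  assumes "lin X ground \<phi>" "lin X ground \<psi>" "t \<in> pts X"
  shows "conv C D \<phi> \<psi> t = lact X \<Delta>X ground \<phi> \<psi> t"
proof -
  have bl: "bilin X X ground (\<lambda>a b. \<phi> a * \<psi> b)"
    using assms by (auto intro!: bilinI lin_mult_left lin_mult_right)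
  have "lact X \<Delta>X ground \<phi> \<psi> t = lift C D ground (\<lambda>c d. lact X \<Delta>X ground \<phi> \<psi> (tens C D c d)) t"
    using assms by (intro eq_lift X.lin_lact) auto
  also have "\<dots> = conv C D \<phi> \<psi> t"
    unfolding conv_def
    by (rule fun_cong[OF lift_cong]) (simp add: lact_def convol_def sw_def tens_mem lift_comult[OF _ bl])
  finally show ?thesis ..
qed

end

context coalg_pair
begin

abbreviation left_act (\<open>(_ \<triangleright>\<^bsub>_\<^esub> _)\<close> [81, 0, 80] 80)
  where "e \<triangleright>\<^bsub>U\<^esub> F \<equiv> lact X \<Delta>X U e F"
abbreviation right_act (\<open>(_ \<triangleleft>\<^bsub>_\<^esub> _)\<close> [80, 0, 81] 80)
  where "F \<triangleleft>\<^bsub>U\<^esub> e \<equiv> ract X \<Delta>X U F e"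
abbreviation tens_act (\<open>(_ \<odot>\<^bsub>_,_\<^esub> _)\<close> [79, 0, 0, 78] 78)
  where "F \<odot>\<^bsub>U,W\<^esub> G \<equiv> tprod X \<Delta>X U W F G"

lemma eq_on_tensI:
  assumes "is_vspace U" "lin X U g" "lin X U h"
    "\<And>c d. c \<in> pts C \<Longrightarrow> d \<in> pts D \<Longrightarrow> g (tens C D c d) = h (tens C D c d)" "x \<in> pts X"
  shows "g x = h x"
  by (rule tensor_universal_uniq[OF vss assms(1-3) assms(4,5)])

lemma convol_tens:
  assumes "is_vspace U" "bilin A B U m" "lin X A F" "lin X B G" "c \<in> pts C" "d \<in> pts D"
  shows "convol X \<Delta>X U m F G (tens C D c d) =
    lift C C U (\<lambda>a b. lift D D U (\<lambda>p q. m (F (tens C D a p)) (G (tens C D b q))) (comult D d)) (comult C c)"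
  using lift_comult[OF assms(1) bilin_compose[OF assms(2-4)] assms(5,6)] assms(5,6)
  by (simp add: convol_def tens_mem)

text \<open>The projections of \<open>C \<otimes> D\<close> to its factors; they are homomorphisms of coalgebras.\<close>

definition "\<pi>C = lift C D C (\<lambda>c d. scal C (counit D d) c)"
definition "\<pi>D = lift C D D (\<lambda>c d. scal D (counit C c) d)"

lemma bilin_pi: "bilin C D C (\<lambda>c d. scal C (counit D d) c)" "bilin C D D (\<lambda>c d. scal D (counit C c) d)"
  by (auto intro!: bilinI lin_scal_left lin_scal_right lin_ident C.lin_counit D.lin_counit)

lemma lin_piC: "lin X C \<pi>C" and lin_piD: "lin X D \<pi>D"
  unfolding \<pi>C_def \<pi>D_def by (auto intro!: lin_lift bilin_pi)

lemma piC_tens: "c \<in> pts C \<Longrightarrow> d \<in> pts D \<Longrightarrow> \<pi>C (tens C D c d) = scal C (counit D d) c"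
  and piD_tens: "c \<in> pts C \<Longrightarrow> d \<in> pts D \<Longrightarrow> \<pi>D (tens C D c d) = scal D (counit C c) d"
  unfolding \<pi>C_def \<pi>D_def by (rule lift_tens; auto intro: bilin_pi)+

lemmas Xlins = X.lin_lact X.lin_ract X.lin_tprod lin_ident X.lin_counit lin_piC lin_piD

lemma counit_piC: "x \<in> pts X \<Longrightarrow> counit C (\<pi>C x) = \<epsilon>X x"
  by (rule eq_on_tensI[OF is_vspace_ground lin_compose[OF C.lin_counit lin_piC] lin_counit2])
    (simp_all add: piC_tens counit2_tens lin_scal[OF C.lin_counit] mult.commute)

lemma counit_piD: "x \<in> pts X \<Longrightarrow> counit D (\<pi>D x) = \<epsilon>X x"
  by (rule eq_on_tensI[OF is_vspace_ground lin_compose[OF D.lin_counit lin_piD] lin_counit2])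
    (simp_all add: piD_tens counit2_tens lin_scal[OF D.lin_counit])

lemma comult_piC: "x \<in> pts X \<Longrightarrow> comult C (\<pi>C x) = (\<pi>C \<odot>\<^bsub>C,C\<^esub> \<pi>C) x"
proof (rule eq_on_tensI[OF is_vspace_tensor lin_compose[OF C.com lin_piC]])
  fix c d assume c: "c \<in> pts C" and d: "d \<in> pts D"
  have lc: "lin D (C \<otimes> C) (\<lambda>q. scal (C \<otimes> C) (counit D q) (tens C C a b))" if "a \<in> pts C" "b \<in> pts C" for a b
    using that by (auto intro!: lin_scal_left D.lin_counit tens_mem)
  have "(\<pi>C \<odot>\<^bsub>C,C\<^esub> \<pi>C) (tens C D c d) =
    lift C C (C \<otimes> C) (\<lambda>a b. lift D D (C \<otimes> C) (\<lambda>p q. tens C C (\<pi>C (tens C D a p)) (\<pi>C (tens C D b q))) (comult D d)) (comult C c)"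
    unfolding tprod_def
    by (rule convol_tens[OF is_vspace_tensor bilin_tens lin_piC lin_piC c d]) auto
  also have "\<dots> = lift C C (C \<otimes> C) (\<lambda>a b. lift D D (C \<otimes> C) (\<lambda>p q. scal (C \<otimes> C) (counit D p) (scal (C \<otimes> C) (counit D q) (tens C C a b))) (comult D d)) (comult C c)"
    by (rule fun_cong[OF lift_cong], rule fun_cong[OF lift_cong])
      (simp add: piC_tens vspace_scal lin_scal[OF bilin_left[OF bilin_tens]] lin_scal[OF bilin_right[OF bilin_tens]] scal_simps(3)[OF is_vspace_tensor] mult.commute)
  also have "\<dots> = lift C C (C \<otimes> C) (\<lambda>a b. scal (C \<otimes> C) (counit D d) (tens C C a b)) (comult C c)"
    by (rule fun_cong[OF lift_cong]) (intro D.counit_lift_left lc is_vspace_tensor d)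
  also have "\<dots> = scal (C \<otimes> C) (counit D d) (lift C C (C \<otimes> C) (tens C C) (comult C c))"
    using c by (intro lift_post[symmetric, where h = "scal (C \<otimes> C) _"])
      (auto intro!: bilin_tens lin_scal_right[OF lin_ident] C.com_mem)
  also have "\<dots> = comult C (\<pi>C (tens C D c d))"
    using c d eq_lift[OF _ _ _ lin_ident C.com_mem, of c] by (simp add: piC_tens lin_scal[OF C.com])
  finally show "comult C (\<pi>C (tens C D c d)) = (\<pi>C \<odot>\<^bsub>C,C\<^esub> \<pi>C) (tens C D c d)" ..
qed (intro Xlins vss)

lemma comult_piD: "x \<in> pts X \<Longrightarrow> comult D (\<pi>D x) = (\<pi>D \<odot>\<^bsub>D,D\<^esub> \<pi>D) x"
proof (rule eq_on_tensI[OF is_vspace_tensor lin_compose[OF D.com lin_piD]])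
  fix c d assume c: "c \<in> pts C" and d: "d \<in> pts D"
  have lc: "lin D (D \<otimes> D) (\<lambda>p. scal (D \<otimes> D) k (f p))" if "lin D (D \<otimes> D) f" for f k
    using that by (auto intro!: lin_scal_right)
  have bl: "bilin D D (D \<otimes> D) (\<lambda>p q. scal (D \<otimes> D) k (tens D D p q))" for k
    by (auto intro!: bilinI lin_scal_right tens_lins)
  have lb: "lin C (D \<otimes> D) (\<lambda>b. scal (D \<otimes> D) (counit C b) u)" if "u \<in> pts (D \<otimes> D)" for u
    using that by (auto intro!: lin_scal_left C.lin_counit)
  have "(\<pi>D \<odot>\<^bsub>D,D\<^esub> \<pi>D) (tens C D c d) =
    lift C C (D \<otimes> D) (\<lambda>a b. lift D D (D \<otimes> D) (\<lambda>p q. tens D D (\<pi>D (tens C D a p)) (\<pi>D (tens C D b q))) (comult D d)) (comult C c)"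
    unfolding tprod_def
    by (rule convol_tens[OF is_vspace_tensor bilin_tens lin_piD lin_piD c d]) auto
  also have "\<dots> = lift C C (D \<otimes> D) (\<lambda>a b. lift D D (D \<otimes> D) (\<lambda>p q. scal (D \<otimes> D) (counit C a * counit C b) (tens D D p q)) (comult D d)) (comult C c)"
    by (rule fun_cong[OF lift_cong], rule fun_cong[OF lift_cong])
      (simp add: piD_tens vspace_scal lin_scal[OF bilin_left[OF bilin_tens]] lin_scal[OF bilin_right[OF bilin_tens]] scal_simps(3)[OF is_vspace_tensor] mult.commute)
  also have "\<dots> = lift C C (D \<otimes> D) (\<lambda>a b. scal (D \<otimes> D) (counit C a) (scal (D \<otimes> D) (counit C b) (comult D d))) (comult C c)"
  proof (rule fun_cong[OF lift_cong])
    fix a b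
    have "lift D D (D \<otimes> D) (\<lambda>p q. scal (D \<otimes> D) (counit C a * counit C b) (tens D D p q)) (comult D d) =
      scal (D \<otimes> D) (counit C a * counit C b) (lift D D (D \<otimes> D) (tens D D) (comult D d))"
      using d by (intro lift_post[symmetric, where h = "scal (D \<otimes> D) _"])
        (auto intro!: bilin_tens lin_scal_right[OF lin_ident] D.com_mem)
    then show "lift D D (D \<otimes> D) (\<lambda>p q. scal (D \<otimes> D) (counit C a * counit C b) (tens D D p q)) (comult D d) =
      scal (D \<otimes> D) (counit C a) (scal (D \<otimes> D) (counit C b) (comult D d))"
      using d eq_lift[OF _ _ _ lin_ident D.com_mem, of d] by (simp add: scal_simps(3)[OF is_vspace_tensor])
  qed
  also have "\<dots> = scal (D \<otimes> D) (counit C c) (comult D d)"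
    using c d by (intro C.counit_lift_left lb D.com_mem) auto
  also have "\<dots> = comult D (\<pi>D (tens C D c d))"
    using c d by (simp add: piD_tens lin_scal[OF D.com])
  finally show "comult D (\<pi>D (tens C D c d)) = (\<pi>D \<odot>\<^bsub>D,D\<^esub> \<pi>D) (tens C D c d)" ..
qed (intro Xlins vss)

end

section \<open>Twists and their linear forms\<close>

context coalg_pair
begin

abbreviation "DC \<equiv> D \<otimes> C"

lemma Tw_lin: "\<Psi>' \<in> Tw C D \<Longrightarrow> lin DC DC \<Psi>'"
  by (simp add: Tw_def)

lemma bilin_counit2': "bilin D C ground (\<lambda>d c. counit D d * counit C c)"
  by (auto intro!: bilinI lin_mult_left lin_mult_right C.lin_counit D.lin_counit)

lemma lin_counit2': "lin DC ground (counit2 D C)"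
  unfolding counit2_def by (intro lin_lift bilin_counit2') auto

lemma counit2'_tens: "c \<in> pts C \<Longrightarrow> d \<in> pts D \<Longrightarrow> counit2 D C (tens D C d c) = counit D d * counit C c"
  unfolding counit2_def by (intro lift_tens bilin_counit2') auto

text \<open>
  The left coaction of \<open>D\<close> and the right coaction of \<open>C\<close> on \<open>D \<otimes> C\<close>; the set \<open>Tw\<close> consists of the linear maps that
  commute with both.
\<close>

definition "coact_D t = assoc D D C (tmap D C (D \<otimes> D) C (comult D) id t)"
definition "coact_C t = assoc_inv D C C (tmap D C D (C \<otimes> C) id (comult C) t)"

lemma lin_coact_D: "lin DC (D \<otimes> DC) coact_D"
  unfolding coact_D_def by (intro lin_compose[OF lin_assoc] lin_tmap D.com) auto

lemma lin_coact_C: "lin DC (DC \<otimes> C) coact_C"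
  unfolding coact_C_def by (intro lin_compose[OF lin_assoc_inv] lin_tmap C.com) auto

lemma coact_D_tens:
  assumes f: "lin (D \<otimes> DC) U f" and U: "is_vspace U" and c: "c \<in> pts C" and d: "d \<in> pts D"
  shows "f (coact_D (tens D C d c)) = lift D D U (\<lambda>d1 d2. f (tens D DC d1 (tens D C d2 c))) (comult D d)"
proof -
  have "f (coact_D (tens D C d c)) = f (assoc D D C (tens (D \<otimes> D) C (comult D d) c))"
    unfolding coact_D_def using c d by (simp add: tmap_tens D.com)
  also have "\<dots> = lift D D U (\<lambda>d1 d2. f (assoc D D C (tens (D \<otimes> D) C (tens D D d1 d2) c))) (comult D d)"
    by (rule eq_lift[where h = "\<lambda>s. f (assoc D D C (tens (D \<otimes> D) C s c))"])
      (use U c d in \<open>auto intro!: lin_compose[OF f] lin_compose[OF lin_assoc] tens_lins D.com_mem\<close>)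
  also have "\<dots> = lift D D U (\<lambda>d1 d2. f (tens D DC d1 (tens D C d2 c))) (comult D d)"
    by (rule lift_eqI) (use c in \<open>simp add: assoc_tens\<close>)
  finally show ?thesis .
qed

lemma coact_C_tens:
  assumes f: "lin (DC \<otimes> C) U f" and U: "is_vspace U" and c: "c \<in> pts C" and d: "d \<in> pts D"
  shows "f (coact_C (tens D C d c)) = lift C C U (\<lambda>c1 c2. f (tens DC C (tens D C d c1) c2)) (comult C c)"
proof -
  have "f (coact_C (tens D C d c)) = f (assoc_inv D C C (tens D (C \<otimes> C) d (comult C c)))"
    unfolding coact_C_def using c d by (simp add: tmap_tens C.com)
  also have "\<dots> = lift C C U (\<lambda>c1 c2. f (assoc_inv D C C (tens D (C \<otimes> C) d (tens C C c1 c2)))) (comult C c)"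
    by (rule eq_lift[where h = "\<lambda>s. f (assoc_inv D C C (tens D (C \<otimes> C) d s))"])
      (use U c d in \<open>auto intro!: lin_compose[OF f] lin_compose[OF lin_assoc_inv] tens_lins C.com_mem\<close>)
  also have "\<dots> = lift C C U (\<lambda>c1 c2. f (tens DC C (tens D C d c1) c2)) (comult C c)"
    by (rule lift_eqI) (use d in \<open>simp add: assoc_inv_tens\<close>)
  finally show ?thesis .
qed

text \<open>
  The map \<open>h = id \<otimes> \<epsilon>\<^sub>D \<otimes> id\<close> is a left inverse of the coaction of \<open>D\<close>.  Applied to the colinearity condition
  it expresses \<open>\<Psi>'\<close> by \<open>(\<epsilon>\<^sub>D \<otimes> id) \<Psi>'\<close>.  The next lemma does the same for \<open>C\<close>.
\<close>

lemma Tw_left: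
  assumes P: "\<Psi>' \<in> Tw C D" and c: "c \<in> pts C" and d: "d \<in> pts D"
  shows "\<Psi>' (tens D C d c) = lift D D DC (\<lambda>d1 d2.
    tens D C d1 (lift D C C (\<lambda>d c. scal C (counit D d) c) (\<Psi>' (tens D C d2 c)))) (comult D d)"
proof -
  note L = Tw_lin[OF P]
  let ?U = "D \<otimes> C"
  let ?\<eta> = "lift D C C (\<lambda>d c. scal C (counit D d) c)"
  have bl: "bilin D C C (\<lambda>d c. scal C (counit D d) c)"
    by (auto intro!: bilinI lin_scal_left lin_scal_right lin_ident D.lin_counit)
  have \<eta>: "lin ?U C ?\<eta>" by (intro lin_lift bl) auto
  define h where "h = tmap D ?U D C id ?\<eta>"
  have h: "lin (D \<otimes> ?U) ?U h" unfolding h_def by (intro lin_tmap \<eta>) auto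
  have ht: "h (tens D ?U d1 u) = tens D C d1 (?\<eta> u)" if "d1 \<in> pts D" "u \<in> pts ?U" for d1 u
    unfolding h_def using that by (simp add: tmap_tens \<eta>)
  have inv: "h (coact_D t) = t" if "t \<in> pts ?U" for t
  proof (rule tensor_universal_uniq[OF vss(2,1) is_vspace_tensor _ lin_ident _ that])
    show "lin ?U ?U (\<lambda>t. h (coact_D t))" by (rule lin_compose[OF h lin_coact_D])
    fix d c assume d: "d \<in> pts D" and c: "c \<in> pts C"
    have "h (coact_D (tens D C d c)) = lift D D ?U (\<lambda>d1 d2. scal ?U (counit D d2) (tens D C d1 c)) (comult D d)"
      unfolding coact_D_tens[OF h is_vspace_tensor c d]
      by (rule fun_cong[OF lift_cong])
        (use c in \<open>simp add: ht tens_mem lift_tens[OF _ _ _ bl] lin_scal[OF bilin_right[OF bilin_tens]]\<close>)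
    also have "\<dots> = tens D C d c"
      by (rule D.counit_lift_right) (use c d in \<open>auto intro!: tens_lins\<close>)
    finally show "h (coact_D (tens D C d c)) = tens D C d c" .
  qed
  have m: "tens D C d c \<in> pts ?U" using c d by (intro tens_mem) auto
  have "coact_D (\<Psi>' (tens D C d c)) = tmap D ?U D ?U id \<Psi>' (coact_D (tens D C d c))"
    using P m by (simp add: Tw_def coact_D_def)
  then have "\<Psi>' (tens D C d c) = h (tmap D ?U D ?U id \<Psi>' (coact_D (tens D C d c)))"
    using inv[OF lin_mem[OF L m]] by simp
  also have "\<dots> = lift D D ?U (\<lambda>d1 d2. h (tmap D ?U D ?U id \<Psi>' (tens D ?U d1 (tens D C d2 c)))) (comult D d)"
    by (rule coact_D_tens[OF lin_compose[OF h lin_tmap[OF vss(2) is_vspace_tensor vss(2) is_vspace_tensor lin_id L]] is_vspace_tensor c d])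
  also have "\<dots> = lift D D ?U (\<lambda>d1 d2. tens D C d1 (?\<eta> (\<Psi>' (tens D C d2 c)))) (comult D d)"
    by (rule fun_cong[OF lift_cong]) (use c L in \<open>simp add: tmap_tens ht tens_mem lin_mem[OF L]\<close>)
  finally show ?thesis .
qed

lemma Tw_right:
  assumes P: "\<Psi>' \<in> Tw C D" and c: "c \<in> pts C" and d: "d \<in> pts D"
  shows "\<Psi>' (tens D C d c) = lift C C DC (\<lambda>c1 c2.
    tens D C (lift D C D (\<lambda>d c. scal D (counit C c) d) (\<Psi>' (tens D C d c1))) c2) (comult C c)"
proof -
  note L = Tw_lin[OF P]
  let ?U = "D \<otimes> C"
  let ?\<eta> = "lift D C D (\<lambda>d c. scal D (counit C c) d)"
  have bl: "bilin D C D (\<lambda>d c. scal D (counit C c) d)"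
    by (auto intro!: bilinI lin_scal_left lin_scal_right lin_ident C.lin_counit)
  have \<eta>: "lin ?U D ?\<eta>" by (intro lin_lift bl) auto
  define h where "h = tmap ?U C D C ?\<eta> id"
  have h: "lin (?U \<otimes> C) ?U h" unfolding h_def by (intro lin_tmap \<eta>) auto
  have ht: "h (tens ?U C u c1) = tens D C (?\<eta> u) c1" if "c1 \<in> pts C" "u \<in> pts ?U" for c1 u
    unfolding h_def using that by (simp add: tmap_tens \<eta>)
  have inv: "h (coact_C t) = t" if "t \<in> pts ?U" for t
  proof (rule tensor_universal_uniq[OF vss(2,1) is_vspace_tensor _ lin_ident _ that])
    show "lin ?U ?U (\<lambda>t. h (coact_C t))" by (rule lin_compose[OF h lin_coact_C])
    fix d c assume d: "d \<in> pts D" and c: "c \<in> pts C"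
    have "h (coact_C (tens D C d c)) = lift C C ?U (\<lambda>c1 c2. scal ?U (counit C c1) (tens D C d c2)) (comult C c)"
      unfolding coact_C_tens[OF h is_vspace_tensor c d]
      by (rule fun_cong[OF lift_cong])
        (use d in \<open>simp add: ht tens_mem lift_tens[OF _ _ _ bl] lin_scal[OF bilin_left[OF bilin_tens]]\<close>)
    also have "\<dots> = tens D C d c"
      by (rule C.counit_lift_left) (use c d in \<open>auto intro!: tens_lins\<close>)
    finally show "h (coact_C (tens D C d c)) = tens D C d c" .
  qed
  have m: "tens D C d c \<in> pts ?U" using c d by (intro tens_mem) auto
  have "coact_C (\<Psi>' (tens D C d c)) = tmap ?U C ?U C \<Psi>' id (coact_C (tens D C d c))"
    using P m by (simp add: Tw_def coact_C_def)
  then have "\<Psi>' (tens D C d c) = h (tmap ?U C ?U C \<Psi>' id (coact_C (tens D C d c)))"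
    using inv[OF lin_mem[OF L m]] by simp
  also have "\<dots> = lift C C ?U (\<lambda>c1 c2. h (tmap ?U C ?U C \<Psi>' id (tens ?U C (tens D C d c1) c2))) (comult C c)"
    by (rule coact_C_tens[OF lin_compose[OF h lin_tmap[OF is_vspace_tensor vss(1) is_vspace_tensor vss(1) L lin_id]] is_vspace_tensor c d])
  also have "\<dots> = lift C C ?U (\<lambda>c1 c2. tens D C (?\<eta> (\<Psi>' (tens D C d c1))) c2) (comult C c)"
    by (rule fun_cong[OF lift_cong]) (use d L in \<open>simp add: tmap_tens ht tens_mem lin_mem[OF L]\<close>)
  finally show ?thesis .
qed

text \<open>The twist that maps \<open>c \<otimes> d\<close> to the Sweedler sum of \<open>\<phi> (c\<^sub>1 \<otimes> d\<^sub>2) d\<^sub>1 \<otimes> c\<^sub>2\<close>.\<close>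

definition twist_of_form where
  "twist_of_form \<phi> = lift C D DC (\<lambda>c d. lift D D DC (\<lambda>d1 d2. lift C C DC (\<lambda>c1 c2.
     scal DC (\<phi> (tens C D c1 d2)) (tens D C d1 c2)) (comult C c)) (comult D d))"

lemma twist_of_form:
  assumes \<phi>: "lin X ground \<phi>"
  shows lin_twist_of_form: "lin X DC (twist_of_form \<phi>)"
    and twist_of_form_tens: "c \<in> pts C \<Longrightarrow> d \<in> pts D \<Longrightarrow> twist_of_form \<phi> (tens C D c d) =
      lift D D DC (\<lambda>d1 d2. lift C C DC (\<lambda>c1 c2.
     scal DC (\<phi> (tens C D c1 d2)) (tens D C d1 c2)) (comult C c)) (comult D d)"
proof -
  have bl: "bilin C D DC (\<lambda>c d. lift D D DC (\<lambda>d1 d2. lift C C DC (\<lambda>c1 c2.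
     scal DC (\<phi> (tens C D c1 d2)) (tens D C d1 c2)) (comult C c)) (comult D d))"
    by (auto intro!: bilinI lin_lift_param lin_lift_comp lin_scal_left lin_scal_right lin_compose[OF \<phi>] tens_lins
        C.com D.com C.com_mem D.com_mem)
  show "lin X DC (twist_of_form \<phi>)"
    and "c \<in> pts C \<Longrightarrow> d \<in> pts D \<Longrightarrow> twist_of_form \<phi> (tens C D c d) =
      lift D D DC (\<lambda>d1 d2. lift C C DC (\<lambda>c1 c2.
     scal DC (\<phi> (tens C D c1 d2)) (tens D C d1 c2)) (comult C c)) (comult D d)"
    unfolding twist_of_form_def by (intro lin_lift lift_tens bl is_vspace_tensor vss; assumption)+
qed

text \<open>
  By \<open>Tw_left\<close> the value \<open>\<Psi> (c \<otimes> d)\<close> is determined by the elements \<open>(\<epsilon>\<^sub>D \<otimes> id) \<Psi>' (d\<^sub>2 \<otimes> c)\<close> of \<open>C\<close>, and by \<open>Tw_right\<close>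
  these are determined by the scalars \<open>(\<epsilon>\<^sub>D \<otimes> \<epsilon>\<^sub>C) \<Psi>' (d\<^sub>2 \<otimes> c\<^sub>1)\<close>.
\<close>

lemma Tw_determined:
  assumes P: "\<Psi>' \<in> Tw C D" and \<Psi>: "\<Psi> = \<Psi>' \<circ> flip C D"
  shows Tw_lin_twist: "lin X DC \<Psi>" and Tw_lin_phi: "lin X ground (phi C D \<Psi>)"
    and Tw_eq_twist_of_form: "x \<in> pts X \<Longrightarrow> \<Psi> x = twist_of_form (phi C D \<Psi>) x"
proof -
  let ?U = "D \<otimes> C"
  note L = Tw_lin[OF P]
  show lP: "lin X ?U \<Psi>" unfolding \<Psi> o_def by (intro lin_compose[OF L lin_flip]) auto
  show lphi: "lin X ground (phi C D \<Psi>)" unfolding phi_def o_def by (rule lin_compose[OF lin_counit2' lP])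
  let ?\<phi> = "phi C D \<Psi>"
  let ?e = "lift D C C (\<lambda>d c. scal C (counit D d) c)"
  let ?f = "lift D C D (\<lambda>d c. scal D (counit C c) d)"
  have bl: "bilin D C C (\<lambda>d c. scal C (counit D d) c)" "bilin D C D (\<lambda>d c. scal D (counit C c) d)"
    by (auto intro!: bilinI lin_scal_left lin_scal_right lin_ident C.lin_counit D.lin_counit)
  have e: "lin ?U C ?e" and f: "lin ?U D ?f" by (auto intro!: lin_lift bl)
  have ef: "counit D (?f u) = counit2 D C u" if "u \<in> pts ?U" for u
    by (rule tensor_universal_uniq[OF vss(2,1) is_vspace_ground lin_compose[OF D.lin_counit f] lin_counit2' _ that])
      (simp add: lift_tens[OF _ _ _ bl(2)] counit2'_tens lin_scal[OF D.lin_counit] mult.commute)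
  have \<Psi>t: "\<Psi> (tens C D c d) = \<Psi>' (tens D C d c)" if "c \<in> pts C" "d \<in> pts D" for c d
    using that by (simp add: \<Psi> flip_tens)
  have e\<Psi>: "?e (\<Psi>' (tens D C d c)) = lift C C C (\<lambda>c1 c2. scal C (?\<phi> (tens C D c1 d)) c2) (comult C c)"
    if c: "c \<in> pts C" and d: "d \<in> pts D" for c d
  proof -
    have "?e (\<Psi>' (tens D C d c)) = lift C C C (\<lambda>c1 c2. ?e (tens D C (?f (\<Psi>' (tens D C d c1))) c2)) (comult C c)"
      unfolding Tw_right[OF P c d]
      by (rule lift_post[where h = ?e])
        (use c d in \<open>auto intro!: bilinI e tens_lins lin_compose[OF f] lin_compose[OF L] lin_mem[OF f] lin_mem[OF L] C.com_mem\<close>)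
    also have "\<dots> = lift C C C (\<lambda>c1 c2. scal C (?\<phi> (tens C D c1 d)) c2) (comult C c)"
      by (rule fun_cong[OF lift_cong])
        (use d in \<open>simp add: lift_tens[OF _ _ _ bl(1)] lin_mem[OF f] lin_mem[OF L] tens_mem ef phi_def \<Psi>t\<close>)
    finally show ?thesis .
  qed
  have pure: "\<Psi> (tens C D c d) = twist_of_form ?\<phi> (tens C D c d)" if c: "c \<in> pts C" and d: "d \<in> pts D" for c d
  proof -
    have "\<Psi> (tens C D c d) = lift D D ?U (\<lambda>d1 d2. tens D C d1 (lift C C C (\<lambda>c1 c2. scal C (?\<phi> (tens C D c1 d2)) c2) (comult C c))) (comult D d)"
      unfolding \<Psi>t[OF c d] Tw_left[OF P c d]
      by (rule fun_cong[OF lift_cong]) (simp add: e\<Psi> c)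
    also have "\<dots> = lift D D ?U (\<lambda>d1 d2. lift C C ?U (\<lambda>c1 c2. tens D C d1 (scal C (?\<phi> (tens C D c1 d2)) c2)) (comult C c)) (comult D d)"
      by (rule fun_cong[OF lift_cong], rule lift_post[where h = "tens D C _"])
        (use c in \<open>auto intro!: bilinI tens_lins lin_scal_left lin_scal_right lin_compose[OF lphi] C.com_mem\<close>)
    also have "\<dots> = twist_of_form ?\<phi> (tens C D c d)"
      unfolding twist_of_form_tens[OF lphi c d]
      by (rule fun_cong[OF lift_cong], rule fun_cong[OF lift_cong]) (simp add: lin_scal[OF bilin_right[OF bilin_tens]])
    finally show ?thesis .
  qed
  show "x \<in> pts X \<Longrightarrow> \<Psi> x = twist_of_form ?\<phi> x"
    by (rule eq_on_tensI[OF is_vspace_tensor lP lin_twist_of_form[OF lphi] pure])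
qed

lemma twisted_comult_cong:
  assumes "lin X DC \<Psi>" "lin X DC \<Psi>2" "\<And>x. x \<in> pts X \<Longrightarrow> \<Psi> x = \<Psi>2 x" "x \<in> pts X"
  shows "twisted_comult C D \<Psi> x = twisted_comult C D \<Psi>2 x"
proof (rule eq_on_tensI[OF is_vspace_tensor lin_twisted_comult[OF assms(1)] lin_twisted_comult[OF assms(2)] _ assms(4)])
  fix c d assume "c \<in> pts C" "d \<in> pts D"
  then show "twisted_comult C D \<Psi> (tens C D c d) = twisted_comult C D \<Psi>2 (tens C D c d)"
    by (simp add: twisted_comult_tens assms(1,2))
      (rule lift_eqI, rule lift_eqI, simp add: assms(3) tens_mem)
qed

text \<open>
  In Sweedler notation both sides are \<open>\<phi> (c\<^sub>2 \<otimes> d\<^sub>2) (c\<^sub>1 \<otimes> d\<^sub>1) \<otimes> (c\<^sub>3 \<otimes> d\<^sub>3)\<close>.  On the left the factors of \<open>d\<close> come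
  from applying the twist to \<open>c\<^sub>2 \<otimes> d\<^sub>1\<close>, that is from splitting \<open>d\<^sub>1\<close> again, on the right from splitting \<open>d\<^sub>2\<close>.
\<close>

lemma twisted_comult_of_form:
  assumes \<phi>: "lin X ground \<phi>" and x: "x \<in> pts X"
  shows "twisted_comult C D (twist_of_form \<phi>) x = (((\<lambda>x. x) \<triangleleft>\<^bsub>X\<^esub> \<phi>) \<odot>\<^bsub>X,X\<^esub> (\<lambda>x. x)) x"
proof (rule eq_on_tensI[OF is_vspace_tensor lin_twisted_comult[OF lin_twist_of_form[OF \<phi>]] _ _ x])
  show "lin X XX (((\<lambda>x. x) \<triangleleft>\<^bsub>X\<^esub> \<phi>) \<odot>\<^bsub>X,X\<^esub> (\<lambda>x. x))"
    by (intro Xlins \<phi>) auto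
  fix c d assume c: "c \<in> pts C" and d: "d \<in> pts D"
  let ?LC = "lift C C XX" and ?LD = "lift D D XX" and ?t = "tens C D" and ?tt = "tens X X"
  note side = bilinI lin_lift_param lin_lift_comp lin_scal_left lin_scal_right lin_compose[OF \<phi>] lin_tens_left lin_tens_right
    lin_ident tens_mem vspace_scal C.com_mem D.com_mem C.com D.com is_vspace_tensor
  let ?B = "\<lambda>a q d1 b1. ?tt (?t a d1) (?t b1 q)"
  have K: "lift D C XX (?B a q) (twist_of_form \<phi> (?t b p)) =
    ?LD (\<lambda>p1 p2. ?LC (\<lambda>b1 b2. scal XX (\<phi> (?t b1 p2)) (?tt (?t a p1) (?t b2 q))) (comult C b)) (comult D p)"
    if m: "a \<in> pts C" "b \<in> pts C" "p \<in> pts D" "q \<in> pts D" for a b p q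
  proof -
    have bl: "bilin D C XX (?B a q)" using m by (auto intro!: side)
    have lk: "lin DC XX (lift D C XX (?B a q))" by (intro lin_lift bl) auto
    have "lift D C XX (?B a q) (twist_of_form \<phi> (?t b p)) =
      ?LD (\<lambda>p1 p2. lift D C XX (?B a q) (lift C C DC (\<lambda>b1 b2. scal DC (\<phi> (?t b1 p2)) (tens D C p1 b2)) (comult C b))) (comult D p)"
      unfolding twist_of_form_tens[OF \<phi> m(2,3)]
      by (rule lift_post[where h = "lift D C XX (?B a q)"]) (use m lk in \<open>auto intro!: side\<close>)
    also have "\<dots> = ?LD (\<lambda>p1 p2. ?LC (\<lambda>b1 b2. lift D C XX (?B a q) (scal DC (\<phi> (?t b1 p2)) (tens D C p1 b2))) (comult C b)) (comult D p)"
      by (rule lift_eqI, rule lift_post[where h = "lift D C XX (?B a q)"]) (use m lk in \<open>auto intro!: side\<close>)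
    also have "\<dots> = ?LD (\<lambda>p1 p2. ?LC (\<lambda>b1 b2. scal XX (\<phi> (?t b1 p2)) (?tt (?t a p1) (?t b2 q))) (comult C b)) (comult D p)"
      by (rule lift_eqI, rule lift_eqI) (simp add: lin_scal[OF lk] tens_mem lift_tens[OF _ _ _ bl])
    finally show ?thesis .
  qed
  have "twisted_comult C D (twist_of_form \<phi>) (?t c d) =
    ?LC (\<lambda>a b. ?LD (\<lambda>p q. lift D C XX (?B a q) (twist_of_form \<phi> (?t b p))) (comult D d)) (comult C c)"
    by (rule twisted_comult_tens[OF lin_twist_of_form[OF \<phi>] c d])
  also have "\<dots> = ?LC (\<lambda>a b. ?LD (\<lambda>p q. ?LD (\<lambda>p1 p2. ?LC (\<lambda>b1 b2. scal XX (\<phi> (?t b1 p2)) (?tt (?t a p1) (?t b2 q))) (comult C b)) (comult D p)) (comult D d)) (comult C c)"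
    by (rule lift_eqI, rule lift_eqI) (rule K)
  also have "\<dots> = ?LC (\<lambda>a b. ?LD (\<lambda>p q. ?LD (\<lambda>p1 p2. ?LC (\<lambda>b1 b2. scal XX (\<phi> (?t b1 p1)) (?tt (?t a p) (?t b2 p2))) (comult C b)) (comult D q)) (comult D d)) (comult C c)"
    by (rule lift_eqI, rule D.coassoc_lift[where T = "\<lambda>p1 p2 q. ?LC (\<lambda>b1 b2. scal XX (\<phi> (?t b1 p2)) (?tt (?t _ p1) (?t b2 q))) (comult C _)"])
      (use d in \<open>auto intro!: side\<close>)
  also have "\<dots> = ?LC (\<lambda>a b. ?LD (\<lambda>p q. ?LC (\<lambda>b1 b2. ?LD (\<lambda>p1 p2. scal XX (\<phi> (?t b1 p1)) (?tt (?t a p) (?t b2 p2))) (comult D q)) (comult C b)) (comult D d)) (comult C c)"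
    by (rule lift_eqI, rule lift_eqI, rule lift_swap) (auto intro!: side)
  also have "\<dots> = ?LC (\<lambda>a b. ?LD (\<lambda>p q. ?tt (?t a p) ((\<phi> \<triangleright>\<^bsub>X\<^esub> (\<lambda>x. x)) (?t b q))) (comult D d)) (comult C c)"
  proof (rule lift_eqI, rule lift_eqI)
    fix a b p q assume m: "a \<in> pts C" "b \<in> pts C" "p \<in> pts D" "q \<in> pts D"
    have l: "lin X XX (?tt (?t a p))" using m by (auto intro!: side)
    have "?tt (?t a p) ((\<phi> \<triangleright>\<^bsub>X\<^esub> (\<lambda>x. x)) (?t b q)) =
      ?tt (?t a p) (lift C C X (\<lambda>b1 b2. lift D D X (\<lambda>p1 p2. scal X (\<phi> (?t b1 p1)) (?t b2 p2)) (comult D q)) (comult C b))"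
      unfolding lact_def using m by (subst convol_tens[OF is_vspace_tensor bilin_scal(1) \<phi> lin_ident]) auto
    also have "\<dots> = ?LC (\<lambda>b1 b2. ?tt (?t a p) (lift D D X (\<lambda>p1 p2. scal X (\<phi> (?t b1 p1)) (?t b2 p2)) (comult D q))) (comult C b)"
      by (rule lift_post[where h = "?tt (?t a p)"]) (use m l in \<open>auto intro!: side\<close>)
    also have "\<dots> = ?LC (\<lambda>b1 b2. ?LD (\<lambda>p1 p2. ?tt (?t a p) (scal X (\<phi> (?t b1 p1)) (?t b2 p2))) (comult D q)) (comult C b)"
      by (rule lift_eqI, rule lift_post[where h = "?tt (?t a p)"]) (use m l in \<open>auto intro!: side\<close>)
    also have "\<dots> = ?LC (\<lambda>b1 b2. ?LD (\<lambda>p1 p2. scal XX (\<phi> (?t b1 p1)) (?tt (?t a p) (?t b2 p2))) (comult D q)) (comult C b)"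
      by (rule lift_eqI, rule lift_eqI) (simp add: lin_scal[OF l] tens_mem)
    finally show "?LC (\<lambda>b1 b2. ?LD (\<lambda>p1 p2. scal XX (\<phi> (?t b1 p1)) (?tt (?t a p) (?t b2 p2))) (comult D q)) (comult C b) =
      ?tt (?t a p) ((\<phi> \<triangleright>\<^bsub>X\<^esub> (\<lambda>x. x)) (?t b q))" ..
  qed
  also have "\<dots> = ((\<lambda>x. x) \<odot>\<^bsub>X,X\<^esub> (\<phi> \<triangleright>\<^bsub>X\<^esub> (\<lambda>x. x))) (?t c d)"
    unfolding tprod_def using c d
    by (intro convol_tens[symmetric, OF is_vspace_tensor bilin_tens lin_ident]) (auto intro!: Xlins \<phi>)
  also have "\<dots> = (((\<lambda>x. x) \<triangleleft>\<^bsub>X\<^esub> \<phi>) \<odot>\<^bsub>X,X\<^esub> (\<lambda>x. x)) (?t c d)"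
    by (subst X.tprod_middle) (auto intro!: lin_ident \<phi>)
  finally show "twisted_comult C D (twist_of_form \<phi>) (?t c d) = (((\<lambda>x. x) \<triangleleft>\<^bsub>X\<^esub> \<phi>) \<odot>\<^bsub>X,X\<^esub> (\<lambda>x. x)) (?t c d)" .
qed

lemma phi_twist_of_form:
  assumes \<phi>: "lin X ground \<phi>" and \<Psi>: "lin X DC \<Psi>" "\<And>x. x \<in> pts X \<Longrightarrow> \<Psi> x = twist_of_form \<phi> x" and x: "x \<in> pts X"
  shows "phi C D \<Psi> x = \<phi> x"
proof -
  note side = bilinI lin_lift_param lin_lift_comp lin_scal_left lin_scal_right lin_compose[OF \<phi>] tens_lins
    C.com_mem D.com_mem C.com D.com C.lin_counit D.lin_counit vspace_scal vss is_vspace_tensor lin_counit2'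
    lin_mult_left lin_mult_right
  have l: "lin X ground (\<lambda>x. counit2 D C (twist_of_form \<phi> x))"
    by (rule lin_compose[OF lin_counit2' lin_twist_of_form[OF \<phi>]])
  have "counit2 D C (twist_of_form \<phi> x) = \<phi> x"
  proof (rule eq_on_tensI[OF is_vspace_ground l \<phi> _ x])
    fix c d assume c: "c \<in> pts C" and d: "d \<in> pts D"
    have "counit2 D C (twist_of_form \<phi> (tens C D c d)) =
      lift D D ground (\<lambda>d1 d2. counit2 D C (lift C C DC (\<lambda>c1 c2. scal DC (\<phi> (tens C D c1 d2)) (tens D C d1 c2)) (comult C c))) (comult D d)"
      unfolding twist_of_form_tens[OF \<phi> c d]
      by (rule lift_post[where h = "counit2 D C"]) (use c d in \<open>auto intro!: side\<close>)
    also have "\<dots> = lift D D ground (\<lambda>d1 d2. lift C C ground (\<lambda>c1 c2. counit2 D C (scal DC (\<phi> (tens C D c1 d2)) (tens D C d1 c2))) (comult C c)) (comult D d)"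
      by (rule lift_eqI, rule lift_post[where h = "counit2 D C"]) (use c d in \<open>auto intro!: side\<close>)
    also have "\<dots> = lift D D ground (\<lambda>d1 d2. lift C C ground (\<lambda>c1 c2. scal ground (counit C c2) (counit D d1 * \<phi> (tens C D c1 d2))) (comult C c)) (comult D d)"
      by (rule lift_eqI, rule lift_eqI) (simp add: lin_scal[OF lin_counit2'] tens_mem counit2'_tens mult_ac)
    also have "\<dots> = lift D D ground (\<lambda>d1 d2. scal ground (counit D d1) (\<phi> (tens C D c d2))) (comult D d)"
      by (rule lift_eqI, subst C.counit_lift_right) (use c in \<open>auto intro!: side\<close>)
    also have "\<dots> = \<phi> (tens C D c d)"
      by (rule D.counit_lift_left) (use c d in \<open>auto intro!: side\<close>)
    finally show "counit2 D C (twist_of_form \<phi> (tens C D c d)) = \<phi> (tens C D c d)" .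
  qed
  then show ?thesis using \<Psi>(2)[OF x] by (simp add: phi_def)
qed

text \<open>
  Conversely every linear form gives an element of \<open>Tw\<close>; this provides the twist of the example.  Colinearity
  holds because \<open>d\<^sub>1\<close> stays on the far left and \<open>c\<^sub>2\<close> on the far right.
\<close>

lemma twist_of_form_in_Tw:
  assumes \<phi>: "lin X ground \<phi>"
  shows "twist_of_form \<phi> \<circ> flip D C \<in> Tw C D"
proof -
  let ?P = "twist_of_form \<phi> \<circ> flip D C" and ?U = "D \<otimes> C" and ?DU = "D \<otimes> DC" and ?UC = "DC \<otimes> C"
  let ?t = "tens D C" and ?f = "\<lambda>c d. \<phi> (tens C D c d)"
  have L: "lin ?U ?U ?P" unfolding o_def by (intro lin_compose[OF lin_twist_of_form[OF \<phi>] lin_flip] vss)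
  note side = bilinI lin_lift_param lin_lift_comp lin_scal_left lin_scal_right lin_compose[OF \<phi>] tens_lins
    C.com_mem D.com_mem C.com D.com vspace_scal vss is_vspace_tensor lin_coact_C lin_coact_D lin_tmap L L[unfolded o_def] lin_id
  have Pt: "?P (?t d c) = lift D D ?U (\<lambda>d1 d2. lift C C ?U (\<lambda>c1 c2. scal ?U (?f c1 d2) (?t d1 c2)) (comult C c)) (comult D d)"
    if "c \<in> pts C" "d \<in> pts D" for c d
    using that by (simp add: flip_tens twist_of_form_tens[OF \<phi>])
  have swap: "?P (?t d c) = lift C C ?U (\<lambda>c1 c2. lift D D ?U (\<lambda>d1 d2. scal ?U (?f c1 d2) (?t d1 c2)) (comult D d)) (comult C c)"
    if "c \<in> pts C" "d \<in> pts D" for c d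
    unfolding Pt[OF that] by (rule lift_swap) (use that in \<open>auto intro!: side\<close>)
  have "coact_D (?P t) = tmap D ?U D ?U id ?P (coact_D t)" if t: "t \<in> pts ?U" for t
  proof (rule tensor_universal_uniq[OF vss(2,1) is_vspace_tensor[of D "D \<otimes> C"] lin_compose[OF lin_coact_D L] lin_compose[OF _ lin_coact_D] _ t])
    show "lin ?DU ?DU (tmap D ?U D ?U id ?P)" by (intro side)
    fix d c assume d: "d \<in> pts D" and c: "c \<in> pts C"
    have "coact_D (?P (?t d c)) = lift C C ?DU (\<lambda>c1 c2. coact_D (lift D D ?U (\<lambda>d1 d2. scal ?U (?f c1 d2) (?t d1 c2)) (comult D d))) (comult C c)"
      unfolding swap[OF c d] by (rule lift_post[where h = coact_D]) (use c d in \<open>auto intro!: side\<close>)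
    also have "\<dots> = lift C C ?DU (\<lambda>c1 c2. lift D D ?DU (\<lambda>d1 d2. coact_D (scal ?U (?f c1 d2) (?t d1 c2))) (comult D d)) (comult C c)"
      by (rule lift_eqI, rule lift_post[where h = coact_D]) (use c d in \<open>auto intro!: side\<close>)
    also have "\<dots> = lift C C ?DU (\<lambda>c1 c2. lift D D ?DU (\<lambda>d1 d2. lift D D ?DU (\<lambda>p q. scal ?DU (?f c1 d2) (tens D ?U p (?t q c2))) (comult D d1)) (comult D d)) (comult C c)"
    proof (rule lift_eqI, rule lift_eqI)
      fix c1 c2 d1 d2 assume m: "c1 \<in> pts C" "c2 \<in> pts C" "d1 \<in> pts D" "d2 \<in> pts D"
      show "coact_D (scal ?U (?f c1 d2) (?t d1 c2)) = lift D D ?DU (\<lambda>p q. scal ?DU (?f c1 d2) (tens D ?U p (?t q c2))) (comult D d1)"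
        using m coact_D_tens[where f = "scal ?DU (?f c1 d2)", OF lin_scal_right[OF lin_ident is_vspace_tensor] is_vspace_tensor m(2,3)]
        by (simp add: lin_scal[OF lin_coact_D] tens_mem)
    qed
    also have "\<dots> = lift C C ?DU (\<lambda>c1 c2. lift D D ?DU (\<lambda>d1 d2. lift D D ?DU (\<lambda>p q. scal ?DU (?f c1 q) (tens D ?U d1 (?t p c2))) (comult D d2)) (comult D d)) (comult C c)"
      by (rule lift_eqI, rule D.coassoc_lift[where T = "\<lambda>p q d2. scal ?DU (?f _ d2) (tens D ?U p (?t q _))"])
        (use c d in \<open>auto intro!: side\<close>)
    also have "\<dots> = lift D D ?DU (\<lambda>d1 d2. lift C C ?DU (\<lambda>c1 c2. lift D D ?DU (\<lambda>p q. scal ?DU (?f c1 q) (tens D ?U d1 (?t p c2))) (comult D d2)) (comult C c)) (comult D d)"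
      by (rule lift_swap) (use c d in \<open>auto intro!: side\<close>)
    also have "\<dots> = lift D D ?DU (\<lambda>d1 d2. tens D ?U d1 (?P (?t d2 c))) (comult D d)"
    proof (rule lift_eqI)
      fix d1 d2 assume m: "d1 \<in> pts D" "d2 \<in> pts D"
      have l: "lin ?U ?DU (tens D ?U d1)" using m by (auto intro!: side)
      have "tens D ?U d1 (?P (?t d2 c)) = lift C C ?DU (\<lambda>c1 c2. tens D ?U d1 (lift D D ?U (\<lambda>p q. scal ?U (?f c1 q) (?t p c2)) (comult D d2))) (comult C c)"
        unfolding swap[OF c m(2)] by (rule lift_post[where h = "tens D ?U d1"]) (use c m in \<open>auto intro!: side\<close>)
      also have "\<dots> = lift C C ?DU (\<lambda>c1 c2. lift D D ?DU (\<lambda>p q. tens D ?U d1 (scal ?U (?f c1 q) (?t p c2))) (comult D d2)) (comult C c)"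
        by (rule lift_eqI, rule lift_post[where h = "tens D ?U d1"]) (use c m in \<open>auto intro!: side\<close>)
      also have "\<dots> = lift C C ?DU (\<lambda>c1 c2. lift D D ?DU (\<lambda>p q. scal ?DU (?f c1 q) (tens D ?U d1 (?t p c2))) (comult D d2)) (comult C c)"
        by (rule lift_eqI, rule lift_eqI) (simp add: lin_scal[OF l] tens_mem)
      finally show "lift C C ?DU (\<lambda>c1 c2. lift D D ?DU (\<lambda>p q. scal ?DU (?f c1 q) (tens D ?U d1 (?t p c2))) (comult D d2)) (comult C c) = tens D ?U d1 (?P (?t d2 c))" ..
    qed
    also have "\<dots> = lift D D ?DU (\<lambda>d1 d2. tmap D ?U D ?U id ?P (tens D ?U d1 (?t d2 c))) (comult D d)"
      by (rule lift_eqI) (use c L in \<open>simp add: tmap_tens tens_mem\<close>)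
    also have "\<dots> = tmap D ?U D ?U id ?P (coact_D (?t d c))"
      by (rule coact_D_tens[symmetric]) (use c d in \<open>auto intro!: side\<close>)
    finally show "coact_D (?P (?t d c)) = tmap D ?U D ?U id ?P (coact_D (?t d c))" .
  qed
  moreover have "coact_C (?P t) = tmap ?U C ?U C ?P id (coact_C t)" if t: "t \<in> pts ?U" for t
  proof (rule tensor_universal_uniq[OF vss(2,1) is_vspace_tensor[of "D \<otimes> C" C] lin_compose[OF lin_coact_C L] lin_compose[OF _ lin_coact_C] _ t])
    show "lin ?UC ?UC (tmap ?U C ?U C ?P id)" by (intro side)
    fix d c assume d: "d \<in> pts D" and c: "c \<in> pts C"
    have "coact_C (?P (?t d c)) = lift D D ?UC (\<lambda>d1 d2. coact_C (lift C C ?U (\<lambda>c1 c2. scal ?U (?f c1 d2) (?t d1 c2)) (comult C c))) (comult D d)"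
      unfolding Pt[OF c d] by (rule lift_post[where h = coact_C]) (use c d in \<open>auto intro!: side\<close>)
    also have "\<dots> = lift D D ?UC (\<lambda>d1 d2. lift C C ?UC (\<lambda>c1 c2. coact_C (scal ?U (?f c1 d2) (?t d1 c2))) (comult C c)) (comult D d)"
      by (rule lift_eqI, rule lift_post[where h = coact_C]) (use c d in \<open>auto intro!: side\<close>)
    also have "\<dots> = lift D D ?UC (\<lambda>d1 d2. lift C C ?UC (\<lambda>c1 c2. lift C C ?UC (\<lambda>p q. scal ?UC (?f c1 d2) (tens ?U C (?t d1 p) q)) (comult C c2)) (comult C c)) (comult D d)"
    proof (rule lift_eqI, rule lift_eqI)
      fix c1 c2 d1 d2 assume m: "d1 \<in> pts D" "d2 \<in> pts D" "c1 \<in> pts C" "c2 \<in> pts C"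
      show "coact_C (scal ?U (?f c1 d2) (?t d1 c2)) = lift C C ?UC (\<lambda>p q. scal ?UC (?f c1 d2) (tens ?U C (?t d1 p) q)) (comult C c2)"
        using m coact_C_tens[where f = "scal ?UC (?f c1 d2)", OF lin_scal_right[OF lin_ident is_vspace_tensor] is_vspace_tensor m(4,1)]
        by (simp add: lin_scal[OF lin_coact_C] tens_mem)
    qed
    also have "\<dots> = lift D D ?UC (\<lambda>d1 d2. lift C C ?UC (\<lambda>c1 c2. lift C C ?UC (\<lambda>p q. scal ?UC (?f p d2) (tens ?U C (?t d1 q) c2)) (comult C c1)) (comult C c)) (comult D d)"
      by (rule lift_eqI, rule C.coassoc_lift[where T = "\<lambda>c1 p q. scal ?UC (?f c1 _) (tens ?U C (?t _ p) q)", symmetric])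
        (use c d in \<open>auto intro!: side\<close>)
    also have "\<dots> = lift C C ?UC (\<lambda>c1 c2. lift D D ?UC (\<lambda>d1 d2. lift C C ?UC (\<lambda>p q. scal ?UC (?f p d2) (tens ?U C (?t d1 q) c2)) (comult C c1)) (comult D d)) (comult C c)"
      by (rule lift_swap) (use c d in \<open>auto intro!: side\<close>)
    also have "\<dots> = lift C C ?UC (\<lambda>c1 c2. tens ?U C (?P (?t d c1)) c2) (comult C c)"
    proof (rule lift_eqI)
      fix c1 c2 assume m: "c1 \<in> pts C" "c2 \<in> pts C"
      have l: "lin ?U ?UC (\<lambda>u. tens ?U C u c2)" using m by (auto intro!: side)
      have "tens ?U C (?P (?t d c1)) c2 = lift D D ?UC (\<lambda>d1 d2. tens ?U C (lift C C ?U (\<lambda>p q. scal ?U (?f p d2) (?t d1 q)) (comult C c1)) c2) (comult D d)"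
        unfolding Pt[OF m(1) d] by (rule lift_post[where h = "\<lambda>u. tens ?U C u c2"]) (use d m in \<open>auto intro!: side\<close>)
      also have "\<dots> = lift D D ?UC (\<lambda>d1 d2. lift C C ?UC (\<lambda>p q. tens ?U C (scal ?U (?f p d2) (?t d1 q)) c2) (comult C c1)) (comult D d)"
        by (rule lift_eqI, rule lift_post[where h = "\<lambda>u. tens ?U C u c2"]) (use d m in \<open>auto intro!: side\<close>)
      also have "\<dots> = lift D D ?UC (\<lambda>d1 d2. lift C C ?UC (\<lambda>p q. scal ?UC (?f p d2) (tens ?U C (?t d1 q) c2)) (comult C c1)) (comult D d)"
        by (rule lift_eqI, rule lift_eqI) (simp add: lin_scal[OF l] tens_mem)
      finally show "lift D D ?UC (\<lambda>d1 d2. lift C C ?UC (\<lambda>p q. scal ?UC (?f p d2) (tens ?U C (?t d1 q) c2)) (comult C c1)) (comult D d) = tens ?U C (?P (?t d c1)) c2" ..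
    qed
    also have "\<dots> = lift C C ?UC (\<lambda>c1 c2. tmap ?U C ?U C ?P id (tens ?U C (?t d c1) c2)) (comult C c)"
      by (rule lift_eqI) (use d L in \<open>simp add: tmap_tens tens_mem\<close>)
    also have "\<dots> = tmap ?U C ?U C ?P id (coact_C (?t d c))"
      by (rule coact_C_tens[symmetric]) (use c d in \<open>auto intro!: side\<close>)
    finally show "coact_C (?P (?t d c)) = tmap ?U C ?U C ?P id (coact_C (?t d c))" .
  qed
  ultimately show ?thesis
    unfolding Tw_def using L by (simp add: coact_C_def coact_D_def)
qed

end

section \<open>The second convolution product\<close>

context coalg_pair
begin

text \<open>The tensor product of \<open>D\<close> with the co-opposite coalgebra of \<open>C\<close>, on the same space \<open>C \<otimes> D\<close>.\<close>

abbreviation "\<Delta>Y \<equiv> comult (tensor_coalgebra (cop C) D)"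

lemma coalg_pair_cop: "coalg_pair (cop C) D"
  by unfold_locales (simp_all add: coalgebra_cop coalgC coalgD)

lemma counit2_cop: "counit2 (cop C) D = \<epsilon>X"
  by (simp add: counit2_def)

lemma coalg_str_cop: "coalg_str X \<Delta>Y \<epsilon>X"
proof -
  interpret Y: coalg_pair "cop C" D by (rule coalg_pair_cop)
  show ?thesis using Y.X.coalg_str_axioms by (simp add: counit2_cop)
qed

lemma cop_lact_pure:
  assumes "is_vspace U" "lin X ground \<phi>" "lin X U F" "c \<in> pts C" "d \<in> pts D"
  shows "lact X \<Delta>Y U \<phi> F (tens C D c d) =
    lift C C U (\<lambda>a b. lift D D U (\<lambda>p q. scal U (\<phi> (tens C D b p)) (F (tens C D a q))) (comult D d)) (comult C c)"
proof -
  interpret Y: coalg_pair "cop C" D by (rule coalg_pair_cop)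
  have "lact X \<Delta>Y U \<phi> F (tens C D c d) =
    lift C C U (\<lambda>a b. lift D D U (\<lambda>p q. scal U (\<phi> (tens C D a p)) (F (tens C D b q))) (comult D d)) (flip C C (comult C c))"
    unfolding lact_def
    using Y.convol_tens[OF assms(1) bilin_scal(1)[OF assms(1)], of \<phi> F c d] assms by simp
  also have "\<dots> = lift C C U (\<lambda>a b. lift D D U (\<lambda>p q. scal U (\<phi> (tens C D b p)) (F (tens C D a q))) (comult D d)) (comult C c)"
    by (rule lift_flip) (use assms in \<open>auto intro!: bilinI lin_lift_param lin_scal_left lin_scal_right
      lin_compose[OF assms(2)] lin_compose[OF assms(3)] tens_lins lin_mem[OF assms(3)] C.com_mem D.com_mem\<close>)
  finally show ?thesis .
qed

text \<open>
  Passing to the co-opposite coalgebra exchanges \<open>c\<^sub>1\<close> and \<open>c\<^sub>2\<close>, which is the difference between \<open>conv\<close> and \<open>star\<close>.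
\<close>

lemma star_eq:
  assumes "lin X ground \<phi>" "lin X ground \<psi>" "t \<in> pts X"
  shows "star C D \<phi> \<psi> t = lact X \<Delta>Y ground \<phi> \<psi> t"
proof -
  interpret Y: coalg_str X \<Delta>Y \<epsilon>X by (rule coalg_str_cop)
  have "lact X \<Delta>Y ground \<phi> \<psi> t = lift C D ground (\<lambda>c d. lact X \<Delta>Y ground \<phi> \<psi> (tens C D c d)) t"
    using assms by (intro eq_lift Y.lin_lact) auto
  also have "\<dots> = star C D \<phi> \<psi> t"
    unfolding star_def
    by (rule fun_cong[OF lift_cong]) (simp add: sw_def cop_lact_pure assms)
  finally show ?thesis ..
qed

text \<open>
  Inverses are unique in an associative algebra.  The example needs this, because \<open>eps\<close> is chosen among all
  inverses.
\<close>

lemma eps_unique: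
  assumes inv: "is_inverse C D (conv C D) (phi C D \<Psi>) \<psi>" and x: "x \<in> pts X"
  shows "eps C D \<Psi> x = \<psi> x"
proof -
  let ?e = "eps C D \<Psi>" and ?\<phi> = "phi C D \<Psi>"
  have e: "is_inverse C D (conv C D) ?\<phi> ?e" unfolding eps_def by (rule someI[where P = "is_inverse C D (conv C D) (phi C D \<Psi>)", OF inv])
  note l = e[unfolded is_inverse_def] inv[unfolded is_inverse_def]
  have le: "lin X ground ?e" and lp: "lin X ground ?\<phi>" and ls: "lin X ground \<psi>" using l by auto
  have 1: "(?e \<triangleright>\<^bsub>ground\<^esub> ?\<phi>) x = \<epsilon>X x" "(?\<phi> \<triangleright>\<^bsub>ground\<^esub> \<psi>) x = \<epsilon>X x" if "x \<in> pts X" for x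
    using l that conv_eq[OF le lp] conv_eq[OF lp ls] by auto
  have "?e x = (?e \<triangleleft>\<^bsub>ground\<^esub> \<epsilon>X) x"
    by (rule X.ract_counit[symmetric]) (auto intro: le x)
  also have "\<dots> = (?e \<triangleright>\<^bsub>ground\<^esub> (?\<phi> \<triangleright>\<^bsub>ground\<^esub> \<psi>)) x"
    unfolding X.ract_ground by (rule fun_cong[OF lact_cong]) (simp_all add: 1)
  also have "\<dots> = ((?e \<triangleright>\<^bsub>ground\<^esub> ?\<phi>) \<triangleright>\<^bsub>ground\<^esub> \<psi>) x"
    by (subst X.lact_lact) (auto intro: le lp ls)
  also have "\<dots> = (\<epsilon>X \<triangleright>\<^bsub>ground\<^esub> \<psi>) x"
    by (rule fun_cong[OF lact_cong]) (simp_all add: 1)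
  also have "\<dots> = \<psi> x"
    by (rule X.counit_lact) (auto intro: ls x)
  finally show ?thesis .
qed

lemma is_inverse_cong:
  assumes "is_inverse C D m \<phi> \<psi>" "m = conv C D \<or> m = star C D" "lin X ground \<phi>'" "\<And>x. x \<in> pts X \<Longrightarrow> \<phi>' x = \<phi> x"
  shows "is_inverse C D m \<phi>' \<psi>"
proof -
  note l = assms(1)[unfolded is_inverse_def]
  have lp: "lin X ground \<phi>" and ls: "lin X ground \<psi>" using l by auto
  have c: "lact X \<Delta> ground \<phi>' \<psi> = lact X \<Delta> ground \<phi> \<psi>" "lact X \<Delta> ground \<psi> \<phi>' = lact X \<Delta> ground \<psi> \<phi>" for \<Delta>
    by (rule lact_cong; simp add: assms(4))+
  have "m \<phi>' \<psi> t = m \<phi> \<psi> t" "m \<psi> \<phi>' t = m \<psi> \<phi> t" if "t \<in> pts X" for t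
    using assms(2) that by (auto simp: conv_eq[OF assms(3) ls] conv_eq[OF lp ls] conv_eq[OF ls assms(3)] conv_eq[OF ls lp]
        star_eq[OF assms(3) ls] star_eq[OF lp ls] star_eq[OF ls assms(3)] star_eq[OF ls lp] c)
  then show ?thesis using l assms(3) unfolding is_inverse_def by auto
qed

end

section \<open>The conormal twist and the two isomorphisms\<close>

locale twisted_pair = coalg_pair C D
  for C :: "('k::field, 'c::ab_group_add) coalg" and D :: "('k, 'd::ab_group_add) coalg" +
  fixes \<Psi>' :: "('d, 'c, 'k) tensor \<Rightarrow> ('d, 'c, 'k) tensor" and \<Psi> :: "('c, 'd, 'k) tensor \<Rightarrow> ('d, 'c, 'k) tensor"
  assumes Tw: "\<Psi>' \<in> Tw C D" and Psi: "\<Psi> = \<Psi>' \<circ> flip C D"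
    and conv_inv: "conv_invertible C D (phi C D \<Psi>)" and star_inv: "star_invertible C D (eps C D \<Psi>)"
begin

abbreviation "\<phi> \<equiv> phi C D \<Psi>"
abbreviation "e \<equiv> eps C D \<Psi>"
abbreviation "\<Delta>\<Psi> \<equiv> twisted_comult C D \<Psi>"

lemma is_inverse_eps: "is_inverse C D (conv C D) \<phi> e"
  using someI_ex[OF conv_inv[unfolded conv_invertible_def]] unfolding eps_def .

lemma lin_phi: "lin X ground \<phi>" and lin_e: "lin X ground e"
  using is_inverse_eps by (auto simp: is_inverse_def)

lemma phi_e: "x \<in> pts X \<Longrightarrow> (\<phi> \<triangleright>\<^bsub>ground\<^esub> e) x = \<epsilon>X x"
  and e_phi: "x \<in> pts X \<Longrightarrow> (e \<triangleright>\<^bsub>ground\<^esub> \<phi>) x = \<epsilon>X x"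
  using is_inverse_eps conv_eq[OF lin_phi lin_e] conv_eq[OF lin_e lin_phi] by (auto simp: is_inverse_def)

lemma lin_Psi: "lin X (D \<otimes> C) \<Psi>"
  by (rule Tw_lin_twist[OF Tw Psi])

lemma Delta_Psi: "x \<in> pts X \<Longrightarrow> \<Delta>\<Psi> x = (((\<lambda>x. x) \<triangleleft>\<^bsub>X\<^esub> \<phi>) \<odot>\<^bsub>X,X\<^esub> (\<lambda>x. x)) x"
  using twisted_comult_cong[OF lin_Psi lin_twist_of_form[OF lin_phi] Tw_eq_twist_of_form[OF Tw Psi]]
    twisted_comult_of_form[OF lin_phi] by simp

text \<open>
  By linearity, \<open>F\<close> after \<open>id \<triangleleft> \<phi>\<close> is \<open>F \<triangleleft> \<phi>\<close>.  In this form the twisted coproduct enters the computations below.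
\<close>

lemma tmap_Delta_Psi:
  assumes "is_vspace U" "is_vspace W" "lin X U F" "lin X W G" "x \<in> pts X"
  shows "tmap X X U W F G (\<Delta>\<Psi> x) = ((F \<triangleleft>\<^bsub>U\<^esub> \<phi>) \<odot>\<^bsub>U,W\<^esub> G) x"
proof -
  have "tmap X X U W F G (\<Delta>\<Psi> x) = ((\<lambda>x. F (((\<lambda>x. x) \<triangleleft>\<^bsub>X\<^esub> \<phi>) x)) \<odot>\<^bsub>U,W\<^esub> G) x"
    unfolding Delta_Psi[OF assms(5)]
    by (rule X.tmap_tprod) (use assms in \<open>auto intro!: Xlins lin_phi\<close>)
  also have "\<dots> = ((F \<triangleleft>\<^bsub>U\<^esub> \<phi>) \<odot>\<^bsub>U,W\<^esub> G) x"
    by (rule fun_cong[OF tprod_cong]) (use assms lin_phi X.ract_pre in auto)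
  finally show ?thesis .
qed

text \<open>
  In \<open>\<pi>C \<triangleleft> e\<close> the second factor is split into \<open>d\<^sub>1\<close> and \<open>d\<^sub>2\<close>, and the projection evaluates the counit at \<open>d\<^sub>1\<close>, which
  leaves \<open>e (c\<^sub>2 \<otimes> d) c\<^sub>1\<close>; similarly for \<open>e \<triangleright> \<pi>D\<close>.
\<close>

lemma p_C_eq: "x \<in> pts X \<Longrightarrow> p_C C D \<Psi> x = (\<pi>C \<triangleleft>\<^bsub>C\<^esub> e) x"
  and p_D_eq: "x \<in> pts X \<Longrightarrow> p_D C D \<Psi> x = (e \<triangleright>\<^bsub>D\<^esub> \<pi>D) x"
  and p_D_pure: "c \<in> pts C \<Longrightarrow> d \<in> pts D \<Longrightarrow> p_D C D \<Psi> (tens C D c d) = lift D D D (\<lambda>d1 d2. scal D (e (tens C D c d1)) d2) (comult D d)"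
  and p_C_pure: "c \<in> pts C \<Longrightarrow> d \<in> pts D \<Longrightarrow> p_C C D \<Psi> (tens C D c d) = lift C C C (\<lambda>c1 c2. scal C (e (tens C D c2 d)) c1) (comult C c)"
proof -
  note side = bilinI lin_lift_param lin_lift_comp lin_scal_left lin_scal_right lin_compose[OF lin_e] tens_lins
    C.com_mem D.com_mem C.com D.com C.lin_counit D.lin_counit vspace_scal vss
  have bC: "bilin C D C (\<lambda>c d. lift C C C (\<lambda>c1 c2. scal C (e (tens C D c2 d)) c1) (comult C c))"
    and bD: "bilin C D D (\<lambda>c d. lift D D D (\<lambda>d1 d2. scal D (e (tens C D c d1)) d2) (comult D d))"
    by (auto intro!: side)
  show pC: "p_C C D \<Psi> (tens C D c d) = lift C C C (\<lambda>c1 c2. scal C (e (tens C D c2 d)) c1) (comult C c)"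
    if "c \<in> pts C" "d \<in> pts D" for c d
    unfolding p_C_def sw_def by (intro lift_tens bC vss that)
  show pD: "p_D C D \<Psi> (tens C D c d) = lift D D D (\<lambda>d1 d2. scal D (e (tens C D c d1)) d2) (comult D d)"
    if "c \<in> pts C" "d \<in> pts D" for c d
    unfolding p_D_def sw_def by (intro lift_tens bD vss that)
  have lC: "lin X C (p_C C D \<Psi>)" unfolding p_C_def sw_def by (intro lin_lift bC vss)
  have lD: "lin X D (p_D C D \<Psi>)" unfolding p_D_def sw_def by (intro lin_lift bD vss)
  show "p_C C D \<Psi> x = (\<pi>C \<triangleleft>\<^bsub>C\<^esub> e) x" if x: "x \<in> pts X" for x
  proof (rule eq_on_tensI[OF vss(1) lC _ _ x])
    show "lin X C (\<pi>C \<triangleleft>\<^bsub>C\<^esub> e)" by (intro Xlins lin_e vss)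
    fix c d assume c: "c \<in> pts C" and d: "d \<in> pts D"
    have "(\<pi>C \<triangleleft>\<^bsub>C\<^esub> e) (tens C D c d) =
      lift C C C (\<lambda>a b. lift D D C (\<lambda>p q. scal C (e (tens C D b q)) (\<pi>C (tens C D a p))) (comult D d)) (comult C c)"
      unfolding ract_def by (rule convol_tens[OF vss(1) bilin_scal(2)[OF vss(1)] lin_piC lin_e c d])
    also have "\<dots> = lift C C C (\<lambda>a b. lift D D C (\<lambda>p q. scal C (counit D p) (scal C (e (tens C D b q)) a)) (comult D d)) (comult C c)"
      by (rule lift_eqI, rule lift_eqI) (simp add: piC_tens scal_simps(3)[OF vss(1)] mult.commute)
    also have "\<dots> = lift C C C (\<lambda>a b. scal C (e (tens C D b d)) a) (comult C c)"
      by (rule lift_eqI, rule D.counit_lift_left) (use d in \<open>auto intro!: side\<close>)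
    finally show "p_C C D \<Psi> (tens C D c d) = (\<pi>C \<triangleleft>\<^bsub>C\<^esub> e) (tens C D c d)" using pC[OF c d] by simp
  qed
  show "p_D C D \<Psi> x = (e \<triangleright>\<^bsub>D\<^esub> \<pi>D) x" if x: "x \<in> pts X" for x
  proof (rule eq_on_tensI[OF vss(2) lD _ _ x])
    show "lin X D (e \<triangleright>\<^bsub>D\<^esub> \<pi>D)" by (intro Xlins lin_e vss)
    fix c d assume c: "c \<in> pts C" and d: "d \<in> pts D"
    have "(e \<triangleright>\<^bsub>D\<^esub> \<pi>D) (tens C D c d) =
      lift C C D (\<lambda>a b. lift D D D (\<lambda>p q. scal D (e (tens C D a p)) (\<pi>D (tens C D b q))) (comult D d)) (comult C c)"
      unfolding lact_def by (rule convol_tens[OF vss(2) bilin_scal(1)[OF vss(2)] lin_e lin_piD c d])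
    also have "\<dots> = lift C C D (\<lambda>a b. lift D D D (\<lambda>p q. scal D (counit C b) (scal D (e (tens C D a p)) q)) (comult D d)) (comult C c)"
      by (rule lift_eqI, rule lift_eqI) (simp add: piD_tens scal_simps(3)[OF vss(2)] mult.commute)
    also have "\<dots> = lift C C D (\<lambda>a b. scal D (counit C b) (lift D D D (\<lambda>p q. scal D (e (tens C D a p)) q) (comult D d))) (comult C c)"
      by (rule lift_eqI, rule lift_post[symmetric, where h = "scal D _"]) (use d in \<open>auto intro!: side\<close>)
    also have "\<dots> = lift D D D (\<lambda>p q. scal D (e (tens C D c p)) q) (comult D d)"
      by (rule C.counit_lift_right) (use c d in \<open>auto intro!: side\<close>)
    finally show "p_D C D \<Psi> (tens C D c d) = (e \<triangleright>\<^bsub>D\<^esub> \<pi>D) (tens C D c d)" using pD[OF c d] by simp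
  qed
qed

text \<open>
  The maps \<open>p_C\<close>, \<open>p_D\<close> and \<open>mu\<close> in closed form.  They agree with the originals on the carrier (\<open>p_C_eq\<close>, \<open>p_D_eq\<close>,
  \<open>mu_eq\<close>).
\<close>

abbreviation "pC \<equiv> \<pi>C \<triangleleft>\<^bsub>C\<^esub> e"
abbreviation "pD \<equiv> e \<triangleright>\<^bsub>D\<^esub> \<pi>D"
abbreviation "\<mu> \<equiv> \<pi>C \<odot>\<^bsub>C,D\<^esub> pD"

lemmas lins = Xlins lin_e lin_phi vss is_vspace_tensor is_vspace_ground

lemma pC_phi: "pC \<triangleleft>\<^bsub>C\<^esub> \<phi> = \<pi>C \<triangleleft>\<^bsub>C\<^esub> \<epsilon>X"
  by (subst X.ract_ract) (auto intro!: lins ract_cong simp: e_phi)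

text \<open>
  The form \<open>\<phi>\<close> of the twisted coproduct cancels against the form \<open>e\<close> in \<open>p_C\<close>.
\<close>

lemma tmap_p_C_p_D: "x \<in> pts X \<Longrightarrow> tmap X X C D (p_C C D \<Psi>) (p_D C D \<Psi>) (\<Delta>\<Psi> x) = \<mu> x"
proof -
  assume x: "x \<in> pts X"
  have "tmap X X C D (p_C C D \<Psi>) (p_D C D \<Psi>) (\<Delta>\<Psi> x) = tmap X X C D pC pD (\<Delta>\<Psi> x)"
    by (rule fun_cong[OF tmap_cong]) (simp_all add: p_C_eq p_D_eq)
  also have "\<dots> = ((pC \<triangleleft>\<^bsub>C\<^esub> \<phi>) \<odot>\<^bsub>C,D\<^esub> pD) x"
    by (rule tmap_Delta_Psi) (intro lins x)+
  also have "\<dots> = \<mu> x"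
    unfolding pC_phi
    by (rule fun_cong[OF tprod_cong]) (auto intro!: X.ract_counit lins)
  finally show ?thesis .
qed

lemma mu_eq: "x \<in> pts X \<Longrightarrow> mu C D \<Psi> x = \<mu> x"
  by (simp add: mu_def tmap_p_C_p_D)

lemma lin_mu: "lin X X \<mu>" by (intro lins)

text \<open>
  At \<open>c \<otimes> d\<close> both sides are \<open>e (c\<^sub>2 \<otimes> d\<^sub>1) c\<^sub>1 \<otimes> d\<^sub>2\<close>.  In this form \<open>\<mu>\<close> is inverted by a \<open>\<star>\<close>-inverse of \<open>e\<close>.
\<close>

lemma mu_cop: "x \<in> pts X \<Longrightarrow> \<mu> x = lact X \<Delta>Y X e (\<lambda>x. x) x"
proof -
  interpret Y: coalg_str X \<Delta>Y \<epsilon>X by (rule coalg_str_cop)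
  note side = bilinI lin_lift_param lin_lift_comp lin_scal_left lin_scal_right lin_compose[OF lin_e] tens_lins
    C.com_mem D.com_mem C.com D.com C.lin_counit D.lin_counit vspace_scal vss lin_mem[OF X.lin_lact[OF vss(2) lin_e lin_piD]]
    lin_compose[OF X.lin_lact[OF vss(2) lin_e lin_piD]] is_vspace_tensor
  assume x: "x \<in> pts X"
  show ?thesis
  proof (rule eq_on_tensI[OF is_vspace_tensor lin_mu _ _ x])
    show "lin X X (lact X \<Delta>Y X e (\<lambda>x. x))" by (intro Y.lin_lact lins)
    fix c d assume c: "c \<in> pts C" and d: "d \<in> pts D"
    have "\<mu> (tens C D c d) =
      lift C C X (\<lambda>a b. lift D D X (\<lambda>p q. tens C D (\<pi>C (tens C D a p)) (pD (tens C D b q))) (comult D d)) (comult C c)"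
      unfolding tprod_def by (rule convol_tens[OF is_vspace_tensor bilin_tens[OF vss] _ _ c d]) (intro lins)+
    also have "\<dots> = lift C C X (\<lambda>a b. lift D D X (\<lambda>p q. scal X (counit D p) (tens C D a (pD (tens C D b q)))) (comult D d)) (comult C c)"
      by (rule lift_eqI, rule lift_eqI) (simp add: piC_tens lin_scal[OF bilin_left[OF bilin_tens[OF vss]]] side)
    also have "\<dots> = lift C C X (\<lambda>a b. tens C D a (pD (tens C D b d))) (comult C c)"
      by (rule lift_eqI, rule D.counit_lift_left) (use d in \<open>auto intro!: side\<close>)
    also have "\<dots> = lift C C X (\<lambda>a b. tens C D a (lift D D D (\<lambda>p q. scal D (e (tens C D b p)) q) (comult D d))) (comult C c)"
      by (rule lift_eqI) (use d in \<open>simp add: p_D_eq[symmetric] p_D_pure tens_mem\<close>)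
    also have "\<dots> = lift C C X (\<lambda>a b. lift D D X (\<lambda>p q. tens C D a (scal D (e (tens C D b p)) q)) (comult D d)) (comult C c)"
      by (rule lift_eqI, rule lift_post[where h = "tens C D _"]) (use d in \<open>auto intro!: side\<close>)
    also have "\<dots> = lift C C X (\<lambda>a b. lift D D X (\<lambda>p q. scal X (e (tens C D b p)) (tens C D a q)) (comult D d)) (comult C c)"
      by (rule lift_eqI, rule lift_eqI) (simp add: lin_scal[OF bilin_right[OF bilin_tens[OF vss]]])
    also have "\<dots> = lact X \<Delta>Y X e (\<lambda>x. x) (tens C D c d)"
      by (rule cop_lact_pure[symmetric]) (intro lins c d)+
    finally show "\<mu> (tens C D c d) = lact X \<Delta>Y X e (\<lambda>x. x) (tens C D c d)" .
  qed
qed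

lemma bij_mu: "bij_betw \<mu> (pts X) (pts X)"
proof -
  interpret Y: coalg_str X \<Delta>Y \<epsilon>X by (rule coalg_str_cop)
  obtain f where f: "is_inverse C D (star C D) e f"
    using star_inv by (auto simp: star_invertible_def)
  then have lf: "lin X ground f" by (simp add: is_inverse_def)
  have "bij_betw (lact X \<Delta>Y X e (\<lambda>x. x)) (pts X) (pts X)"
    by (rule Y.bij_lact[OF lin_e lf])
      (use f star_eq[OF lf lin_e] star_eq[OF lin_e lf] in \<open>auto simp: is_inverse_def\<close>)
  then show ?thesis
    by (subst bij_betw_cong[of _ _ "lact X \<Delta>Y X e (\<lambda>x. x)"]) (auto simp: mu_cop)
qed

abbreviation "\<alpha> \<equiv> e \<triangleright>\<^bsub>X\<^esub> (\<lambda>x. x)"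

lemma lin_alpha: "lin X X \<alpha>" by (intro lins)

lemma bij_alpha: "bij_betw \<alpha> (pts X) (pts X)"
  by (rule X.bij_lact[OF lin_e lin_phi]) (simp_all add: phi_e e_phi)

lemma counit_alpha: "x \<in> pts X \<Longrightarrow> \<epsilon>X (\<alpha> x) = e x"
proof -
  assume x: "x \<in> pts X"
  have "\<epsilon>X (\<alpha> x) = (e \<triangleright>\<^bsub>ground\<^esub> \<epsilon>X) x" by (rule X.lact_pre) (intro lins x)+
  also have "\<dots> = e x" unfolding X.ract_ground[symmetric] by (rule X.ract_counit) (intro lins x)+
  finally show ?thesis .
qed

text \<open>
  Both sides are \<open>e \<triangleright> (id \<odot> id)\<close>: on the right-hand side, \<open>((e \<triangleright> id) \<triangleleft> \<phi>) \<odot> (e \<triangleright> id)\<close>, the forms \<open>\<phi>\<close> and \<open>e\<close> in the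
  middle cancel.
\<close>

lemma comult_alpha: "x \<in> pts X \<Longrightarrow> \<Delta>X (\<alpha> x) = tmap X X X X \<alpha> \<alpha> (\<Delta>\<Psi> x)"
proof -
  assume x: "x \<in> pts X"
  let ?id = "\<lambda>x::('c,'d,'k) tensor. x"
  note XV = is_vspace_tensor[of C D]
  have 1: "(\<alpha> \<triangleleft>\<^bsub>X\<^esub> \<phi>) \<odot>\<^bsub>X,X\<^esub> \<alpha> = e \<triangleright>\<^bsub>XX\<^esub> ((?id \<triangleleft>\<^bsub>X\<^esub> \<phi>) \<odot>\<^bsub>X,X\<^esub> \<alpha>)"
    unfolding X.lact_ract[OF XV lin_e lin_ident lin_phi]
    by (rule X.lact_tprod[OF XV XV lin_e X.lin_ract[OF XV lin_ident lin_phi] lin_alpha])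
  have 2: "(?id \<triangleleft>\<^bsub>X\<^esub> \<phi>) \<odot>\<^bsub>X,X\<^esub> \<alpha> = ?id \<odot>\<^bsub>X,X\<^esub> ((\<phi> \<triangleright>\<^bsub>ground\<^esub> e) \<triangleright>\<^bsub>X\<^esub> ?id)"
    unfolding X.tprod_middle[OF XV XV lin_ident lin_phi lin_alpha] X.lact_lact[OF XV lin_phi lin_e lin_ident] ..
  have 3: "(\<phi> \<triangleright>\<^bsub>ground\<^esub> e) \<triangleright>\<^bsub>X\<^esub> ?id = \<epsilon>X \<triangleright>\<^bsub>X\<^esub> ?id"
    by (rule lact_cong) (simp_all add: phi_e)
  have 4: "?id \<odot>\<^bsub>X,X\<^esub> (\<epsilon>X \<triangleright>\<^bsub>X\<^esub> ?id) = ?id \<odot>\<^bsub>X,X\<^esub> ?id"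
    by (rule tprod_cong) (auto intro!: X.counit_lact lins)
  have "tmap X X X X \<alpha> \<alpha> (\<Delta>\<Psi> x) = ((\<alpha> \<triangleleft>\<^bsub>X\<^esub> \<phi>) \<odot>\<^bsub>X,X\<^esub> \<alpha>) x"
    by (rule tmap_Delta_Psi) (intro lins x)+
  also have "\<dots> = (e \<triangleright>\<^bsub>XX\<^esub> (?id \<odot>\<^bsub>X,X\<^esub> ?id)) x"
    unfolding 1 2 3 4 ..
  also have "\<dots> = (e \<triangleright>\<^bsub>XX\<^esub> \<Delta>X) x"
    by (rule fun_cong[OF lact_cong]) (simp_all add: X.comult_eq_tprod)
  also have "\<dots> = \<Delta>X (\<alpha> x)"
    by (rule X.lact_pre[symmetric]) (intro lins lin_comult x)+
  finally show ?thesis ..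
qed

abbreviation "\<Psi>t \<equiv> tilde_twist C D \<Psi>"

text \<open>
  As \<open>\<mu>\<close> is bijective, the new twist is known from its composition with \<open>\<mu>\<close>.
\<close>

lemma tilde_mu: "x \<in> pts X \<Longrightarrow> \<Psi>t (\<mu> x) = ((pD \<triangleleft>\<^bsub>D\<^esub> \<phi>) \<odot>\<^bsub>D,C\<^esub> pC) x"
proof -
  assume x: "x \<in> pts X"
  have inj: "inj_on (mu C D \<Psi>) (pts X)"
    using bij_mu by (auto simp: bij_betw_def inj_on_def mu_eq)
  have "\<Psi>t (\<mu> x) = tmap X X D C (p_D C D \<Psi>) (p_C C D \<Psi>) (\<Delta>\<Psi> x)"
    using the_inv_into_f_f[OF inj x] by (simp add: tilde_twist_def mu_eq[OF x])
  also have "\<dots> = tmap X X D C pD pC (\<Delta>\<Psi> x)"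
    by (rule fun_cong[OF tmap_cong]) (simp_all add: p_C_eq p_D_eq)
  also have "\<dots> = ((pD \<triangleleft>\<^bsub>D\<^esub> \<phi>) \<odot>\<^bsub>D,C\<^esub> pC) x"
    by (rule tmap_Delta_Psi) (intro lins x)+
  finally show ?thesis .
qed

lemma mu_surj: "t \<in> pts X \<Longrightarrow> \<exists>x\<in>pts X. t = \<mu> x"
  using bij_mu by (auto simp: bij_betw_def)

lemma lin_tilde: "lin X (D \<otimes> C) \<Psi>t"
proof -
  let ?g = "the_inv_into (pts X) \<mu>"
  let ?M = "(pD \<triangleleft>\<^bsub>D\<^esub> \<phi>) \<odot>\<^bsub>D,C\<^esub> pC"
  have g: "lin X X ?g" by (rule lin_inv_into[OF is_vspace_tensor lin_mu bij_mu])
  have M: "lin X (D \<otimes> C) ?M" by (intro lins)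
  have "\<Psi>t t = ?M (?g t)" if t: "t \<in> pts X" for t
  proof -
    obtain x where x: "x \<in> pts X" "t = \<mu> x" using mu_surj[OF t] by blast
    have "?g t = x" unfolding x(2) using bij_mu x(1) by (intro the_inv_into_f_f) (auto simp: bij_betw_def)
    then show ?thesis using tilde_mu[OF x(1)] x(2) by simp
  qed
  then show ?thesis
    by (subst lin_cong[OF is_vspace_tensor]) (assumption, rule lin_compose[OF M g])
qed

lemma counit_pC: "x \<in> pts X \<Longrightarrow> counit C (pC x) = e x"
proof -
  assume x: "x \<in> pts X"
  have "counit C (pC x) = ((\<lambda>x. counit C (\<pi>C x)) \<triangleleft>\<^bsub>ground\<^esub> e) x"
    by (rule X.ract_post) (intro lins C.lin_counit x)+
  also have "\<dots> = (\<epsilon>X \<triangleright>\<^bsub>ground\<^esub> e) x"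
    unfolding X.ract_ground by (rule fun_cong[OF lact_cong]) (simp_all add: counit_piC)
  also have "\<dots> = e x" by (rule X.counit_lact) (intro lins x)+
  finally show ?thesis .
qed

lemma counit_pD: "x \<in> pts X \<Longrightarrow> counit D (pD x) = e x"
proof -
  assume x: "x \<in> pts X"
  have "counit D (pD x) = (e \<triangleright>\<^bsub>ground\<^esub> (\<lambda>x. counit D (\<pi>D x))) x"
    by (rule X.lact_post) (intro lins D.lin_counit x)+
  also have "\<dots> = (e \<triangleleft>\<^bsub>ground\<^esub> \<epsilon>X) x"
    unfolding X.ract_ground by (rule fun_cong[OF lact_cong]) (simp_all add: counit_piD)
  also have "\<dots> = e x" by (rule X.ract_counit) (intro lins x)+
  finally show ?thesis .
qed

lemma counit_pD_phi: "x \<in> pts X \<Longrightarrow> counit D ((pD \<triangleleft>\<^bsub>D\<^esub> \<phi>) x) = \<epsilon>X x"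
proof -
  assume x: "x \<in> pts X"
  have "counit D ((pD \<triangleleft>\<^bsub>D\<^esub> \<phi>) x) = ((\<lambda>x. counit D (pD x)) \<triangleleft>\<^bsub>ground\<^esub> \<phi>) x"
    by (rule X.ract_post) (intro lins D.lin_counit x)+
  also have "\<dots> = (e \<triangleright>\<^bsub>ground\<^esub> \<phi>) x"
    unfolding X.ract_ground by (rule fun_cong[OF lact_cong]) (simp_all add: counit_pD)
  finally show ?thesis by (simp add: e_phi x)
qed

text \<open>
  At \<open>t = \<mu> x\<close> the two equations of conormality become \<open>(\<epsilon> \<circ> (p_D \<triangleleft> \<phi>)) \<triangleright> p_C = \<pi>C \<triangleleft> (\<epsilon> \<circ> p_D)\<close> and
  \<open>(p_D \<triangleleft> \<phi>) \<triangleleft> (\<epsilon> \<circ> p_C) = (\<epsilon> \<circ> \<pi>C) \<triangleright> p_D\<close>, where \<open>\<epsilon>\<close> is the counit of \<open>C\<close> or \<open>D\<close>.  Since \<open>\<epsilon> \<circ> p_C\<close> and \<open>\<epsilon> \<circ> p_D\<close> are both \<open>e\<close>, and \<open>e\<close>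
  is inverse to \<open>\<phi>\<close>, the first equation says \<open>p_C = p_C\<close> and the second \<open>p_D = p_D\<close>.
\<close>

lemma conormal_tilde: "conormal C D \<Psi>t"
  unfolding conormal_def \<pi>C_def[symmetric] \<pi>D_def[symmetric]
proof (intro ballI conjI)
  fix t assume "t \<in> pts X"
  then obtain x where x: "x \<in> pts X" and t: "t = \<mu> x" using mu_surj by blast
  have "lift D C C (\<lambda>d c. scal C (counit D d) c) (\<Psi>t t) = ((\<lambda>x. counit D ((pD \<triangleleft>\<^bsub>D\<^esub> \<phi>) x)) \<triangleright>\<^bsub>C\<^esub> pC) x"
    unfolding t tilde_mu[OF x] by (rule X.tprod_eval_left) (intro lins D.lin_counit x)+
  also have "\<dots> = (\<epsilon>X \<triangleright>\<^bsub>C\<^esub> pC) x"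
    by (rule fun_cong[OF lact_cong]) (simp_all add: counit_pD_phi)
  also have "\<dots> = pC x"
    by (rule X.counit_lact) (intro lins x)+
  also have "\<dots> = (\<pi>C \<triangleleft>\<^bsub>C\<^esub> (\<lambda>x. counit D (pD x))) x"
    by (rule fun_cong[OF ract_cong]) (simp_all add: counit_pD)
  also have "\<dots> = \<pi>C t"
    unfolding t \<pi>C_def[of] by (rule X.tprod_eval_right[symmetric]) (intro lins D.lin_counit x lin_piC[unfolded \<pi>C_def])+
  finally show "lift D C C (\<lambda>d c. scal C (counit D d) c) (\<Psi>t t) = \<pi>C t" .
  have "lift D C D (\<lambda>d c. scal D (counit C c) d) (\<Psi>t t) = ((pD \<triangleleft>\<^bsub>D\<^esub> \<phi>) \<triangleleft>\<^bsub>D\<^esub> (\<lambda>x. counit C (pC x))) x"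
    unfolding t tilde_mu[OF x] by (rule X.tprod_eval_right) (intro lins C.lin_counit x)+
  also have "\<dots> = ((pD \<triangleleft>\<^bsub>D\<^esub> \<phi>) \<triangleleft>\<^bsub>D\<^esub> e) x"
    by (rule fun_cong[OF ract_cong]) (simp_all add: counit_pC)
  also have "\<dots> = (pD \<triangleleft>\<^bsub>D\<^esub> (\<phi> \<triangleright>\<^bsub>ground\<^esub> e)) x"
    by (subst X.ract_ract) (intro lins refl)+
  also have "\<dots> = (pD \<triangleleft>\<^bsub>D\<^esub> \<epsilon>X) x"
    by (rule fun_cong[OF ract_cong]) (simp_all add: phi_e)
  also have "\<dots> = pD x"
    by (rule X.ract_counit) (intro lins x)+
  also have "\<dots> = (\<epsilon>X \<triangleright>\<^bsub>D\<^esub> pD) x"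
    by (rule X.counit_lact[symmetric]) (intro lins x)+
  also have "\<dots> = ((\<lambda>x. counit C (\<pi>C x)) \<triangleright>\<^bsub>D\<^esub> pD) x"
    by (rule fun_cong[OF lact_cong]) (simp_all add: counit_piC)
  also have "\<dots> = lift C D D (\<lambda>c d. scal D (counit C c) d) (\<mu> x)"
    by (rule X.tprod_eval_left[symmetric]) (intro lins C.lin_counit x)+
  finally show "lift D C D (\<lambda>d c. scal D (counit C c) d) (\<Psi>t t) = \<pi>D t" unfolding \<pi>D_def t .
qed

text \<open>
  Because \<open>\<pi>C\<close> and \<open>\<pi>D\<close> are coalgebra maps, \<open>(\<Delta>\<^sub>C \<otimes> \<Delta>\<^sub>D) \<mu>\<close> is \<open>(\<pi>C \<odot> \<pi>C) \<odot> (p_D \<odot> \<pi>D)\<close>, up to bracketing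
  \<open>\<pi>C \<odot> \<mu> \<odot> \<pi>D\<close>.  The new twist acts on the middle factor, where \<open>\<Psi>t \<mu>\<close> is known; what results,
  \<open>\<pi>C \<odot> (p_D \<triangleleft> \<phi>) \<odot> p_C \<odot> \<pi>D\<close>, is \<open>(\<mu> \<triangleleft> \<phi>) \<odot> \<mu>\<close> after the last rebracketing.
\<close>

lemma comult_mu: "x \<in> pts X \<Longrightarrow> twisted_comult C D \<Psi>t (\<mu> x) = tmap X X X X \<mu> \<mu> (\<Delta>\<Psi> x)"
proof -
  assume x: "x \<in> pts X"
  let ?CC = "C \<otimes> C" and ?DD = "D \<otimes> D" and ?DC = "D \<otimes> C"
  let ?pDp = "pD \<triangleleft>\<^bsub>D\<^esub> \<phi>"
  have 1: "comult D (pD x) = (pD \<odot>\<^bsub>D,D\<^esub> \<pi>D) x" if "x \<in> pts X" for x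
  proof -
    have "comult D (pD x) = (e \<triangleright>\<^bsub>?DD\<^esub> (\<lambda>x. comult D (\<pi>D x))) x"
      by (rule X.lact_post) (intro lins D.com that)+
    also have "\<dots> = (e \<triangleright>\<^bsub>?DD\<^esub> (\<pi>D \<odot>\<^bsub>D,D\<^esub> \<pi>D)) x"
      by (rule fun_cong[OF lact_cong]) (simp_all add: comult_piD)
    also have "\<dots> = (pD \<odot>\<^bsub>D,D\<^esub> \<pi>D) x"
      by (subst X.lact_tprod) (intro lins refl)+
    finally show ?thesis .
  qed
  have "tmap C D ?CC ?DD (comult C) (comult D) (\<mu> x) = ((\<lambda>x. comult C (\<pi>C x)) \<odot>\<^bsub>?CC,?DD\<^esub> (\<lambda>x. comult D (pD x))) x"
    by (rule X.tmap_tprod) (intro lins C.com D.com x)+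
  also have "\<dots> = ((\<pi>C \<odot>\<^bsub>C,C\<^esub> \<pi>C) \<odot>\<^bsub>?CC,?DD\<^esub> (pD \<odot>\<^bsub>D,D\<^esub> \<pi>D)) x"
    by (rule fun_cong[OF tprod_cong]) (simp_all add: comult_piC 1)
  finally have "twisted_comult C D \<Psi>t (\<mu> x) = mid C D \<Psi>t (((\<pi>C \<odot>\<^bsub>C,C\<^esub> \<pi>C) \<odot>\<^bsub>?CC,?DD\<^esub> (pD \<odot>\<^bsub>D,D\<^esub> \<pi>D)) x)"
    by (simp add: twisted_comult_def)
  also have "\<dots> = assoc_inv C D X (tmap C (?DC \<otimes> D) C (D \<otimes> X) id (assoc D C D) (tmap C (X \<otimes> D) C (?DC \<otimes> D) id (tmap X D ?DC D \<Psi>t id)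
    (tmap C (C \<otimes> ?DD) C (X \<otimes> D) id (assoc_inv C D D) (assoc C C ?DD (((\<pi>C \<odot>\<^bsub>C,C\<^esub> \<pi>C) \<odot>\<^bsub>?CC,?DD\<^esub> (pD \<odot>\<^bsub>D,D\<^esub> \<pi>D)) x)))))"
    by (simp add: mid_def)
  also have "\<dots> = ((\<mu> \<triangleleft>\<^bsub>X\<^esub> \<phi>) \<odot>\<^bsub>X,X\<^esub> \<mu>) x"
  proof -
    \<comment> \<open>The five maps that compose \<open>mid\<close>, from the innermost to the outermost.\<close>
    have s1: "assoc C C ?DD (((\<pi>C \<odot>\<^bsub>C,C\<^esub> \<pi>C) \<odot>\<^bsub>?CC,?DD\<^esub> (pD \<odot>\<^bsub>D,D\<^esub> \<pi>D)) x) = (\<pi>C \<odot>\<^bsub>C,C \<otimes> ?DD\<^esub> (\<pi>C \<odot>\<^bsub>C,?DD\<^esub> (pD \<odot>\<^bsub>D,D\<^esub> \<pi>D))) x"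
      by (rule X.assoc_tprod) (intro lins x)+
    have "tmap C (C \<otimes> ?DD) C (X \<otimes> D) id (assoc_inv C D D) ((\<pi>C \<odot>\<^bsub>C,C \<otimes> ?DD\<^esub> (\<pi>C \<odot>\<^bsub>C,?DD\<^esub> (pD \<odot>\<^bsub>D,D\<^esub> \<pi>D))) x)
      = ((\<lambda>x. id (\<pi>C x)) \<odot>\<^bsub>C,X \<otimes> D\<^esub> (\<lambda>x. assoc_inv C D D ((\<pi>C \<odot>\<^bsub>C,?DD\<^esub> (pD \<odot>\<^bsub>D,D\<^esub> \<pi>D)) x))) x"
      by (rule X.tmap_tprod) (intro lins lin_assoc_inv lin_id x)+
    also have "\<dots> = (\<pi>C \<odot>\<^bsub>C,X \<otimes> D\<^esub> (\<mu> \<odot>\<^bsub>X,D\<^esub> \<pi>D)) x"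
      by (rule fun_cong[OF tprod_cong]) (simp, rule X.assoc_inv_tprod, (intro lins | assumption)+)
    finally have s2: "tmap C (C \<otimes> ?DD) C (X \<otimes> D) id (assoc_inv C D D) ((\<pi>C \<odot>\<^bsub>C,C \<otimes> ?DD\<^esub> (\<pi>C \<odot>\<^bsub>C,?DD\<^esub> (pD \<odot>\<^bsub>D,D\<^esub> \<pi>D))) x)
      = (\<pi>C \<odot>\<^bsub>C,X \<otimes> D\<^esub> (\<mu> \<odot>\<^bsub>X,D\<^esub> \<pi>D)) x" .
    have t: "(\<lambda>x. \<Psi>t (\<mu> x)) \<odot>\<^bsub>?DC,D\<^esub> (\<lambda>x. id (\<pi>D x)) = (?pDp \<odot>\<^bsub>D,C\<^esub> pC) \<odot>\<^bsub>?DC,D\<^esub> \<pi>D"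
      by (rule tprod_cong) (simp_all add: tilde_mu)
    have "tmap C (X \<otimes> D) C (?DC \<otimes> D) id (tmap X D ?DC D \<Psi>t id) ((\<pi>C \<odot>\<^bsub>C,X \<otimes> D\<^esub> (\<mu> \<odot>\<^bsub>X,D\<^esub> \<pi>D)) x)
      = ((\<lambda>x. id (\<pi>C x)) \<odot>\<^bsub>C,?DC \<otimes> D\<^esub> (\<lambda>x. tmap X D ?DC D \<Psi>t id ((\<mu> \<odot>\<^bsub>X,D\<^esub> \<pi>D) x))) x"
      by (rule X.tmap_tprod) (intro lins lin_tmap lin_tilde lin_id x)+
    also have "\<dots> = (\<pi>C \<odot>\<^bsub>C,?DC \<otimes> D\<^esub> ((\<lambda>x. \<Psi>t (\<mu> x)) \<odot>\<^bsub>?DC,D\<^esub> (\<lambda>x. id (\<pi>D x)))) x"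
      by (rule fun_cong[OF tprod_cong]) (simp, rule X.tmap_tprod, (intro lins lin_tilde lin_id | assumption)+)
    also have "\<dots> = (\<pi>C \<odot>\<^bsub>C,?DC \<otimes> D\<^esub> ((?pDp \<odot>\<^bsub>D,C\<^esub> pC) \<odot>\<^bsub>?DC,D\<^esub> \<pi>D)) x"
      unfolding t ..
    finally have s3: "tmap C (X \<otimes> D) C (?DC \<otimes> D) id (tmap X D ?DC D \<Psi>t id) ((\<pi>C \<odot>\<^bsub>C,X \<otimes> D\<^esub> (\<mu> \<odot>\<^bsub>X,D\<^esub> \<pi>D)) x)
      = (\<pi>C \<odot>\<^bsub>C,?DC \<otimes> D\<^esub> ((?pDp \<odot>\<^bsub>D,C\<^esub> pC) \<odot>\<^bsub>?DC,D\<^esub> \<pi>D)) x" .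
    have "tmap C (?DC \<otimes> D) C (D \<otimes> X) id (assoc D C D) ((\<pi>C \<odot>\<^bsub>C,?DC \<otimes> D\<^esub> ((?pDp \<odot>\<^bsub>D,C\<^esub> pC) \<odot>\<^bsub>?DC,D\<^esub> \<pi>D)) x) =
      ((\<lambda>x. id (\<pi>C x)) \<odot>\<^bsub>C,D \<otimes> X\<^esub> (\<lambda>x. assoc D C D (((?pDp \<odot>\<^bsub>D,C\<^esub> pC) \<odot>\<^bsub>?DC,D\<^esub> \<pi>D) x))) x"
      by (rule X.tmap_tprod) (intro lins lin_assoc lin_id x)+
    also have "\<dots> = (\<pi>C \<odot>\<^bsub>C,D \<otimes> X\<^esub> (?pDp \<odot>\<^bsub>D,X\<^esub> (pC \<odot>\<^bsub>C,D\<^esub> \<pi>D))) x"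
      by (rule fun_cong[OF tprod_cong]) (simp, rule X.assoc_tprod, (intro lins | assumption)+)
    finally have s4: "tmap C (?DC \<otimes> D) C (D \<otimes> X) id (assoc D C D) ((\<pi>C \<odot>\<^bsub>C,?DC \<otimes> D\<^esub> ((?pDp \<odot>\<^bsub>D,C\<^esub> pC) \<odot>\<^bsub>?DC,D\<^esub> \<pi>D)) x) =
      (\<pi>C \<odot>\<^bsub>C,D \<otimes> X\<^esub> (?pDp \<odot>\<^bsub>D,X\<^esub> (pC \<odot>\<^bsub>C,D\<^esub> \<pi>D))) x" .
    have s5: "assoc_inv C D X ((\<pi>C \<odot>\<^bsub>C,D \<otimes> X\<^esub> (?pDp \<odot>\<^bsub>D,X\<^esub> (pC \<odot>\<^bsub>C,D\<^esub> \<pi>D))) x) = ((\<pi>C \<odot>\<^bsub>C,D\<^esub> ?pDp) \<odot>\<^bsub>X,X\<^esub> (pC \<odot>\<^bsub>C,D\<^esub> \<pi>D)) x"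
      by (rule X.assoc_inv_tprod) (intro lins x)+
    have s6: "\<pi>C \<odot>\<^bsub>C,D\<^esub> ?pDp = \<mu> \<triangleleft>\<^bsub>X\<^esub> \<phi>"
      by (rule X.tprod_ract[symmetric]) (intro lins)+
    have s7: "pC \<odot>\<^bsub>C,D\<^esub> \<pi>D = \<mu>"
      by (rule X.tprod_middle) (intro lins)+
    show ?thesis unfolding s1 s2 s3 s4 s5 unfolding s6 s7 ..
  qed
  also have "\<dots> = tmap X X X X \<mu> \<mu> (\<Delta>\<Psi> x)"
    by (rule tmap_Delta_Psi[symmetric]) (intro lins x)+
  finally show ?thesis .
qed

lemma lin_Delta_Psi: "lin X XX \<Delta>\<Psi>"
  by (rule lin_twisted_comult[OF lin_Psi])

lemma coalg_str_Psi: "coalg_str X \<Delta>\<Psi> e"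
proof -
  let ?g = "the_inv_into (pts X) \<alpha>"
  have inj: "inj_on \<alpha> (pts X)" and im: "\<alpha> ` pts X = pts X" using bij_alpha by (auto simp: bij_betw_def)
  have g: "lin X X ?g" by (rule lin_inv_into[OF is_vspace_tensor lin_alpha bij_alpha])
  have ag: "\<alpha> (?g y) = y" and gm: "?g y \<in> pts X" if "y \<in> pts X" for y
    using that im by (auto intro: the_inv_into_into[OF inj] f_the_inv_into_f[OF inj])
  have ga: "?g (\<alpha> x) = x" if "x \<in> pts X" for x using that by (rule the_inv_into_f_f[OF inj])
  have "coalg_str X \<Delta>\<Psi> (\<lambda>x. \<epsilon>X (\<alpha> x))"
  proof (rule X.transport[OF is_vspace_tensor[of C D] g lin_alpha lin_Delta_Psi])
    fix x assume x: "x \<in> pts X"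
    show "?g (\<alpha> x) = x" "\<alpha> (?g x) = x" by (rule ga[OF x] ag[OF x])+
    have "tmap X X X X ?g ?g (\<Delta>X x) = tmap X X X X ?g ?g (tmap X X X X \<alpha> \<alpha> (\<Delta>\<Psi> (?g x)))"
      using comult_alpha[OF gm[OF x]] ag[OF x] by simp
    also have "\<dots> = \<Delta>\<Psi> (?g x)"
      by (rule tmap_inverse) (auto intro!: lin_alpha g ga lin_mem[OF lin_Delta_Psi] gm x)
    finally show "\<Delta>\<Psi> (?g x) = tmap X X X X ?g ?g (\<Delta>X x)" ..
  qed
  then interpret P: coalg_str X \<Delta>\<Psi> "\<lambda>x. \<epsilon>X (\<alpha> x)" .
  show ?thesis
  proof
    show "is_counit X \<Delta>\<Psi> e"
    proof -
      have "lift X X X (\<lambda>y z. scal X (e y) z) = lift X X X (\<lambda>y z. scal X (\<epsilon>X (\<alpha> y)) z)"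
        "lift X X X (\<lambda>y z. scal X (e z) y) = lift X X X (\<lambda>y z. scal X (\<epsilon>X (\<alpha> z)) y)"
        by (rule lift_cong; simp add: counit_alpha)+
      then show ?thesis using P.cou lin_e by (simp add: is_counit_def)
    qed
  qed (fact P.vs P.com P.coass)+
qed

lemma coalg_str_tilde: "coalg_str X (twisted_comult C D \<Psi>t) (\<lambda>y. e (the_inv_into (pts X) \<mu> y))"
proof -
  let ?g = "the_inv_into (pts X) \<mu>"
  interpret P: coalg_str X \<Delta>\<Psi> e by (rule coalg_str_Psi)
  have inj: "inj_on \<mu> (pts X)" and im: "\<mu> ` pts X = pts X" using bij_mu by (auto simp: bij_betw_def)
  have g: "lin X X ?g" by (rule lin_inv_into[OF is_vspace_tensor lin_mu bij_mu])
  show ?thesis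
    by (rule P.transport[OF is_vspace_tensor[of C D] lin_mu g lin_twisted_comult[OF lin_tilde]])
      (use im in \<open>auto intro: the_inv_into_f_f[OF inj] f_the_inv_into_f[OF inj] comult_mu\<close>)
qed

lemma space_twisted: "pts (twisted_tensor C D \<Theta>) = pts X" "scal (twisted_tensor C D \<Theta>) = scal X"
  "comult (twisted_tensor C D \<Theta>) = twisted_comult C D \<Theta>"
  by (simp_all add: twisted_tensor_def)

lemma space_tensor: "pts (tensor_coalgebra C D) = pts X" "scal (tensor_coalgebra C D) = scal X" "counit (tensor_coalgebra C D) = \<epsilon>X"
  by (simp_all add: tensor_coalgebra_def)

lemma iso_mu: "coalgebra_iso (twisted_tensor C D \<Psi>) (twisted_tensor C D \<Psi>t) \<mu>"
proof -
  note S = same_space[OF space_twisted(1,2)] same_space_tensor[OF space_twisted(1,2)] same_space_lift[OF space_twisted(1,2)] space_twisted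
  have gm: "the_inv_into (pts X) \<mu> (\<mu> x) = x" if "x \<in> pts X" for x
    using bij_mu that by (intro the_inv_into_f_f) (auto simp: bij_betw_def)
  have t: "tmap (twisted_tensor C D \<Psi>) (twisted_tensor C D \<Psi>) (twisted_tensor C D \<Psi>t) (twisted_tensor C D \<Psi>t) = tmap X X X X"
    by (intro ext) (simp only: tmap_def S)
  show ?thesis
    unfolding coalgebra_iso_def t S
    using counit_twisted_tensor[OF coalg_str_Psi] counit_twisted_tensor[OF coalg_str_tilde] lin_mem[OF lin_mu]
    by (auto simp: lin_mu bij_mu comult_mu gm)
qed

lemma iso_alpha: "coalgebra_iso (twisted_tensor C D \<Psi>) (tensor_coalgebra C D) \<alpha>"
proof -
  note S = same_space[OF space_twisted(1,2)] same_space_tensor[OF space_twisted(1,2)] same_space_lift[OF space_twisted(1,2)] space_twisted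
  note S' = same_space[OF space_tensor(1,2)] same_space_tensor[OF space_tensor(1,2)] same_space_lift[OF space_tensor(1,2)] space_tensor
  have t: "tmap (twisted_tensor C D \<Psi>) (twisted_tensor C D \<Psi>) (tensor_coalgebra C D) (tensor_coalgebra C D) = tmap X X X X"
    by (intro ext) (simp only: tmap_def S S')
  show ?thesis
    unfolding coalgebra_iso_def t S S'
    using counit_twisted_tensor[OF coalg_str_Psi] X.coalg_str_axioms coalgebra_tensor_coalgebra[of C D]
    by (auto simp: lin_alpha bij_alpha comult_alpha counit_alpha)
qed

end

section \<open>A conormal twist different from the flip\<close>

definition unit_vec :: "nat \<Rightarrow> nat \<Rightarrow> 'k::field" where
  "unit_vec i = (\<lambda>n. if n = i then 1 else 0)"

definition arrow_space :: "('k::field, nat \<Rightarrow> 'k) vspace" where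
  "arrow_space = \<lparr>pts = {f. \<forall>n\<ge>3. f n = 0}, scal = (\<lambda>a f n. a * f n)\<rparr>"

text \<open>
  The path coalgebra of a quiver with one arrow, dual to the algebra of upper triangular matrices of size
  two: the basis vectors \<open>0\<close> and \<open>1\<close> are the grouplike elements \<open>g\<close> and \<open>h\<close>, the basis vector \<open>2\<close> is \<open>x\<close>.
\<close>

definition arrow_coalgebra :: "('k::field, nat \<Rightarrow> 'k) coalg" where
  "arrow_coalgebra = \<lparr>pts = pts arrow_space, scal = scal arrow_space,
    comult = (\<lambda>f. let V = arrow_space; W = V \<otimes> V in
      scal W (f 0) (tens V V (unit_vec 0) (unit_vec 0)) + (scal W (f 1) (tens V V (unit_vec 1) (unit_vec 1))
      + scal W (f 2) (tens V V (unit_vec 0) (unit_vec 2) + tens V V (unit_vec 2) (unit_vec 1)))),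
    counit = (\<lambda>f. f 0 + f 1)\<rparr>"

abbreviation "AC \<equiv> arrow_coalgebra"

lemma AC_space [simp]: "pts AC = {f. \<forall>n\<ge>3. f n = 0}" "scal AC = (\<lambda>a f n. a * f n)" "counit AC f = f 0 + f 1"
  by (simp_all add: arrow_coalgebra_def arrow_space_def)

lemma vspace_AC: "is_vspace (AC :: ('k::field, nat \<Rightarrow> 'k) coalg)"
proof -
  have vs: "vector_space (\<lambda>(a::'k) (f::nat \<Rightarrow> 'k) n. a * f n)"
    by unfold_locales (auto simp: fun_eq_iff algebra_simps)
  then interpret vector_space "\<lambda>(a::'k) (f::nat \<Rightarrow> 'k) n. a * f n" .
  show ?thesis using vs by (auto simp: is_vspace_def subspace_def)
qed

lemma comult_AC: "comult AC f = scal (AC \<otimes> AC) (f 0) (tens AC AC (unit_vec 0) (unit_vec 0)) + (scal (AC \<otimes> AC) (f 1) (tens AC AC (unit_vec 1) (unit_vec 1))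
      + scal (AC \<otimes> AC) (f 2) (tens AC AC (unit_vec 0) (unit_vec 2) + tens AC AC (unit_vec 2) (unit_vec 1)))"
proof -
  have s: "pts AC = pts arrow_space" "scal AC = scal arrow_space" by (simp_all add: arrow_coalgebra_def)
  show ?thesis
    unfolding same_space_tensor[OF s] by (simp add: arrow_coalgebra_def Let_def)
qed

lemma unit_vec_AC [simp]: "i < 3 \<Longrightarrow> unit_vec i \<in> pts AC"
  by (auto simp: unit_vec_def)

lemma unit_vec_simps [simp]: "unit_vec i i = 1" "i \<noteq> j \<Longrightarrow> unit_vec i j = 0"
  by (auto simp: unit_vec_def)

lemma lin_comult_AC: "lin AC (AC \<otimes> AC) (comult AC)"
proof -
  note ts = tens_mem[OF vspace_AC vspace_AC] vspace_add[OF is_vspace_tensor] vspace_scal[OF is_vspace_tensor]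
  have "lin AC (AC \<otimes> AC) (\<lambda>f. scal (AC \<otimes> AC) (f 0) (tens AC AC (unit_vec 0) (unit_vec 0)) + (scal (AC \<otimes> AC) (f 1) (tens AC AC (unit_vec 1) (unit_vec 1))
      + scal (AC \<otimes> AC) (f 2) (tens AC AC (unit_vec 0) (unit_vec 2) + tens AC AC (unit_vec 2) (unit_vec 1))))"
    by (intro lin_plus lin_scal_left is_vspace_tensor ts unit_vec_AC) (simp_all add: lin_def)
  then show ?thesis by (subst lin_cong[OF vspace_AC comult_AC])
qed

lemma lift_comult_AC:
  assumes U: "is_vspace U" and F: "bilin AC AC U F"
  shows "lift AC AC U F (comult AC f) = scal U (f 0) (F (unit_vec 0) (unit_vec 0)) + (scal U (f 1) (F (unit_vec 1) (unit_vec 1))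
      + scal U (f 2) (F (unit_vec 0) (unit_vec 2) + F (unit_vec 2) (unit_vec 1)))"
proof -
  note ts = tens_mem[OF vspace_AC vspace_AC] vspace_add[OF is_vspace_tensor] vspace_scal[OF is_vspace_tensor] unit_vec_AC
  note L = lin_lift[OF vspace_AC vspace_AC U F]
  show ?thesis
    unfolding comult_AC
    by (simp only: lin_add[OF L] lin_scal[OF L] lift_tens[OF vspace_AC vspace_AC U F] ts
        numeral_3_eq_3 zero_less_Suc lessI less_SucI one_less_numeral_iff numeral_2_eq_2 One_nat_def)
qed

lemma AC_expand: "f \<in> pts AC \<Longrightarrow> scal AC (f 0) (unit_vec 0) + (scal AC (f 1) (unit_vec 1) + scal AC (f 2) (unit_vec 2)) = f"
proof (rule ext)
  fix n :: nat assume f: "f \<in> pts AC"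
  consider "n = 0" | "n = 1" | "n = 2" | "n \<ge> 3" by linarith
  then show "(scal AC (f 0) (unit_vec 0) + (scal AC (f 1) (unit_vec 1) + scal AC (f 2) (unit_vec 2))) n = f n"
    by cases (use f in \<open>auto simp: unit_vec_def\<close>)
qed

lemma coalgebra_AC: "coalgebra AC"
  unfolding coalgebra_coalg_str
proof
  show "is_vspace AC" "lin AC (AC \<otimes> AC) (comult AC)" by (fact vspace_AC lin_comult_AC)+
  let ?U = "AC \<otimes> (AC \<otimes> AC)"
  note side = bilinI lin_lift_param lin_lift_comp tens_lins is_vspace_tensor vspace_AC lin_comult_AC lin_mem[OF lin_comult_AC] unit_vec_AC
  show "coassociative AC (comult AC)"
    unfolding coassociative_iff[OF vspace_AC lin_comult_AC]
  proof
    fix f assume "f \<in> pts AC"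
    let ?t = "\<lambda>i j k. tens AC (AC \<otimes> AC) (unit_vec i) (tens AC AC (unit_vec j) (unit_vec k))"
    have 1: "lift AC AC ?U (\<lambda>p q. tens AC (AC \<otimes> AC) p (tens AC AC q b)) (comult AC a) =
      scal ?U (a 0) (tens AC (AC \<otimes> AC) (unit_vec 0) (tens AC AC (unit_vec 0) b)) +
      (scal ?U (a 1) (tens AC (AC \<otimes> AC) (unit_vec 1) (tens AC AC (unit_vec 1) b)) +
      scal ?U (a 2) (tens AC (AC \<otimes> AC) (unit_vec 0) (tens AC AC (unit_vec 2) b) + tens AC (AC \<otimes> AC) (unit_vec 2) (tens AC AC (unit_vec 1) b)))"
      if "b \<in> pts AC" for a b
      by (rule lift_comult_AC) (use that in \<open>auto intro!: side simp del: AC_space\<close>)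
    have "lift AC AC ?U (\<lambda>a b. lift AC AC ?U (\<lambda>p q. tens AC (AC \<otimes> AC) p (tens AC AC q b)) (comult AC a)) (comult AC f) =
      scal ?U (f 0) (?t 0 0 0) + (scal ?U (f 1) (?t 1 1 1) + scal ?U (f 2) (?t 0 0 2 + (?t 0 2 1 + ?t 2 1 1)))"
      by (subst lift_comult_AC) (auto intro!: side simp: 1 scal_simps(4,5)[OF is_vspace_tensor] simp del: AC_space)
    moreover have 2: "tens AC (AC \<otimes> AC) a (comult AC b) = lift AC AC ?U (\<lambda>p q. tens AC (AC \<otimes> AC) a (tens AC AC p q)) (comult AC b)"
      if "a \<in> pts AC" "b \<in> pts AC" for a b
      by (rule eq_lift[where h = "tens AC (AC \<otimes> AC) a"]) (use that in \<open>auto intro!: side simp del: AC_space\<close>)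
    have 3: "tens AC (AC \<otimes> AC) a (comult AC b) = scal ?U (b 0) (tens AC (AC \<otimes> AC) a (tens AC AC (unit_vec 0) (unit_vec 0))) +
      (scal ?U (b 1) (tens AC (AC \<otimes> AC) a (tens AC AC (unit_vec 1) (unit_vec 1))) +
      scal ?U (b 2) (tens AC (AC \<otimes> AC) a (tens AC AC (unit_vec 0) (unit_vec 2)) + tens AC (AC \<otimes> AC) a (tens AC AC (unit_vec 2) (unit_vec 1))))"
      if "a \<in> pts AC" "b \<in> pts AC" for a b
      unfolding 2[OF that] by (rule lift_comult_AC) (use that in \<open>auto intro!: side simp del: AC_space\<close>)
    have "lift AC AC ?U (\<lambda>a b. tens AC (AC \<otimes> AC) a (comult AC b)) (comult AC f) =
      scal ?U (f 0) (?t 0 0 0) + (scal ?U (f 1) (?t 1 1 1) + scal ?U (f 2) (?t 0 0 2 + (?t 0 2 1 + ?t 2 1 1)))"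
      by (subst lift_comult_AC) (auto intro!: side simp: 3 scal_simps(4,5)[OF is_vspace_tensor] add.assoc simp del: AC_space)
    ultimately show "lift AC AC ?U (\<lambda>a b. lift AC AC ?U (\<lambda>p q. tens AC (AC \<otimes> AC) p (tens AC AC q b)) (comult AC a)) (comult AC f) =
      lift AC AC ?U (\<lambda>a b. tens AC (AC \<otimes> AC) a (comult AC b)) (comult AC f)" by simp
  qed
  have e: "lin AC ground (counit AC)" by (auto simp: lin_def algebra_simps)
  have b: "bilin AC AC AC (\<lambda>y z. scal AC (counit AC y) z)" "bilin AC AC AC (\<lambda>y z. scal AC (counit AC z) y)"
    by (intro bilinI lin_scal_left lin_scal_right lin_ident e vspace_AC; assumption)+
  show "is_counit AC (comult AC) (counit AC)"
    unfolding is_counit_def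
  proof (intro conjI ballI e)
    fix f assume f: "f \<in> pts AC"
    show "lift AC AC AC (\<lambda>y z. scal AC (counit AC y) z) (comult AC f) = f"
      "lift AC AC AC (\<lambda>y z. scal AC (counit AC z) y) (comult AC f) = f"
      unfolding lift_comult_AC[OF vspace_AC b(1)] lift_comult_AC[OF vspace_AC b(2)]
      using AC_expand[OF f] by (simp_all add: plus_fun_def)
  qed
qed

interpretation A: coalg_pair AC AC
  by unfold_locales (rule coalgebra_AC)+

text \<open>
  The form \<open>\<epsilon> \<otimes> \<epsilon> + s x\<^sup>* \<otimes> x\<^sup>*\<close>.  As \<open>x\<^sup>* x\<^sup>* = 0\<close> in the dual algebra, its inverse for either of the two products is the
  form with \<open>- s\<close>.
\<close>

definition arrow_form where
  "arrow_form s = lift AC AC ground (\<lambda>c d. (c 0 + c 1) * (d 0 + d 1) + s * (c 2 * d 2))"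

lemma arrow_form:
  shows lin_arrow_form: "lin A.X ground (arrow_form s)"
    and arrow_form_tens: "c \<in> pts AC \<Longrightarrow> d \<in> pts AC \<Longrightarrow> arrow_form s (tens AC AC c d) = (c 0 + c 1) * (d 0 + d 1) + s * (c 2 * d 2)"
proof -
  have b: "bilin AC AC ground (\<lambda>c d. (c 0 + c 1) * (d 0 + d 1) + s * (c 2 * d 2))"
    by (auto simp: bilin_def lin_def algebra_simps)
  show "lin A.X ground (arrow_form s)"
    and "c \<in> pts AC \<Longrightarrow> d \<in> pts AC \<Longrightarrow> arrow_form s (tens AC AC c d) = (c 0 + c 1) * (d 0 + d 1) + s * (c 2 * d 2)"
    unfolding arrow_form_def by (intro lin_lift lift_tens b vspace_AC is_vspace_ground; assumption)+
qed

text \<open>The Sweedler sum over \<open>f\<close> of a scalar-valued bilinear \<open>F\<close>, computed in the basis.\<close>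

definition arrow_sum :: "(nat \<Rightarrow> 'k::field) \<Rightarrow> ((nat \<Rightarrow> 'k) \<Rightarrow> (nat \<Rightarrow> 'k) \<Rightarrow> 'k) \<Rightarrow> 'k" where
  "arrow_sum f F = f 0 * F (unit_vec 0) (unit_vec 0) + f 1 * F (unit_vec 1) (unit_vec 1)
     + f 2 * (F (unit_vec 0) (unit_vec 2) + F (unit_vec 2) (unit_vec 1))"

lemma lift_ground_AC:
  "bilin AC AC ground F \<Longrightarrow> lift AC AC ground F (comult AC f) = arrow_sum f F"
  by (subst lift_comult_AC) (simp_all add: arrow_sum_def)

lemma lift_lift_AC:
  assumes "\<And>b p q. b \<in> pts AC \<Longrightarrow> p \<in> pts AC \<Longrightarrow> q \<in> pts AC \<Longrightarrow> lin AC ground (\<lambda>a. F a b p q)"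
    "\<And>a p q. a \<in> pts AC \<Longrightarrow> p \<in> pts AC \<Longrightarrow> q \<in> pts AC \<Longrightarrow> lin AC ground (\<lambda>b. F a b p q)"
    "\<And>a b q. a \<in> pts AC \<Longrightarrow> b \<in> pts AC \<Longrightarrow> q \<in> pts AC \<Longrightarrow> lin AC ground (\<lambda>p. F a b p q)"
    "\<And>a b p. a \<in> pts AC \<Longrightarrow> b \<in> pts AC \<Longrightarrow> p \<in> pts AC \<Longrightarrow> lin AC ground (\<lambda>q. F a b p q)"
    and d: "d \<in> pts AC"
  shows "lift AC AC ground (\<lambda>a b. lift AC AC ground (\<lambda>p q. F a b p q) (comult AC d)) (comult AC c) =
    arrow_sum c (\<lambda>a b. arrow_sum d (\<lambda>p q. F a b p q))"
proof -
  have "lift AC AC ground (\<lambda>a b. lift AC AC ground (\<lambda>p q. F a b p q) (comult AC d)) (comult AC c) =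
    arrow_sum c (\<lambda>a b. lift AC AC ground (\<lambda>p q. F a b p q) (comult AC d))"
    by (rule lift_ground_AC) (auto intro!: bilinI lin_lift_param assms lin_mem[OF lin_comult_AC] vspace_AC simp del: AC_space)
  also have "\<dots> = arrow_sum c (\<lambda>a b. arrow_sum d (\<lambda>p q. F a b p q))"
    unfolding arrow_sum_def[of c] by (subst lift_ground_AC; (intro bilinI assms unit_vec_AC)?; simp)+
  finally show ?thesis .
qed

lemma lift_lift_forms_AC:
  assumes "lin A.X ground \<phi>" "lin A.X ground \<psi>" "d \<in> pts AC"
  shows "lift AC AC ground (\<lambda>a b. lift AC AC ground (\<lambda>p q. \<phi> (tens AC AC a p) * \<psi> (tens AC AC b q)) (comult AC d)) (comult AC c) =
      arrow_sum c (\<lambda>a b. arrow_sum d (\<lambda>p q. \<phi> (tens AC AC a p) * \<psi> (tens AC AC b q)))" (is ?conv)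
    and "lift AC AC ground (\<lambda>a b. lift AC AC ground (\<lambda>p q. \<phi> (tens AC AC b p) * \<psi> (tens AC AC a q)) (comult AC d)) (comult AC c) =
      arrow_sum c (\<lambda>a b. arrow_sum d (\<lambda>p q. \<phi> (tens AC AC b p) * \<psi> (tens AC AC a q)))" (is ?star)
proof -
  note side = lin_mult_left lin_mult_right lin_compose[OF assms(1)] lin_compose[OF assms(2)] tens_lins vspace_AC
  show ?conv by (rule lift_lift_AC) (intro side assms | assumption)+
  show ?star by (rule lift_lift_AC) (intro side assms | assumption)+
qed

lemma arrow_form_inverse:
  shows "is_inverse AC AC (conv AC AC) (arrow_form s) (arrow_form (- s))"
    and "is_inverse AC AC (star AC AC) (arrow_form s) (arrow_form (- s))"
proof -
  have p: "lact A.X A.\<Delta>X ground (arrow_form s) (arrow_form (- s)) t = counit2 AC AC t" (is "?f t = _")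
    and q: "lact A.X A.\<Delta>Y ground (arrow_form s) (arrow_form (- s)) t = counit2 AC AC t" (is "?g t = _")
    if t: "t \<in> pts A.X" for s :: 'a and t
  proof -
    interpret Y: coalg_str "A.X" A.\<Delta>Y "counit2 AC AC" by (rule A.coalg_str_cop)
    have v: "arrow_form s (tens AC AC (unit_vec i) (unit_vec j)) = (unit_vec i 0 + unit_vec i 1) * (unit_vec j 0 + unit_vec j 1) + s * (unit_vec i 2 * unit_vec j 2)"
      if "i < 3" "j < 3" for s :: 'a and i j
      using that by (intro arrow_form_tens unit_vec_AC)
    show "?f t = counit2 AC AC t"
    proof (rule A.eq_on_tensI[OF is_vspace_ground A.X.lin_lact[OF is_vspace_ground lin_arrow_form lin_arrow_form] A.lin_counit2 _ t])
      fix c d :: "nat \<Rightarrow> 'a" assume m: "c \<in> pts AC" "d \<in> pts AC"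
      have "?f (tens AC AC c d) = arrow_sum c (\<lambda>a b. arrow_sum d (\<lambda>p q. arrow_form s (tens AC AC a p) * arrow_form (- s) (tens AC AC b q)))"
        unfolding lact_def A.convol_tens[OF is_vspace_ground bilin_scal(1)[OF is_vspace_ground] lin_arrow_form lin_arrow_form m]
        using lift_lift_forms_AC(1)[OF lin_arrow_form lin_arrow_form m(2)] by simp
      also have "\<dots> = counit2 AC AC (tens AC AC c d)"
        unfolding A.counit2_tens[OF m] by (simp add: arrow_sum_def v algebra_simps)
      finally show "?f (tens AC AC c d) = counit2 AC AC (tens AC AC c d)" .
    qed
    show "?g t = counit2 AC AC t"
    proof (rule A.eq_on_tensI[OF is_vspace_ground Y.lin_lact[OF is_vspace_ground lin_arrow_form lin_arrow_form] A.lin_counit2 _ t])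
      fix c d :: "nat \<Rightarrow> 'a" assume m: "c \<in> pts AC" "d \<in> pts AC"
      have "?g (tens AC AC c d) = arrow_sum c (\<lambda>a b. arrow_sum d (\<lambda>p q. arrow_form s (tens AC AC b p) * arrow_form (- s) (tens AC AC a q)))"
        unfolding A.cop_lact_pure[OF is_vspace_ground lin_arrow_form lin_arrow_form m]
        using lift_lift_forms_AC(2)[OF lin_arrow_form lin_arrow_form m(2)] by simp
      also have "\<dots> = counit2 AC AC (tens AC AC c d)"
        unfolding A.counit2_tens[OF m] by (simp add: arrow_sum_def v algebra_simps)
      finally show "?g (tens AC AC c d) = counit2 AC AC (tens AC AC c d)" .
    qed
  qed
  show "is_inverse AC AC (conv AC AC) (arrow_form s) (arrow_form (- s))"
    unfolding is_inverse_def using p[of _ s] p[of _ "- s"]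
    by (simp add: lin_arrow_form A.conv_eq[OF lin_arrow_form lin_arrow_form])
  show "is_inverse AC AC (star AC AC) (arrow_form s) (arrow_form (- s))"
    unfolding is_inverse_def using q[of _ s] q[of _ "- s"]
    by (simp add: lin_arrow_form A.star_eq[OF lin_arrow_form lin_arrow_form])
qed

text \<open>The twist whose form is the inverse of \<open>e = arrow_form 1\<close>.\<close>

definition arrow_Psi' :: "((nat \<Rightarrow> 'k::field), (nat \<Rightarrow> 'k), 'k) tensor \<Rightarrow> ((nat \<Rightarrow> 'k), (nat \<Rightarrow> 'k), 'k) tensor" where
  "arrow_Psi' = A.twist_of_form (arrow_form (- 1)) \<circ> flip AC AC"

abbreviation "arrow_Psi \<equiv> arrow_Psi' \<circ> flip AC AC"

lemma arrow_Psi: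
  shows arrow_Tw: "arrow_Psi' \<in> Tw AC AC"
    and phi_arrow: "t \<in> pts A.X \<Longrightarrow> phi AC AC arrow_Psi t = arrow_form (- 1) t"
    and lin_phi_arrow: "lin A.X ground (phi AC AC arrow_Psi)"
proof -
  show Tw: "arrow_Psi' \<in> Tw AC AC"
    unfolding arrow_Psi'_def by (rule A.twist_of_form_in_Tw[OF lin_arrow_form])
  show "lin A.X ground (phi AC AC arrow_Psi)" by (rule A.Tw_lin_phi[OF Tw refl])
  show "phi AC AC arrow_Psi t = arrow_form (- 1) t" if "t \<in> pts A.X"
    by (rule A.phi_twist_of_form[OF lin_arrow_form A.Tw_lin_twist[OF Tw refl] _ that])
      (simp add: arrow_Psi'_def flip_flip vspace_AC)
qed

lemma inverse_phi_arrow: "is_inverse AC AC (conv AC AC) (phi AC AC arrow_Psi) (arrow_form 1)"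
  using A.is_inverse_cong[OF arrow_form_inverse(1)[of "- 1"] _ lin_phi_arrow phi_arrow] by simp

lemma eps_arrow: "t \<in> pts A.X \<Longrightarrow> eps AC AC arrow_Psi t = arrow_form 1 t"
  by (rule A.eps_unique[OF inverse_phi_arrow])

lemma lin_eps_arrow: "lin A.X ground (eps AC AC arrow_Psi)"
  by (subst lin_cong[OF is_vspace_tensor eps_arrow]) (simp_all add: lin_arrow_form)

lemma star_invertible_arrow: "star_invertible AC AC (eps AC AC arrow_Psi)"
  using A.is_inverse_cong[OF arrow_form_inverse(2)[of 1] _ lin_eps_arrow eps_arrow]
  unfolding star_invertible_def by blast

interpretation B: twisted_pair AC AC arrow_Psi' arrow_Psi
  by unfold_locales (auto intro: arrow_Tw star_invertible_arrow inverse_phi_arrow simp: conv_invertible_def)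

lemma lin_coord: "lin AC ground (\<lambda>f. f i)" by (simp add: lin_def)

lemma coord_pC:
  assumes "c \<in> pts AC" "d \<in> pts AC"
  shows "B.pC (tens AC AC c d) 0 = c 0 * (d 0 + d 1) + c 2 * d 2"
proof -
  note side = bilinI lin_scal_left lin_scal_right lin_mult_left lin_mult_right lin_compose[OF lin_eps_arrow] tens_lins vspace_AC
    lin_mem[OF lin_comult_AC] lin_coord
  have "B.pC (tens AC AC c d) 0 = lift AC AC ground (\<lambda>c1 c2. scal AC (eps AC AC arrow_Psi (tens AC AC c2 d)) c1 0) (comult AC c)"
    unfolding B.p_C_eq[OF tens_mem[OF vspace_AC vspace_AC assms], symmetric] B.p_C_pure[OF assms]
    by (rule lift_post[where h = "\<lambda>f. f 0"]) (use assms in \<open>auto intro!: side simp del: AC_space\<close>)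
  also have "\<dots> = arrow_sum c (\<lambda>c1 c2. eps AC AC arrow_Psi (tens AC AC c2 d) * c1 0)"
    by (subst lift_ground_AC) (use assms in \<open>auto intro!: side simp del: AC_space simp: AC_space(2)\<close>)
  also have "\<dots> = c 0 * (d 0 + d 1) + c 2 * d 2"
    using assms by (simp add: arrow_sum_def eps_arrow tens_mem vspace_AC arrow_form_tens del: AC_space(1))
  finally show ?thesis .
qed

lemma coord_pD:
  assumes "c \<in> pts AC" "d \<in> pts AC"
  shows "B.pD (tens AC AC c d) 0 = (c 0 + c 1) * d 0"
proof -
  note side = bilinI lin_scal_left lin_scal_right lin_mult_left lin_mult_right lin_compose[OF lin_eps_arrow] tens_lins vspace_AC
    lin_mem[OF lin_comult_AC] lin_coord
  have "B.pD (tens AC AC c d) 0 = lift AC AC ground (\<lambda>d1 d2. scal AC (eps AC AC arrow_Psi (tens AC AC c d1)) d2 0) (comult AC d)"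
    unfolding B.p_D_eq[OF tens_mem[OF vspace_AC vspace_AC assms], symmetric] B.p_D_pure[OF assms]
    by (rule lift_post[where h = "\<lambda>f. f 0"]) (use assms in \<open>auto intro!: side simp del: AC_space\<close>)
  also have "\<dots> = arrow_sum d (\<lambda>d1 d2. eps AC AC arrow_Psi (tens AC AC c d1) * d2 0)"
    by (subst lift_ground_AC) (use assms in \<open>auto intro!: side simp del: AC_space simp: AC_space(2)\<close>)
  also have "\<dots> = (c 0 + c 1) * d 0"
    using assms by (simp add: arrow_sum_def eps_arrow tens_mem vspace_AC arrow_form_tens del: AC_space(1))
  finally show ?thesis .
qed

lemma arrow_convol:
  assumes F: "lin A.X AC F" and G: "lin A.X AC G" and m: "bilin AC AC ground m" and c: "c \<in> pts AC" and d: "d \<in> pts AC"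
  shows "convol A.X A.\<Delta>X ground m F G (tens AC AC c d) =
    arrow_sum c (\<lambda>a b. arrow_sum d (\<lambda>p q. m (F (tens AC AC a p)) (G (tens AC AC b q))))"
  unfolding A.convol_tens[OF is_vspace_ground m F G c d]
  by (rule lift_lift_AC) (intro lin_bilin_left[OF m] lin_bilin_right[OF m] lin_mem[OF F] lin_mem[OF G] lin_compose[OF F] lin_compose[OF G] tens_lins vspace_AC d | assumption)+

text \<open>
  The two maps are compared at \<open>\<mu> (x \<otimes> x)\<close> by the form \<open>g\<^sup>* \<otimes> g\<^sup>*\<close>.  By \<open>coord_pD\<close> and \<open>coord_pC\<close> the only term
  of \<open>(p_D \<triangleleft> \<phi>) \<odot> p_C\<close> that survives is that of \<open>(g \<otimes> g) \<otimes> (g \<otimes> g) \<otimes> (x \<otimes> x)\<close>, with value \<open>1\<close>.  The element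
  \<open>\<mu> (x \<otimes> x)\<close> itself is \<open>x \<otimes> x + g \<otimes> h\<close>, on which \<open>g\<^sup>* \<otimes> g\<^sup>*\<close> vanishes.
\<close>

lemma tilde_arrow_not_flip:
  "\<exists>t\<in>pts ((AC :: ('k::field, nat \<Rightarrow> 'k) coalg) \<otimes> AC). tilde_twist AC AC arrow_Psi t \<noteq> flip AC AC t"
proof -
  let ?m = "\<lambda>(d :: nat \<Rightarrow> 'k) c. d 0 * c (0::nat)"
  let ?z = "tens (AC :: ('k, nat \<Rightarrow> 'k) coalg) AC (unit_vec 2) (unit_vec 2)"
  have m: "bilin AC AC ground ?m" by (auto simp: bilin_def lin_def algebra_simps)
  have z: "?z \<in> pts A.X" by (intro tens_mem vspace_AC unit_vec_AC) auto
  have mz: "B.\<mu> ?z \<in> pts A.X" by (rule lin_mem[OF B.lin_mu z])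
  have m': "bilin AC AC ground (\<lambda>c d. ?m d c)" by (auto simp: bilin_def lin_def algebra_simps)
  have u: "unit_vec 2 \<in> pts AC" by (rule unit_vec_AC) simp
  have pD: "lin A.X AC B.pD" and pC: "lin A.X AC B.pC"
    and pDp: "lin A.X AC (ract A.X A.\<Delta>X AC B.pD (phi AC AC arrow_Psi))"
    by (intro B.lins)+
  have coord: "(ract A.X A.\<Delta>X AC B.pD (phi AC AC arrow_Psi)) (tens AC AC c d) 0 =
    arrow_sum c (\<lambda>a b. arrow_sum d (\<lambda>p q. B.pD (tens AC AC a p) 0 * arrow_form (- 1) (tens AC AC b q)))"
    if "c \<in> pts AC" "d \<in> pts AC" for c d
  proof -
    have l: "lin A.X ground (\<lambda>x. B.pD x 0)"
      by (rule lin_compose[OF lin_coord pD])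
    have "(ract A.X A.\<Delta>X AC B.pD (phi AC AC arrow_Psi)) (tens AC AC c d) 0 =
      (ract A.X A.\<Delta>X ground (\<lambda>x. B.pD x 0) (phi AC AC arrow_Psi)) (tens AC AC c d)"
      by (rule A.X.ract_post[OF vspace_AC is_vspace_ground lin_coord pD lin_phi_arrow tens_mem[OF vspace_AC vspace_AC that]])
    also have "\<dots> = (lact A.X A.\<Delta>X ground (\<lambda>x. B.pD x 0) (arrow_form (- 1))) (tens AC AC c d)"
      unfolding A.X.ract_ground by (rule fun_cong[OF lact_cong]) (simp_all add: phi_arrow)
    also have "\<dots> = arrow_sum c (\<lambda>a b. arrow_sum d (\<lambda>p q. B.pD (tens AC AC a p) 0 * arrow_form (- 1) (tens AC AC b q)))"
      unfolding lact_def[of _ _ ground] A.convol_tens[OF is_vspace_ground bilin_scal(1)[OF is_vspace_ground] l lin_arrow_form that]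
      using lift_lift_forms_AC(1)[OF l lin_arrow_form that(2)] by simp
    finally show ?thesis .
  qed
  have "lift AC AC ground ?m (tilde_twist AC AC arrow_Psi (B.\<mu> ?z)) =
    convol A.X A.\<Delta>X ground ?m (ract A.X A.\<Delta>X AC B.pD (phi AC AC arrow_Psi)) B.pC ?z"
    unfolding B.tilde_mu[OF z] by (rule A.X.lift_tprod) (intro B.lins m z)+
  also have "\<dots> = 1"
    unfolding arrow_convol[OF pDp pC m u u]
    by (simp add: arrow_sum_def coord coord_pC coord_pD arrow_form_tens del: AC_space)
  finally have 1: "lift AC AC ground ?m (tilde_twist AC AC arrow_Psi (B.\<mu> ?z)) = 1" .
  have "lift AC AC ground ?m (flip AC AC (B.\<mu> ?z)) = lift AC AC ground (\<lambda>c d. ?m d c) (B.\<mu> ?z)"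
    by (rule lift_flip) (intro vspace_AC is_vspace_ground m mz)+
  also have "\<dots> = convol A.X A.\<Delta>X ground (\<lambda>c d. ?m d c) A.\<pi>C B.pD ?z"
    by (rule A.X.lift_tprod) (intro B.lins m' z)+
  also have "\<dots> = 0"
    unfolding arrow_convol[OF A.lin_piC pD m' u u]
    by (simp add: arrow_sum_def coord_pD A.piC_tens del: AC_space(1))
  finally have 2: "lift AC AC ground ?m (flip AC AC (B.\<mu> ?z)) = 0" .
  have "tilde_twist AC AC arrow_Psi (B.\<mu> ?z) \<noteq> flip AC AC (B.\<mu> ?z)"
    using 1 2 by auto
  with mz show ?thesis by blast
qed

theorem corollary4p12:
  fixes C :: "('k::field, 'c::ab_group_add) coalg"
    and D :: "('k, 'd::ab_group_add) coalg"
    and \<Psi>' :: "('d, 'c, 'k) tensor \<Rightarrow> ('d, 'c, 'k) tensor"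
    and \<Psi> :: "('c, 'd, 'k) tensor \<Rightarrow> ('d, 'c, 'k) tensor"
  assumes "coalgebra C" and "coalgebra D"
    and "\<Psi>' \<in> Tw C D" and "\<Psi> = \<Psi>' \<circ> flip C D"
    and "conv_invertible C D (phi C D \<Psi>)"
    and "star_invertible C D (eps C D \<Psi>)"
  shows "twist C D (tilde_twist C D \<Psi>) \<and> conormal C D (tilde_twist C D \<Psi>) \<and>
    twisted_tensor C D \<Psi> \<simeq> twisted_tensor C D (tilde_twist C D \<Psi>) \<and>
    twisted_tensor C D (tilde_twist C D \<Psi>) \<simeq> tensor_coalgebra C D \<and>
    (\<exists>(C0 :: ('k, nat \<Rightarrow> 'k) coalg) (D0 :: ('k, nat \<Rightarrow> 'k) coalg) \<Psi>0'.
       let \<Psi>0 = \<Psi>0' \<circ> flip C0 D0 in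
       coalgebra C0 \<and> coalgebra D0 \<and> \<Psi>0' \<in> Tw C0 D0 \<and>
       conv_invertible C0 D0 (phi C0 D0 \<Psi>0) \<and> star_invertible C0 D0 (eps C0 D0 \<Psi>0) \<and>
       (\<exists>t\<in>pts (C0 \<otimes> D0). tilde_twist C0 D0 \<Psi>0 t \<noteq> flip C0 D0 t))"
proof (intro conjI)
  interpret twisted_pair C D \<Psi>' \<Psi>
    by unfold_locales (fact assms)+
  show "twist C D (tilde_twist C D \<Psi>)" unfolding twist_def by (rule lin_tilde)
  show "conormal C D (tilde_twist C D \<Psi>)" by (rule conormal_tilde)
  show "twisted_tensor C D \<Psi> \<simeq> twisted_tensor C D (tilde_twist C D \<Psi>)"
    unfolding isomorphic_def using iso_mu by blast
  \<comment> \<open>the composition of \<open>\<alpha>\<close> with the inverse of \<open>\<mu>\<close>\<close>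
  show "twisted_tensor C D (tilde_twist C D \<Psi>) \<simeq> tensor_coalgebra C D"
    unfolding isomorphic_def using coalgebra_iso_comp[OF coalgebra_iso_inverse[OF iso_mu] iso_alpha] by blast
  show "\<exists>(C0 :: ('k, nat \<Rightarrow> 'k) coalg) (D0 :: ('k, nat \<Rightarrow> 'k) coalg) \<Psi>0'.
       let \<Psi>0 = \<Psi>0' \<circ> flip C0 D0 in
       coalgebra C0 \<and> coalgebra D0 \<and> \<Psi>0' \<in> Tw C0 D0 \<and>
       conv_invertible C0 D0 (phi C0 D0 \<Psi>0) \<and> star_invertible C0 D0 (eps C0 D0 \<Psi>0) \<and>
       (\<exists>t\<in>pts (C0 \<otimes> D0). tilde_twist C0 D0 \<Psi>0 t \<noteq> flip C0 D0 t)"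
    by (rule exI[of _ AC], rule exI[of _ AC], rule exI[of _ arrow_Psi'])
      (simp add: Let_def coalgebra_AC arrow_Tw B.conv_inv star_invertible_arrow tilde_arrow_not_flip del: AC_space)
qed

end
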